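(* Let $\alpha>0$ and $\beta\in\mathbb R$. If $1\le p,q<\infty$, then $\mathcal S(\mathbb R^d)$ is dense in $M^{p,q}_{\alpha,\beta}$.
   Context: Conventions: $\widehat f(\eta)=\int_{\mathbb R^d}f(t)e^{-it\cdot\eta}\,dt$; $\langle f,g\rangle=\int f\overline g$, extended to a sesquilinear pairing of $\mathcal S'$ with $\mathcal S$; $B(c,r)$ is a Euclidean ball. Subdyadic lattice at scale $\rho\in(0,\rho_0]$. Here $\rho_0,a>0$ are fixed sufficiently small constants and $b>0$ a fixed constant, depending only on $d,\alpha$. For $n\in\mathbb N_0$ let $A_n=\{2^n\le|\xi|<2^{n+1}\}$, $h_n=\rho2^{n(1-\alpha)}$. Partition $\mathbb R^d$ into half-open cubes of side $h_n$ and choose one point of $A_n$ in each cube meeting $A_n$ (candidates). Order all candidates first by $n$ and arbitrarily inside each annulus, and process them in this order, retaining a candidate $\xi$ exactly when the ball $\{|\eta-\xi|<a\rho|\xi|^{1-\alpha}\}$ is disjoint from all such balls of previously retained candidates. Enumerate the retained points as $\{\xi_k\}_{k\in\mathbb N}$ and set $x_j^k=b\rho|\xi_k|^{\alpha-1}j$, $j\in\mathbb Z^d$; $\Omega_\alpha=\{(x_j^k,\xi_k)\}$. There is a constant $A_{\mathrm{cov}}>1$ depending only on $d,\alpha$ such that the balls $\{|\eta-\xi_k|\le A_{\mathrm{cov}}\rho|\xi_k|^{1-\alpha}\}$ cover $\{|\eta|\ge1\}$. A subdyadic frame pair $(\phi,\Omega_\alpha)$ is fixed: $\phi\in\mathcal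 S(\mathbb R^d)$ is real-valued, even, $L^2$-normalized, with $\widehat\phi\in C_c^\infty$, $\operatorname{supp}\widehat\phi\subset B(0,R_1)$, $|\widehat\phi|\ge m_0>0$ on $\{|\zeta|\le R_0\}$, where $3\cdot2^{\max\{\alpha-1,0\}}<R_0<R_1$; and $\Omega_\alpha$ is a subdyadic lattice at a scale $\rho_\ast\le\rho_0$, i.e. $\Omega_\alpha=\{(x_j^k,\xi_k):k\in\mathbb N,\ j\in\mathbb Z^d\}$ where the $\xi_k$ are the centers retained by the selection procedure run with $\rho=\rho_\ast$ and $x_j^k=b\rho_\ast|\xi_k|^{\alpha-1}j$, with $A_{\mathrm{cov}}\rho_\ast<R_0$ and $b\rho_\ast R_1<\pi$. Packets: $\phi_{x,\xi}(t)=|\xi|^{\frac d2(1-\alpha)}\phi((t-x)|\xi|^{1-\alpha})e^{it\cdot\xi}$. For $f\in\mathcal S'(\mathbb R^d)$ put $c_{j,k}(f)=\langle f,\phi_{x_j^k,\xi_k}\rangle$. For $1\le p,q\le\infty$, $M^{p,q}_{\alpha,\beta}$ is the set of $f\in\mathcal S'(\mathbb R^d)$ with $\|f\|_{M^{p,q}_{\alpha,\beta}}=\big(\sum_k(\sum_j|c_{j,k}(f)|^p)^{q/p}(1+|\xi_k|)^{\beta q}\big)^{1/q}<\infty$ (suprema if $p$ or $q$ is infinite). *)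

theory Defs
  imports "HOL-Analysis.Analysis" "HOL-Library.Disjoint_Sets"
begin

section \<open>Schwartz functions and tempered distributions\<close>

definition partial_deriv :: "'n::finite \<Rightarrow> (real^'n \<Rightarrow> complex) \<Rightarrow> real^'n \<Rightarrow> complex" where
  "partial_deriv i f x = vector_derivative (\<lambda>s. f (x + s *\<^sub>R axis i 1)) (at 0)"

definition iter_partial :: "'n::finite list \<Rightarrow> (real^'n \<Rightarrow> complex) \<Rightarrow> real^'n \<Rightarrow> complex" where
  "iter_partial is f = foldr partial_deriv is f"

text \<open>Differentiability of every iterated partial derivative is the same as continuity of every
  iterated partial derivative, i.e. being of class \<open>C\<^sup>\<infinity>\<close>.\<close>

definition smooth :: "(real^'n::finite \<Rightarrow> complex) \<Rightarrow> bool" where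
  "smooth f \<longleftrightarrow> (\<forall>is x. iter_partial is f differentiable (at x))"

definition schwartz :: "(real^'n::finite \<Rightarrow> complex) set" where
  "schwartz = {f. smooth f \<and>
     (\<forall>N is. bdd_above (range (\<lambda>x. (1 + norm x) ^ N * norm (iter_partial is f x))))}"

definition schwartz_seminorm :: "nat \<Rightarrow> (real^'n::finite \<Rightarrow> complex) \<Rightarrow> real" where
  "schwartz_seminorm N f =
     (SUP (is, x) \<in> {is. length is \<le> N} \<times> UNIV. (1 + norm x) ^ N * norm (iter_partial is f x))"

text \<open>A tempered distribution is a complex-linear functional on the Schwartz space, continuous for
  the topology of the increasing seminorms above. Functionals are represented by total functions
  with value \<open>0\<close> outside the Schwartz space, so that equality of distributions is equality of
  functions.\<close>

definition tempered :: "((real^'n::finite \<Rightarrow> complex) \<Rightarrow> complex) set" where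
  "tempered = {u.
     (\<forall>g\<in>schwartz. \<forall>h\<in>schwartz. u (\<lambda>t. g t + h t) = u g + u h) \<and>
     (\<forall>c. \<forall>g\<in>schwartz. u (\<lambda>t. c * g t) = c * u g) \<and>
     (\<exists>C N. \<forall>g\<in>schwartz. norm (u g) \<le> C * schwartz_seminorm N g) \<and>
     (\<forall>g. g \<notin> schwartz \<longrightarrow> u g = 0)}"

text \<open>A distribution \<open>u\<close> acts bilinearly, \<open>u g = \<integral>u g\<close>; the sesquilinear pairing
  \<open>\<langle>u, g\<rangle> = \<integral>u cnj g\<close> therefore conjugates the test function.\<close>

definition pairing :: "((real^'n::finite \<Rightarrow> complex) \<Rightarrow> complex) \<Rightarrow> (real^'n \<Rightarrow> complex) \<Rightarrow> complex" where
  "pairing u g = u (\<lambda>t. cnj (g t))"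

definition distr_of :: "(real^'n::finite \<Rightarrow> complex) \<Rightarrow> (real^'n \<Rightarrow> complex) \<Rightarrow> complex" where
  "distr_of f g = (if g \<in> schwartz then (LINT t|lborel. f t * g t) else 0)"

definition fourier :: "(real^'n::finite \<Rightarrow> complex) \<Rightarrow> real^'n \<Rightarrow> complex" where
  "fourier f \<eta> = (LINT t|lborel. f t * cis (- (t \<bullet> \<eta>)))"

section \<open>Subdyadic lattices\<close>

definition annulus :: "nat \<Rightarrow> (real^'n::finite) set" where
  "annulus n = {\<xi>. 2 ^ n \<le> norm \<xi> \<and> norm \<xi> < 2 ^ (n + 1)}"

definition half_open_cube :: "real^'n::finite \<Rightarrow> real \<Rightarrow> (real^'n) set" where
  "half_open_cube c h = {x. \<forall>i. c $ i \<le> x $ i \<and> x $ i < c $ i + h}"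

definition cube_partition :: "real \<Rightarrow> (real^'n::finite) set set \<Rightarrow> bool" where
  "cube_partition h P \<longleftrightarrow> partition_on UNIV P \<and> (\<forall>Q\<in>P. \<exists>c. Q = half_open_cube c h)"

definition separation_ball :: "real \<Rightarrow> real \<Rightarrow> real \<Rightarrow> real^'n::finite \<Rightarrow> (real^'n) set" where
  "separation_ball \<alpha> a \<rho> \<xi> = {\<eta>. norm (\<eta> - \<xi>) < a * \<rho> * norm \<xi> powr (1 - \<alpha>)}"

text \<open>Greedy selection: the candidate \<open>c i\<close> is kept iff its ball misses those of all candidates
  kept earlier.\<close>

fun retained :: "real \<Rightarrow> real \<Rightarrow> real \<Rightarrow> (nat \<Rightarrow> real^'n::finite) \<Rightarrow> nat \<Rightarrow> bool" where
  "retained \<alpha> a \<rho> c i \<longleftrightarrow>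
     (\<forall>j\<in>{..<i}. retained \<alpha> a \<rho> c j \<longrightarrow>
        disjnt (separation_ball \<alpha> a \<rho> (c i)) (separation_ball \<alpha> a \<rho> (c j)))"

declare retained.simps [simp del]

text \<open>\<open>P n\<close> is the cube partition used for the \<open>n\<close>-th annulus, \<open>pt n Q\<close> the point chosen in the cube
  \<open>Q\<close>, and \<open>c\<close> lists all candidates by increasing annulus. There are finitely many candidates in
  each annulus, so the order of processing has type \<open>\<omega>\<close>.\<close>

definition candidate_order ::
    "real \<Rightarrow> real \<Rightarrow> (nat \<Rightarrow> (real^'n::finite) set set) \<Rightarrow> (nat \<Rightarrow> (real^'n) set \<Rightarrow> real^'n) \<Rightarrow>
     (nat \<Rightarrow> real^'n) \<Rightarrow> bool" where
  "candidate_order \<alpha> \<rho> P pt c \<longleftrightarrow>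
     (\<forall>n. cube_partition (\<rho> * 2 powr (real n * (1 - \<alpha>))) (P n)) \<and>
     (\<forall>n. \<forall>Q\<in>P n. Q \<inter> annulus n \<noteq> {} \<longrightarrow> pt n Q \<in> Q \<inter> annulus n) \<and>
     bij_betw c UNIV (\<Union>n. {pt n Q | Q. Q \<in> P n \<and> Q \<inter> annulus n \<noteq> {}}) \<and>
     (\<forall>i j m n. c i \<in> annulus m \<and> c j \<in> annulus n \<and> m < n \<longrightarrow> i < j)"

definition subdyadic_centers :: "real \<Rightarrow> real \<Rightarrow> real \<Rightarrow> (nat \<Rightarrow> real^'n::finite) \<Rightarrow> bool" where
  "subdyadic_centers \<alpha> a \<rho> \<xi> \<longleftrightarrow>
     (\<exists>P pt c. candidate_order \<alpha> \<rho> P pt c \<and> bij_betw \<xi> UNIV (c ` {i. retained \<alpha> a \<rho> c i}))"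

definition lattice_node :: "real \<Rightarrow> real \<Rightarrow> real \<Rightarrow> (nat \<Rightarrow> real^'n::finite) \<Rightarrow> nat \<Rightarrow> int^'n \<Rightarrow> real^'n" where
  "lattice_node \<alpha> b \<rho> \<xi> k j = (b * \<rho> * norm (\<xi> k) powr (\<alpha> - 1)) *\<^sub>R (\<chi> i. real_of_int (j $ i))"

text \<open>\<open>A\<close> is a covering constant uniformly over all scales up to \<open>\<rho>0\<close> and over all choices made in
  the selection procedure. The \<open>itself\<close> argument carries the dimension.\<close>

definition covering_constant :: "'n::finite itself \<Rightarrow> real \<Rightarrow> real \<Rightarrow> real \<Rightarrow> real \<Rightarrow> bool" where
  "covering_constant (_ :: 'n itself) \<alpha> a \<rho>0 A \<longleftrightarrow> A > 1 \<and>
     (\<forall>\<rho> (\<xi> :: nat \<Rightarrow> real^'n). 0 < \<rho> \<and> \<rho> \<le> \<rho>0 \<and> subdyadic_centers \<alpha> a \<rho> \<xi> \<longrightarrow>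
        {\<eta>. norm \<eta> \<ge> 1} \<subseteq> (\<Union>k. {\<eta>. norm (\<eta> - \<xi> k) \<le> A * \<rho> * norm (\<xi> k) powr (1 - \<alpha>)}))"

section \<open>Frame pairs and modulation spaces\<close>

definition subdyadic_window ::
    "real \<Rightarrow> real \<Rightarrow> real \<Rightarrow> real \<Rightarrow> (real^'n::finite \<Rightarrow> real) \<Rightarrow> bool" where
  "subdyadic_window \<alpha> R0 R1 m0 \<phi> \<longleftrightarrow>
     (let \<phi>c = (\<lambda>t. complex_of_real (\<phi> t)) in
      \<phi>c \<in> schwartz \<and>
      (\<forall>t. \<phi> (- t) = \<phi> t) \<and>
      (LINT t|lborel. (\<phi> t)\<^sup>2) = 1 \<and>
      smooth (fourier \<phi>c) \<and>
      compact (closure {\<zeta>. fourier \<phi>c \<zeta> \<noteq> 0}) \<and>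
      closure {\<zeta>. fourier \<phi>c \<zeta> \<noteq> 0} \<subseteq> ball 0 R1 \<and>
      m0 > 0 \<and>
      (\<forall>\<zeta>. norm \<zeta> \<le> R0 \<longrightarrow> m0 \<le> norm (fourier \<phi>c \<zeta>)) \<and>
      3 * 2 powr (max (\<alpha> - 1) 0) < R0 \<and> R0 < R1)"

definition subdyadic_frame_pair ::
    "real \<Rightarrow> real \<Rightarrow> real \<Rightarrow> real \<Rightarrow> real \<Rightarrow> real \<Rightarrow> real \<Rightarrow> real \<Rightarrow>
     (real^'n::finite \<Rightarrow> real) \<Rightarrow> real \<Rightarrow> (nat \<Rightarrow> real^'n) \<Rightarrow> bool" where
  "subdyadic_frame_pair \<alpha> a b \<rho>0 A R0 R1 m0 \<phi> \<rho> \<xi> \<longleftrightarrow>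
     subdyadic_window \<alpha> R0 R1 m0 \<phi> \<and>
     0 < \<rho> \<and> \<rho> \<le> \<rho>0 \<and> subdyadic_centers \<alpha> a \<rho> \<xi> \<and>
     A * \<rho> < R0 \<and> b * \<rho> * R1 < pi"

definition packet :: "real \<Rightarrow> (real^'n::finite \<Rightarrow> real) \<Rightarrow> real^'n \<Rightarrow> real^'n \<Rightarrow> real^'n \<Rightarrow> complex" where
  "packet \<alpha> \<phi> x \<xi> t =
     complex_of_real (norm \<xi> powr (real CARD('n) / 2 * (1 - \<alpha>)) *
                      \<phi> (norm \<xi> powr (1 - \<alpha>) *\<^sub>R (t - x))) * cis (t \<bullet> \<xi>)"

definition frame_coeff ::
    "real \<Rightarrow> real \<Rightarrow> (real^'n::finite \<Rightarrow> real) \<Rightarrow> real \<Rightarrow> (nat \<Rightarrow> real^'n) \<Rightarrow>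
     ((real^'n \<Rightarrow> complex) \<Rightarrow> complex) \<Rightarrow> nat \<Rightarrow> int^'n \<Rightarrow> complex" where
  "frame_coeff \<alpha> b \<phi> \<rho> \<xi> f k j = pairing f (packet \<alpha> \<phi> (lattice_node \<alpha> b \<rho> \<xi> k j) (\<xi> k))"

definition ennreal_powr :: "ennreal \<Rightarrow> real \<Rightarrow> ennreal" where
  "ennreal_powr x r = (if x = \<infinity> then \<infinity> else ennreal (enn2real x powr r))"

definition ell_norm :: "ennreal \<Rightarrow> ('i \<Rightarrow> ennreal) \<Rightarrow> ennreal" where
  "ell_norm p v =
     (if p = \<infinity> then (SUP i. v i)
      else ennreal_powr (\<Sum>\<^sub>\<infinity>i. ennreal_powr (v i) (enn2real p)) (1 / enn2real p))"

definition mod_norm ::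
    "real \<Rightarrow> real \<Rightarrow> real \<Rightarrow> (real^'n::finite \<Rightarrow> real) \<Rightarrow> real \<Rightarrow> (nat \<Rightarrow> real^'n) \<Rightarrow> ennreal \<Rightarrow> ennreal \<Rightarrow>
     ((real^'n \<Rightarrow> complex) \<Rightarrow> complex) \<Rightarrow> ennreal" where
  "mod_norm \<alpha> \<beta> b \<phi> \<rho> \<xi> p q f =
     ell_norm q (\<lambda>k. ell_norm p (\<lambda>j. ennreal (norm (frame_coeff \<alpha> b \<phi> \<rho> \<xi> f k j))) *
                     ennreal ((1 + norm (\<xi> k)) powr \<beta>))"

definition mod_space ::
    "real \<Rightarrow> real \<Rightarrow> real \<Rightarrow> (real^'n::finite \<Rightarrow> real) \<Rightarrow> real \<Rightarrow> (nat \<Rightarrow> real^'n) \<Rightarrow> ennreal \<Rightarrow> ennreal \<Rightarrow>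
     ((real^'n \<Rightarrow> complex) \<Rightarrow> complex) set" where
  "mod_space \<alpha> \<beta> b \<phi> \<rho> \<xi> p q = {f \<in> tempered. mod_norm \<alpha> \<beta> b \<phi> \<rho> \<xi> p q f < \<infinity>}"

end

theory Submission
  imports Defs "HOL-Probability.Characteristic_Functions" "HOL-Probability.Sinc_Integral"
begin

text \<open>
A coefficient of a tempered distribution is, up to a factor that depends on the cell only and a
phase, the value at a lattice point of a band-limited smooth function: the conjugated packet is the
Fourier transform of the modulated window \<open>U\<^sub>k(\<eta>) = V((\<eta> - \<xi>\<^sub>k) / r\<^sub>k)\<close> with
\<open>r\<^sub>k = |\<xi>\<^sub>k|\<^sup>1\<^sup>-\<^sup>\<alpha>\<close> and \<open>V\<close> the Fourier transform of \<open>\<phi>\<close> (\<open>cnj_packet\<close>). Because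
\<open>b \<rho> R1 < \<pi>\<close>, the support of \<open>V\<close> fits strictly into the cube whose dual lattice carries the nodes. Hence a
Fourier multiplier acts on the coefficients of one cell as a discrete convolution, by expanding the
multiplier in a Fourier series on the cube (\<open>fourier_series\<close>, \<open>sampling\<close>).

Approximation takes two steps. First, \<open>f\<close> is truncated in frequency by a smooth cutoff of size
\<open>K\<close>. A dilated cutoff is a superposition of characters of fixed total mass, that is, the truncation is
an average of translates of \<open>f\<close>, and translates are bounded on the coefficients of each cell uniformly in
the cell, by the Schur test and the decay of the Fourier transform of a bump at the dual lattice
(\<open>cell_node_sum\<close>, \<open>truncation_error\<close>). Cells well inside the cutoff are not affected at all, so that the
error is a fixed multiple of a tail of the convergent \<open>q\<close>-th power sum.

Second, only finitely many cells meet the support of the cutoff. The windows do not vanish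
simultaneously at any frequency: the covering constant takes care of \<open>|\<eta>| \<ge> 1\<close>, and the
lower bound on \<open>R0\<close> of the unit ball. By compactness a finite sum of squared windows is positive
on the support of the cutoff, and dividing by it expands the truncated coefficients in the
coefficients of \<open>f\<close> in these cells. Keeping finitely many of them defines a Schwartz function, and the
omitted tails are small because \<open>p\<close> is finite (\<open>finite_approximation\<close>).

That Schwartz functions belong to the space follows from the same bounds together with the
identity \<open>\<xi> = \<eta> - r \<zeta>\<close> on a cell, which gives decay of every polynomial order in \<open>|\<xi>\<^sub>k|\<close>
because \<open>\<alpha> > 0\<close> (\<open>cell_decay\<close>), and from a packing bound for the centers (\<open>centers_sum_bound\<close>).
\<close>

section \<open>Classes of smooth functions\<close>

lemma partial_deriv_eq:
  fixes f :: "real^'n::finite \<Rightarrow> complex"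
  assumes "(f has_derivative D) (at x)"
  shows "partial_deriv i f x = D (axis i 1)"
proof -
  have "((\<lambda>s. x + s *\<^sub>R axis i 1) has_derivative (\<lambda>s. s *\<^sub>R axis i 1)) (at (0::real))"
    by (auto intro!: derivative_eq_intros)
  moreover have "(f has_derivative D) (at (x + 0 *\<^sub>R axis i 1))" using assms by simp
  ultimately have "((\<lambda>s. f (x + s *\<^sub>R axis i 1)) has_derivative (\<lambda>s. D (s *\<^sub>R axis i 1))) (at 0)"
    by (rule has_derivative_compose)
  then have "((\<lambda>s. f (x + s *\<^sub>R axis i 1)) has_vector_derivative D (axis i 1)) (at 0)"
    unfolding has_vector_derivative_def
    using linear_scale[OF has_derivative_linear[OF assms]] by simp
  then show ?thesis unfolding partial_deriv_def by (rule vector_derivative_at)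
qed

lemma partial_deriv_frechet:
  "f differentiable (at x) \<Longrightarrow> partial_deriv i f x = frechet_derivative f (at x) (axis i 1)"
  by (rule partial_deriv_eq) (simp add: frechet_derivative_works[symmetric])

text \<open>Order by order, every partial derivative is differentiable and satisfies the growth condition
\<open>W\<close>. The recursion peels off the innermost derivative, so that closure under products,
quotients and substitutions is an induction on the order that never commutes two derivatives.
With no condition \<open>W\<close> the intersection of all orders is the class of smooth functions, with
rapid decrease it is the Schwartz space.\<close>

primrec diff_class :: "((real^'n::finite \<Rightarrow> complex) \<Rightarrow> bool) \<Rightarrow> nat \<Rightarrow> (real^'n \<Rightarrow> complex) \<Rightarrow> bool" where
  "diff_class W 0 f \<longleftrightarrow> W f \<and> (\<forall>x. f differentiable (at x))"
| "diff_class W (Suc n) f \<longleftrightarrow> W f \<and> (\<forall>x. f differentiable (at x)) \<and> (\<forall>i. diff_class W n (partial_deriv i f))"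

lemma iter_partial_Nil [simp]: "iter_partial [] f = f"
  by (simp add: iter_partial_def)

lemma iter_partial_snoc [simp]: "iter_partial (is @ [i]) f = iter_partial is (partial_deriv i f)"
  by (simp add: iter_partial_def)

lemma iter_partial_Cons: "iter_partial (i # is) f = partial_deriv i (iter_partial is f)"
  by (simp add: iter_partial_def)

lemma diff_class_iff:
  "diff_class W n f \<longleftrightarrow>
    (\<forall>is. length is \<le> n \<longrightarrow> W (iter_partial is f) \<and> (\<forall>x. iter_partial is f differentiable (at x)))"
proof (induction n arbitrary: f)
  case (Suc n)
  have *: "(\<forall>is::'a list. length is \<le> Suc n \<longrightarrow> Q is) \<longleftrightarrow>
      Q [] \<and> (\<forall>i is. length is \<le> n \<longrightarrow> Q (is @ [i]))" for Q
  proof (intro iffI conjI allI impI)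
    fix js :: "'a list"
    assume a: "Q [] \<and> (\<forall>i is. length is \<le> n \<longrightarrow> Q (is @ [i]))" "length js \<le> Suc n"
    then show "Q js" by (cases js rule: rev_cases) auto
  qed auto
  show ?case by (simp add: * Suc.IH)
qed simp

lemma diff_class_0: "diff_class W n f \<Longrightarrow> W f \<and> f differentiable (at x)"
  by (cases n) auto

lemma diff_class_Suc: "diff_class W (Suc n) f \<Longrightarrow> diff_class W n f"
  by (simp add: diff_class_iff del: diff_class.simps)

definition rapid :: "(real^'n::finite \<Rightarrow> complex) \<Rightarrow> bool" where
  "rapid f \<longleftrightarrow> (\<forall>N. \<exists>C. \<forall>x. (1 + norm x) ^ N * norm (f x) \<le> C)"

definition moderate :: "(real^'n::finite \<Rightarrow> complex) \<Rightarrow> bool" where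
  "moderate f \<longleftrightarrow> (\<exists>N C. \<forall>x. norm (f x) \<le> C * (1 + norm x) ^ N)"

lemma smooth_iff_diff_class: "smooth f \<longleftrightarrow> (\<forall>n. diff_class (\<lambda>_. True) n f)"
  unfolding smooth_def diff_class_iff by auto

lemma schwartz_iff_diff_class: "f \<in> schwartz \<longleftrightarrow> (\<forall>n. diff_class rapid n f)"
  unfolding schwartz_def smooth_def diff_class_iff rapid_def bdd_above_def by fastforce

text \<open>The smooth functions of moderate growth together with all derivatives; they multiply the Schwartz
space into itself.\<close>

definition multiplier :: "(real^'n::finite \<Rightarrow> complex) set" where
  "multiplier = {f. \<forall>n. diff_class moderate n f}"

lemma diff_class_mono: "(\<And>f. W f \<Longrightarrow> V f) \<Longrightarrow> diff_class W n f \<Longrightarrow> diff_class V n f"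
  by (simp add: diff_class_iff)

lemma diff_class_partial_deriv:
  "(\<forall>n. diff_class W n f) \<longleftrightarrow> W f \<and> (\<forall>x. f differentiable (at x)) \<and> (\<forall>i n. diff_class W n (partial_deriv i f))"
proof
  assume "\<forall>n. diff_class W n f"
  then have "diff_class W (Suc n) f" for n by blast
  then show "W f \<and> (\<forall>x. f differentiable (at x)) \<and> (\<forall>i n. diff_class W n (partial_deriv i f))"
    by simp
next
  assume a: "W f \<and> (\<forall>x. f differentiable (at x)) \<and> (\<forall>i n. diff_class W n (partial_deriv i f))"
  show "\<forall>n. diff_class W n f"
  proof
    fix n show "diff_class W n f" using a by (cases n) auto
  qed
qed

lemma schwartz_partial_deriv: "f \<in> schwartz \<Longrightarrow> partial_deriv i f \<in> schwartz"
  unfolding schwartz_iff_diff_class using diff_class_partial_deriv[of rapid f] by blast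

lemma schwartz_iter_partial: "f \<in> schwartz \<Longrightarrow> iter_partial is f \<in> schwartz"
  by (induction "is") (auto simp: iter_partial_Cons schwartz_partial_deriv)

lemma schwartz_rapid: "f \<in> schwartz \<Longrightarrow> rapid f"
  and schwartz_differentiable: "f \<in> schwartz \<Longrightarrow> f differentiable (at x)"
  unfolding schwartz_iff_diff_class using diff_class_0[of rapid 0 f] by blast+

lemma smooth_differentiable: "smooth f \<Longrightarrow> f differentiable (at x)"
  unfolding smooth_iff_diff_class using diff_class_0[of _ 0 f] by blast

lemma smooth_partial_deriv: "smooth f \<Longrightarrow> smooth (partial_deriv i f)"
  unfolding smooth_iff_diff_class using diff_class_partial_deriv[of _ f] by blast

lemma schwartz_smooth: "f \<in> schwartz \<Longrightarrow> smooth f"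
  by (simp add: schwartz_def)

lemma multiplier_smooth: "f \<in> multiplier \<Longrightarrow> smooth f"
  unfolding multiplier_def smooth_iff_diff_class using diff_class_mono[of moderate "\<lambda>_. True"] by blast

lemma smooth_continuous_on: "smooth f \<Longrightarrow> continuous_on S f"
  by (meson continuous_at_imp_continuous_on differentiable_imp_continuous_within smooth_differentiable)

lemma schwartz_continuous_on: "f \<in> schwartz \<Longrightarrow> continuous_on S f"
  by (simp add: schwartz_smooth smooth_continuous_on)

lemma rapid_add: "rapid f \<Longrightarrow> rapid g \<Longrightarrow> rapid (\<lambda>x. f x + g x)"
  unfolding rapid_def
proof
  fix N assume "\<forall>N. \<exists>C. \<forall>x. (1 + norm x) ^ N * norm (f x) \<le> C" "\<forall>N. \<exists>C. \<forall>x. (1 + norm x) ^ N * norm (g x) \<le> C"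
  then obtain C D where "\<forall>x. (1 + norm x) ^ N * norm (f x) \<le> C" "\<forall>x. (1 + norm x) ^ N * norm (g x) \<le> D" by blast
  moreover have "(1 + norm x) ^ N * norm (f x + g x) \<le> (1 + norm x) ^ N * norm (f x) + (1 + norm x) ^ N
      * norm (g x)" for x
    unfolding distrib_left[symmetric] by (intro mult_left_mono norm_triangle_ineq) auto
  ultimately have "\<forall>x. (1 + norm x) ^ N * norm (f x + g x) \<le> C + D"
    by (meson add_mono order_trans)
  then show "\<exists>C. \<forall>x. (1 + norm x) ^ N * norm (f x + g x) \<le> C" by blast
qed

lemma moderateI: "(\<And>x. norm (f x) \<le> C * (1 + norm x) ^ N) \<Longrightarrow> moderate f"
  unfolding moderate_def by blast

lemma moderateE:
  assumes "moderate f"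
  obtains N C where "C \<ge> 0" "\<And>x. norm (f x) \<le> C * (1 + norm x) ^ N"
proof -
  obtain N C where NC: "\<And>x. norm (f x) \<le> C * (1 + norm x) ^ N"
    using assms unfolding moderate_def by blast
  have "norm (f x) \<le> \<bar>C\<bar> * (1 + norm x) ^ N" for x
    using NC[of x] by (rule order_trans) (auto intro: mult_right_mono)
  then show ?thesis using that[of "\<bar>C\<bar>" N] by simp
qed

lemma moderate_add: assumes "moderate f" "moderate g" shows "moderate (\<lambda>x. f x + g x)"
proof -
  obtain N C M D where 1: "C \<ge> 0" "\<And>x. norm (f x) \<le> C * (1 + norm x) ^ N"
    and 2: "D \<ge> 0" "\<And>x. norm (g x) \<le> D * (1 + norm x) ^ M"
    using assms by (meson moderateE)
  show ?thesis
  proof (rule moderateI)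
    fix x
    have "norm (f x + g x) \<le> norm (f x) + norm (g x)" by (rule norm_triangle_ineq)
    also have "\<dots> \<le> C * (1 + norm x) ^ N + D * (1 + norm x) ^ M" using 1 2 by (intro add_mono) auto
    also have "\<dots> \<le> C * (1 + norm x) ^ (N + M) + D * (1 + norm x) ^ (N + M)"
      using 1 2 by (intro add_mono mult_left_mono power_increasing) auto
    finally show "norm (f x + g x) \<le> (C + D) * (1 + norm x) ^ (N + M)" by (simp add: distrib_right)
  qed
qed

lemma moderate_mult: assumes "moderate f" "moderate g" shows "moderate (\<lambda>x. f x * g x)"
proof -
  obtain N C M D where 1: "C \<ge> 0" "\<And>x. norm (f x) \<le> C * (1 + norm x) ^ N"
    and 2: "D \<ge> 0" "\<And>x. norm (g x) \<le> D * (1 + norm x) ^ M"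
    using assms by (meson moderateE)
  show ?thesis
  proof (rule moderateI)
    fix x
    have "norm (f x * g x) \<le> (C * (1 + norm x) ^ N) * (D * (1 + norm x) ^ M)"
      unfolding norm_mult using 1 2 by (intro mult_mono) auto
    also have "\<dots> = (C * D) * (1 + norm x) ^ (N + M)" by (simp add: power_add)
    finally show "norm (f x * g x) \<le> (C * D) * (1 + norm x) ^ (N + M)" .
  qed
qed

lemma rapid_moderate_mult: assumes "rapid f" "moderate g" shows "rapid (\<lambda>x. f x * g x)"
  unfolding rapid_def
proof
  fix K
  obtain N C where 1: "C \<ge> 0" "\<And>x. norm (g x) \<le> C * (1 + norm x) ^ N"
    using assms by (meson moderateE)
  obtain D where D: "\<And>x. (1 + norm x) ^ (K + N) * norm (f x) \<le> D" using assms unfolding rapid_def by blast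
  have "(1 + norm x) ^ K * norm (f x * g x) \<le> C * D" for x
  proof -
    have "(1 + norm x) ^ K * norm (f x * g x) \<le> (1 + norm x) ^ K * (norm (f x) * (C * (1 + norm x) ^ N))"
      unfolding norm_mult using 1 by (intro mult_left_mono) auto
    also have "\<dots> = C * ((1 + norm x) ^ (K + N) * norm (f x))" by (simp add: power_add)
    also have "\<dots> \<le> C * D" using D 1 by (intro mult_left_mono) auto
    finally show ?thesis .
  qed
  then show "\<exists>C. \<forall>x. (1 + norm x) ^ K * norm (f x * g x) \<le> C" by blast
qed

lemma partial_deriv_add:
  "f differentiable (at x) \<Longrightarrow> g differentiable (at x) \<Longrightarrow>
   partial_deriv i (\<lambda>x. f x + g x) x = partial_deriv i f x + partial_deriv i g x"
  using partial_deriv_eq[OF has_derivative_add[of f "frechet_derivative f (at x)" "at x" g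
      "frechet_derivative g (at x)"]]
  by (simp add: frechet_derivative_works[symmetric] partial_deriv_frechet)

lemma partial_deriv_mult:
  "f differentiable (at x) \<Longrightarrow> g differentiable (at x) \<Longrightarrow>
   partial_deriv i (\<lambda>x. f x * g x) x = partial_deriv i f x * g x + f x * partial_deriv i g x"
  using partial_deriv_eq[OF has_derivative_mult[of f "frechet_derivative f (at x)" x UNIV g
      "frechet_derivative g (at x)"]]
  by (simp add: frechet_derivative_works[symmetric] partial_deriv_frechet)

lemma diff_class_add:
  assumes W: "\<And>f g. W f \<Longrightarrow> W g \<Longrightarrow> W (\<lambda>x. f x + g x)"
  shows "diff_class W n f \<Longrightarrow> diff_class W n g \<Longrightarrow> diff_class W n (\<lambda>x. f x + g x)"
proof (induction n arbitrary: f g)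
  case (Suc n)
  have "partial_deriv i (\<lambda>x. f x + g x) = (\<lambda>x. partial_deriv i f x + partial_deriv i g x)" for i
    using Suc.prems by (auto simp: partial_deriv_add)
  then show ?case using Suc W by auto
qed (auto intro: W)

text \<open>The Leibniz rule. The two factors may satisfy different growth conditions, which covers at once
products of smooth functions, of Schwartz functions with multipliers, and of multipliers.\<close>

lemma diff_class_mult:
  assumes add: "\<And>f g. W f \<Longrightarrow> W g \<Longrightarrow> W (\<lambda>x. f x + g x)"
    and W: "\<And>f g. U f \<Longrightarrow> V g \<Longrightarrow> W (\<lambda>x. f x * g x)"
  shows "diff_class U n f \<Longrightarrow> diff_class V n g \<Longrightarrow> diff_class W n (\<lambda>x. f x * g x)"
proof (induction n arbitrary: f g)
  case (Suc n)
  have eq: "partial_deriv i (\<lambda>x. f x * g x) = (\<lambda>x. partial_deriv i f x * g x + f x * partial_deriv i g x)" for i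
    using Suc.prems by (auto simp: partial_deriv_mult)
  have 1: "diff_class U n f" "diff_class V n g" using Suc.prems by (blast intro: diff_class_Suc)+
  have 2: "diff_class U n (partial_deriv i f)" "diff_class V n (partial_deriv i g)" for i
    using Suc.prems by simp_all
  have "diff_class W n (\<lambda>x. partial_deriv i f x * g x + f x * partial_deriv i g x)" for i
    by (rule diff_class_add[OF add Suc.IH[OF 2(1) 1(2)] Suc.IH[OF 1(1) 2(2)]])
  moreover have "W (\<lambda>x. f x * g x)" using Suc.prems W by simp
  moreover have "(\<lambda>x. f x * g x) differentiable (at x)" for x
    using Suc.prems by (simp add: differentiable_mult)
  ultimately show ?case by (simp add: eq)
qed (auto intro: W)

lemma schwartz_add: "f \<in> schwartz \<Longrightarrow> g \<in> schwartz \<Longrightarrow> (\<lambda>x. f x + g x) \<in> schwartz"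
  unfolding schwartz_iff_diff_class by (intro allI diff_class_add[where W=rapid, OF rapid_add]) auto

lemma schwartz_mult_multiplier: "f \<in> schwartz \<Longrightarrow> g \<in> multiplier \<Longrightarrow> (\<lambda>x. f x * g x) \<in> schwartz"
  unfolding schwartz_iff_diff_class multiplier_def
  by (intro allI diff_class_mult[where U=rapid and V=moderate
      and W=rapid, OF rapid_add rapid_moderate_mult]) auto

lemma smooth_add: "smooth f \<Longrightarrow> smooth g \<Longrightarrow> smooth (\<lambda>x. f x + g x)"
  unfolding smooth_iff_diff_class by (intro allI diff_class_add) auto

lemma smooth_mult: "smooth f \<Longrightarrow> smooth g \<Longrightarrow> smooth (\<lambda>x. f x * g x)"
  unfolding smooth_iff_diff_class by (intro allI diff_class_mult[of "\<lambda>_. True" "\<lambda>_. True" "\<lambda>_. True"]) auto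

lemma multiplier_mult: "f \<in> multiplier \<Longrightarrow> g \<in> multiplier \<Longrightarrow> (\<lambda>x. f x * g x) \<in> multiplier"
  unfolding multiplier_def by (auto intro!: diff_class_mult[where U=moderate and V=moderate
      and W=moderate, OF moderate_add moderate_mult])

lemma rapid_imp_moderate: "rapid f \<Longrightarrow> moderate f"
proof -
  assume "rapid f"
  then obtain C where "\<And>x. (1 + norm x) ^ 0 * norm (f x) \<le> C" unfolding rapid_def by blast
  then show "moderate f" by (intro moderateI[where N=0 and C=C]) simp
qed

lemma schwartz_multiplier: "f \<in> schwartz \<Longrightarrow> f \<in> multiplier"
  unfolding schwartz_iff_diff_class multiplier_def
  using diff_class_mono[where W=rapid and V=moderate] rapid_imp_moderate by blast

lemma schwartz_mult: "f \<in> schwartz \<Longrightarrow> g \<in> schwartz \<Longrightarrow> (\<lambda>x. f x * g x) \<in> schwartz"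
  by (simp add: schwartz_mult_multiplier schwartz_multiplier)

lemma partial_deriv_const [simp]: "partial_deriv i (\<lambda>_. c) = (\<lambda>_. 0)"
  by (rule ext, rule partial_deriv_eq) simp

lemma const_multiplier: "(\<lambda>_::real^'n::finite. c) \<in> multiplier"
proof -
  have "diff_class moderate n (\<lambda>_::real^'n. c)" for n
  proof (induction n arbitrary: c)
    case 0 show ?case by (auto intro!: moderateI[where N=0])
  next
    case (Suc n) then show ?case by (auto intro!: moderateI[where N=0 and C="norm c"])
  qed
  then show ?thesis by (simp add: multiplier_def)
qed

lemma schwartz_cmult: "f \<in> schwartz \<Longrightarrow> (\<lambda>x. c * f x) \<in> schwartz"
  using schwartz_mult_multiplier[OF _ const_multiplier[of c]] by (simp add: mult.commute)

lemma schwartz_zero: "(\<lambda>_::real^'n::finite. 0) \<in> schwartz"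
proof -
  have "diff_class rapid n (\<lambda>_::real^'n. 0)" for n
    by (induction n) (auto simp: rapid_def)
  then show ?thesis by (simp add: schwartz_iff_diff_class)
qed

lemma schwartz_sum: "(\<And>j. j \<in> J \<Longrightarrow> h j \<in> schwartz) \<Longrightarrow> (\<lambda>x. \<Sum>j\<in>J. h j x) \<in> schwartz"
  by (induction J rule: infinite_finite_induct) (auto intro: schwartz_zero schwartz_add)

lemma coordinate_derivative:
  "((\<lambda>x. complex_of_real (x $ i)) has_derivative (\<lambda>h. complex_of_real (h $ i))) (at x)"
  by (intro has_derivative_of_real bounded_linear_imp_has_derivative bounded_linear_vec_nth)

lemma partial_deriv_coordinate:
  "partial_deriv j (\<lambda>x. complex_of_real (x $ i)) = (\<lambda>_. if i = j then 1 else 0)"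
  by (rule ext, subst partial_deriv_eq[OF coordinate_derivative]) (auto simp: axis_def)

lemma coordinate_multiplier: "(\<lambda>x. complex_of_real (x $ i)) \<in> multiplier"
  unfolding multiplier_def mem_Collect_eq
proof (subst diff_class_partial_deriv, unfold partial_deriv_coordinate, intro conjI allI)
  show "moderate (\<lambda>x. complex_of_real (x $ i))"
  proof (rule moderateI[where C=1 and N=1])
    fix x :: "real^'a"
    have "\<bar>x $ i\<bar> \<le> norm x" by (rule component_le_norm_cart)
    then show "norm (complex_of_real (x $ i)) \<le> 1 * (1 + norm x) ^ 1" by simp
  qed
  show "(\<lambda>x. complex_of_real (x $ i)) differentiable (at x)" for x :: "real^'a"
    using coordinate_derivative differentiable_def by blast
  show "diff_class moderate n (\<lambda>_::real^'a. if i = j then 1 else 0)" for n j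
    using const_multiplier unfolding multiplier_def by blast
qed

lemma cis_derivative:
  fixes y :: "real^'n::finite"
  shows "((\<lambda>x. cis (x \<bullet> y)) has_derivative (\<lambda>h. \<i> * complex_of_real (h \<bullet> y) * cis (x \<bullet> y))) (at x)"
proof -
  have "((\<lambda>x. exp (\<i> * complex_of_real (x \<bullet> y))) has_derivative
      (\<lambda>h. exp (\<i> * complex_of_real (x \<bullet> y)) * (\<i> * complex_of_real (h \<bullet> y)))) (at x)"
    by (rule has_derivative_compose[of _ _ _ _ exp, OF _ DERIV_exp[unfolded has_field_derivative_def]])
      (auto intro!: derivative_eq_intros)
  then show ?thesis by (simp add: cis_conv_exp mult_ac)
qed

lemma partial_deriv_cis:
  fixes y :: "real^'n::finite"
  shows "partial_deriv i (\<lambda>x. cis (x \<bullet> y)) = (\<lambda>x. (\<i> * complex_of_real (y $ i)) * cis (x \<bullet> y))"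
  by (rule ext, subst partial_deriv_eq[OF cis_derivative]) (auto simp: inner_axis inner_commute)

lemma cis_multiplier:
  fixes y :: "real^'n::finite"
  shows "(\<lambda>x. cis (x \<bullet> y)) \<in> multiplier"
proof -
  have d: "(\<lambda>x. cis (x \<bullet> y)) differentiable (at x)" for x
    using cis_derivative differentiable_def by blast
  have m: "moderate (\<lambda>x. cis (x \<bullet> y))" by (auto intro!: moderateI[where N=0 and C=1])
  have "diff_class moderate n (\<lambda>x. cis (x \<bullet> y))" for n
  proof (induction n)
    case (Suc n)
    then show ?case unfolding diff_class.simps partial_deriv_cis
      using d m const_multiplier
      by (auto intro!: diff_class_mult[where U=moderate and V=moderate
          and W=moderate, OF moderate_add moderate_mult] simp: multiplier_def)
  qed (use d m in auto)
  then show ?thesis by (simp add: multiplier_def)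
qed

lemma smooth_const: "smooth (\<lambda>_. c)"
  by (simp add: const_multiplier multiplier_smooth)

lemma smooth_sum: "(\<And>j. j \<in> J \<Longrightarrow> smooth (h j)) \<Longrightarrow> smooth (\<lambda>x. \<Sum>j\<in>J. h j x)"
  by (induction J rule: infinite_finite_induct) (auto intro: smooth_const smooth_add)

lemma smooth_inverse:
  assumes f: "smooth f" and nz: "\<And>x. f x \<noteq> 0"
  shows "smooth (\<lambda>x. inverse (f x))"
proof -
  have d: "f differentiable (at x)" for x by (simp add: f smooth_differentiable)
  have D: "((\<lambda>x. inverse (f x)) has_derivative (\<lambda>h. - (inverse (f x) * frechet_derivative f (at x) h
      * inverse (f x)))) (at x)" for x
    using d nz by (intro Deriv.has_derivative_inverse) (auto simp: frechet_derivative_works)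
  have d': "(\<lambda>x. inverse (f x)) differentiable (at x)" for x
    using D differentiable_def by blast
  have pd: "partial_deriv i (\<lambda>x. inverse (f x)) =
      (\<lambda>x. (-1) * (inverse (f x) * (partial_deriv i f x * inverse (f x))))" for i
    by (rule ext, subst partial_deriv_eq[OF D]) (simp add: d partial_deriv_frechet mult_ac)
  have "diff_class (\<lambda>_. True) n (\<lambda>x. inverse (f x))" for n
  proof (induction n)
    case (Suc n)
    have 1: "diff_class (\<lambda>_. True) n (partial_deriv i f)" for i
      using smooth_partial_deriv[OF f] by (simp add: smooth_iff_diff_class)
    have 2: "diff_class (\<lambda>_::real^'a \<Rightarrow> complex. True) n (\<lambda>_. -1)"
      using smooth_const[unfolded smooth_iff_diff_class] by blast
    have "diff_class (\<lambda>_. True) n (partial_deriv i (\<lambda>x. inverse (f x)))" for i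
      unfolding pd by (intro diff_class_mult[of "\<lambda>_. True" "\<lambda>_. True" "\<lambda>_. True"] 1 2 Suc.IH) auto
    then show ?case using d' by simp
  qed (simp add: d')
  then show ?thesis by (simp add: smooth_iff_diff_class)
qed

lemma partial_deriv_affine:
  assumes "f differentiable (at (r *\<^sub>R x + c))"
  shows "(\<lambda>x. f (r *\<^sub>R x + c)) differentiable (at x)"
    and "partial_deriv i (\<lambda>x. f (r *\<^sub>R x + c)) x = complex_of_real r * partial_deriv i f (r *\<^sub>R x + c)"
proof -
  let ?D = "frechet_derivative f (at (r *\<^sub>R x + c))"
  have f: "(f has_derivative ?D) (at (r *\<^sub>R x + c))"
    using assms by (simp add: frechet_derivative_works)
  have "((\<lambda>x. r *\<^sub>R x + c) has_derivative (\<lambda>h. r *\<^sub>R h)) (at x)"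
    by (auto intro!: derivative_eq_intros)
  from has_derivative_compose[OF this f]
  have D: "((\<lambda>x. f (r *\<^sub>R x + c)) has_derivative (\<lambda>h. ?D (r *\<^sub>R h))) (at x)" .
  show "(\<lambda>x. f (r *\<^sub>R x + c)) differentiable (at x)" using D differentiable_def by blast
  show "partial_deriv i (\<lambda>x. f (r *\<^sub>R x + c)) x = complex_of_real r * partial_deriv i f (r *\<^sub>R x + c)"
    using partial_deriv_eq[OF D] linear_scale[OF has_derivative_linear[OF f]] assms
    by (simp add: partial_deriv_frechet scaleR_conv_of_real)
qed

lemma smooth_affine:
  assumes "smooth f" shows "smooth (\<lambda>x. f (r *\<^sub>R x + c))"
proof -
  have "smooth f \<Longrightarrow> diff_class (\<lambda>_. True) n (\<lambda>x. f (r *\<^sub>R x + c))" for n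
  proof (induction n arbitrary: f)
    case 0 then show ?case by (simp add: partial_deriv_affine smooth_differentiable)
  next
    case (Suc n)
    have eq: "partial_deriv i (\<lambda>x. f (r *\<^sub>R x + c)) = (\<lambda>x. complex_of_real r * partial_deriv i f (r *\<^sub>R x
        + c))" for i
      by (rule ext) (simp add: partial_deriv_affine Suc.prems smooth_differentiable)
    have "diff_class (\<lambda>_. True) n (\<lambda>x. complex_of_real r * partial_deriv i f (r *\<^sub>R x + c))" for i
      using Suc smooth_const[of "complex_of_real r"]
      by (intro diff_class_mult[of "\<lambda>_. True" "\<lambda>_. True" "\<lambda>_. True"])
        (auto simp: smooth_iff_diff_class smooth_partial_deriv[unfolded smooth_iff_diff_class])
    then show ?case using Suc.prems eq by (simp add: partial_deriv_affine smooth_differentiable)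
  qed
  then show ?thesis using assms by (simp add: smooth_iff_diff_class)
qed

lemma smooth_cnj:
  assumes "smooth f" shows "smooth (\<lambda>x. cnj (f x))"
proof -
  have D: "((\<lambda>x. cnj (f x)) has_derivative (\<lambda>h. cnj (frechet_derivative f (at x) h))) (at x)"
    if "smooth f" for f :: "real^'a \<Rightarrow> complex" and x
    using smooth_differentiable[OF that]
    by (intro has_derivative_cnj) (auto simp: frechet_derivative_works)
  have "smooth f \<Longrightarrow> diff_class (\<lambda>_. True) n (\<lambda>x. cnj (f x))" for n
  proof (induction n arbitrary: f)
    case 0 then show ?case using D differentiable_def by (auto, blast)
  next
    case (Suc n)
    have eq: "partial_deriv i (\<lambda>x. cnj (f x)) = (\<lambda>x. cnj (partial_deriv i f x))" for i
      by (rule ext, subst partial_deriv_eq[OF D[OF Suc.prems]])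
        (simp add: partial_deriv_frechet Suc.prems smooth_differentiable)
    show ?case using Suc.prems eq Suc.IH[OF smooth_partial_deriv] D differentiable_def by (auto, blast)
  qed
  then show ?thesis using assms by (simp add: smooth_iff_diff_class)
qed

text \<open>A derivative of a function that vanishes outside a ball vanishes there too, and on the ball it is
bounded by compactness.\<close>

lemma schwartz_compact_support:
  assumes f: "smooth f" and z: "\<And>x. norm x > R \<Longrightarrow> f x = 0"
  shows "f \<in> schwartz"
proof -
  have "smooth f \<Longrightarrow> (\<And>x. norm x > R \<Longrightarrow> f x = 0) \<Longrightarrow> diff_class rapid n f" for n
  proof (induction n arbitrary: f)
    case base: 0
    have "rapid f" unfolding rapid_def
    proof
      fix N
      have "compact ((\<lambda>x. (1 + norm x) ^ N * norm (f x)) ` cball 0 R)"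
        by (intro compact_continuous_image continuous_intros smooth_continuous_on base) auto
      then obtain C where C: "\<And>x. x \<in> cball 0 R \<Longrightarrow> norm ((1 + norm x) ^ N * norm (f x)) \<le> C"
        by (metis (no_types, lifting) bounded_iff compact_imp_bounded image_eqI)
      have "(1 + norm x) ^ N * norm (f x) \<le> max C 0" for x
      proof (cases "norm x \<le> R")
        case True then show ?thesis using C[of x] by auto
      next
        case False then show ?thesis using base by auto
      qed
      then show "\<exists>C. \<forall>x. (1 + norm x) ^ N * norm (f x) \<le> C" by blast
    qed
    then show ?case using base by (simp add: smooth_differentiable)
  next
    case (Suc n)
    have z: "partial_deriv i f x = 0" if "norm x > R" for i x
    proof -
      have "(f has_derivative (\<lambda>_. 0)) (at x)"
        by (rule has_derivative_transform_within_open[of "\<lambda>_. 0" _ _ _ "{x. norm x > R}"])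
          (use that Suc.prems(2) in \<open>auto intro!: open_Collect_less continuous_intros\<close>)
      then show ?thesis using partial_deriv_eq[of f "\<lambda>_. 0"] by simp
    qed
    have "diff_class rapid n f" "diff_class rapid n (partial_deriv i f)" for i
      using Suc z smooth_partial_deriv by blast+
    then show ?case using diff_class_0[of rapid n f] by auto
  qed
  then show ?thesis using assms by (simp add: schwartz_iff_diff_class)
qed


section \<open>Bump functions\<close>

text \<open>The functions \<open>t\<^sup>-\<^sup>n e\<^sup>-\<^sup>1\<^sup>/\<^sup>t\<close>, extended by \<open>0\<close> to \<open>t \<le> 0\<close>. The family is introduced for all \<open>n\<close>
because its linear span is closed under differentiation.\<close>

definition flat :: "nat \<Rightarrow> real \<Rightarrow> real" where
  "flat n t = (if t > 0 then exp (- (1 / t)) / t ^ n else 0)"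

text \<open>One term of the exponential series beats the power in the denominator; the remaining factor
\<open>t\<^sup>2\<close> gives the zero derivative at the origin.\<close>

lemma flat_le: assumes "t > 0" shows "flat n t \<le> fact (n + 2) * t\<^sup>2"
proof -
  have "(1 / t) ^ (n + 2) / fact (n + 2) \<le> exp (1 / t)"
  proof -
    have "(\<Sum>k<n+3. (1 / t) ^ k / fact k) \<le> exp (1 / t)"
      using assms sum_le_suminf[OF summable_exp[of "1/t"], of "{..<n+3}"]
      by (auto simp: exp_def divide_inverse mult.commute)
    moreover have "(1 / t) ^ (n + 2) / fact (n + 2) \<le> (\<Sum>k<n+3. (1 / t) ^ k / fact k)"
      using assms by (intro member_le_sum[of "n+2" "{..<n+3}" "\<lambda>k. (1/t)^k / fact k"]) auto
    ultimately show ?thesis by linarith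
  qed
  moreover define F where "F = (fact (n + 2) :: real)"
  ultimately have "1 / (F * t ^ (n + 2)) \<le> exp (1 / t)"
    by (simp add: power_one_over mult.commute del: fact_Suc)
  moreover have "F > 0" by (simp add: F_def)
  ultimately have "exp (- (1 / t)) \<le> F * t ^ (n + 2)"
    using assms by (simp add: exp_minus field_simps)
  then have "exp (- (1 / t)) \<le> F * t\<^sup>2 * t ^ n" by (simp add: power_add power2_eq_square mult_ac)
  then show ?thesis using assms by (simp add: flat_def divide_le_eq F_def del: fact_Suc)
qed

lemma flat_derivative: "(flat n has_real_derivative flat (n + 2) t - real n * flat (n + 1) t) (at t)"
proof (cases "t = 0")
  case True
  have "((\<lambda>h. (flat n (0 + h) - flat n 0) / h) \<longlongrightarrow> 0) (at 0)"
  proof (rule Lim_null_comparison[of _ "\<lambda>h. fact (n + 2) * \<bar>h\<bar>"])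
    have "norm ((flat n (0 + h) - flat n 0) / h) \<le> fact (n + 2) * \<bar>h\<bar>" if "h \<noteq> 0" for h
    proof (cases "h > 0")
      case True
      have "0 \<le> flat n h" by (simp add: flat_def True less_imp_le)
      then show ?thesis using True flat_le[OF True, of n]
        by (simp add: flat_def[of n 0] field_simps power2_eq_square)
    qed (auto simp: flat_def mult_le_0_iff simp del: fact_Suc)
    then show "\<forall>\<^sub>F h in at 0. norm ((flat n (0 + h) - flat n 0) / h) \<le> fact (n + 2) * \<bar>h\<bar>"
      by (simp add: eventually_at_filter)
  qed (auto intro!: tendsto_eq_intros)
  then show ?thesis by (simp add: True DERIV_def flat_def)
next
  case False
  show ?thesis
  proof (cases "t > 0")
    case True
    have "((\<lambda>t. exp (- (1 / t)) / t ^ n) has_real_derivative flat (n + 2) t - real n * flat (n + 1) t) (at t)"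
      using True
      by (cases n) (auto intro!: derivative_eq_intros simp: flat_def field_simps power2_eq_square,
          metis Suc_pred' bot_nat_0.not_eq_extremum power_Suc One_nat_def)
    then show ?thesis
      by (rule has_field_derivative_transform_within_open[where S="{0<..}"]) (use True in \<open>auto simp: flat_def\<close>)
  next
    case neg: False
    have "((\<lambda>_. 0) has_real_derivative flat (n + 2) t - real n * flat (n + 1) t) (at t)"
      using neg by (simp add: flat_def)
    then show ?thesis
      by (rule has_field_derivative_transform_within_open[where S="{..<0}"]) (use False neg in \<open>auto
          simp: flat_def\<close>)
  qed
qed

lemma smooth_flat_quadratic:
  "smooth (\<lambda>x::real^'n::finite. complex_of_real (flat n (c + s * (x \<bullet> x))))"
proof -
  have q: "((\<lambda>x::real^'n. c + s * (x \<bullet> x)) has_derivative (\<lambda>h. s * (2 * (x \<bullet> h)))) (at x)" for x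
    by (auto intro!: derivative_eq_intros simp: inner_commute)
  have D: "((\<lambda>x::real^'n. complex_of_real (flat n (c + s * (x \<bullet> x)))) has_derivative
     (\<lambda>h. complex_of_real ((flat (n + 2) (c + s * (x \<bullet> x)) - real n * flat (n + 1) (c + s * (x \<bullet> x)))
         * (s * (2 * (x \<bullet> h)))))) (at x)" for n x
    by (intro has_derivative_of_real has_derivative_compose[of _ _ _ _ "flat n", OF q
        flat_derivative[unfolded has_field_derivative_def]])
  have d: "(\<lambda>x::real^'n. complex_of_real (flat n (c + s * (x \<bullet> x)))) differentiable (at x)" for n x
    using D differentiable_def by blast
  have pd: "partial_deriv i (\<lambda>x::real^'n. complex_of_real (flat n (c + s * (x \<bullet> x)))) =
      (\<lambda>x. (complex_of_real (flat (n + 2) (c + s * (x \<bullet> x)))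
        + complex_of_real (- real n) * complex_of_real (flat (n + 1) (c + s * (x \<bullet> x))))
        * (complex_of_real (2 * s) * complex_of_real (x $ i)))" for i n
    by (rule ext, subst partial_deriv_eq[OF D]) (simp add: inner_axis algebra_simps)
  have T: "diff_class (\<lambda>_. True) m (\<lambda>x::real^'n. f x * g x)" "diff_class (\<lambda>_. True) m (\<lambda>x::real^'n. f x + g x)"
    if "diff_class (\<lambda>_. True) m f" "diff_class (\<lambda>_. True) m g" for m f g
    using that diff_class_mult[of "\<lambda>_. True" "\<lambda>_. True" "\<lambda>_. True" m f g] diff_class_add[of "\<lambda>_. True" m
        f g] by auto
  have C: "diff_class (\<lambda>_. True) m (\<lambda>_::real^'n. k)" for m k
    using smooth_const[unfolded smooth_iff_diff_class] by blast
  have X: "diff_class (\<lambda>_. True) m (\<lambda>x::real^'n. complex_of_real (x $ i))" for m i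
    using multiplier_smooth[OF coordinate_multiplier, unfolded smooth_iff_diff_class] by blast
  have "diff_class (\<lambda>_. True) m (\<lambda>x::real^'n. complex_of_real (flat n (c + s * (x \<bullet> x))))" for m n
  proof (induction m arbitrary: n)
    case (Suc m)
    show ?case unfolding diff_class.simps pd by (intro conjI allI TrueI d T C X Suc.IH)
  qed (simp add: d)
  then show ?thesis by (simp add: smooth_iff_diff_class)
qed

text \<open>The value is \<open>1\<close> on the ball of radius \<open>A\<close> and \<open>0\<close> outside the ball of radius \<open>B\<close>; the denominator
never vanishes when \<open>A < B\<close>.\<close>

definition bump :: "real \<Rightarrow> real \<Rightarrow> real^'n::finite \<Rightarrow> real" where
  "bump A B x = flat 0 (B\<^sup>2 - x \<bullet> x) / (flat 0 (B\<^sup>2 - x \<bullet> x) + flat 0 (x \<bullet> x - A\<^sup>2))"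

lemma flat_nonneg: "0 \<le> flat n t" and flat_pos: "t > 0 \<Longrightarrow> 0 < flat n t"
  by (auto simp: flat_def)

lemma bump_range: "0 \<le> bump A B x" "bump A B x \<le> 1"
  using flat_nonneg[of 0] by (auto simp: bump_def divide_le_eq_1 add_nonneg_eq_0_iff
      order.strict_iff_order intro!: divide_nonneg_nonneg)

lemma bump_0: assumes "0 \<le> B" "norm x \<ge> B" shows "bump A B x = 0"
proof -
  have "B\<^sup>2 \<le> x \<bullet> x" using assms by (simp add: dot_square_norm)
  then show ?thesis by (simp add: bump_def flat_def)
qed

lemma bump_1: assumes "0 \<le> A" "A < B" "norm x \<le> A" shows "bump A B x = 1"
proof -
  have "x \<bullet> x \<le> A\<^sup>2" "A\<^sup>2 < B\<^sup>2" using assms by (auto simp: dot_square_norm power_strict_mono)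
  then show ?thesis using flat_pos[of "B\<^sup>2 - x \<bullet> x" 0] by (simp add: bump_def flat_def[of 0 "x \<bullet> x - A\<^sup>2"])
qed

lemma smooth_bump:
  assumes "0 \<le> A" "A < B" shows "smooth (\<lambda>x. complex_of_real (bump A B x))"
proof -
  have AB: "A\<^sup>2 < B\<^sup>2" using assms by (simp add: power_strict_mono)
  have 1: "smooth (\<lambda>x::real^'n::finite. complex_of_real (flat 0 (B\<^sup>2 - x \<bullet> x)))"
    using smooth_flat_quadratic[of 0 "B\<^sup>2" "-1"] by simp
  have 2: "smooth (\<lambda>x::real^'n::finite. complex_of_real (flat 0 (x \<bullet> x - A\<^sup>2)))"
    using smooth_flat_quadratic[of 0 "- A\<^sup>2" 1] by simp
  have nz: "complex_of_real (flat 0 (B\<^sup>2 - x \<bullet> x)) + complex_of_real (flat 0 (x \<bullet> x - A\<^sup>2)) \<noteq> 0"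
      for x :: "real^'n::finite"
  proof -
    have "0 < flat 0 (B\<^sup>2 - x \<bullet> x) \<or> 0 < flat 0 (x \<bullet> x - A\<^sup>2)"
      using AB by (cases "x \<bullet> x < B\<^sup>2") (auto intro!: flat_pos)
    then have "flat 0 (B\<^sup>2 - x \<bullet> x) + flat 0 (x \<bullet> x - A\<^sup>2) \<noteq> 0"
      using flat_nonneg[of 0 "B\<^sup>2 - x \<bullet> x"] flat_nonneg[of 0 "x \<bullet> x - A\<^sup>2"] by linarith
    then show ?thesis by (metis of_real_add of_real_eq_0_iff)
  qed
  show ?thesis
    using smooth_mult[OF 1 smooth_inverse[OF smooth_add[OF 1 2] nz]]
    by (simp add: bump_def divide_inverse)
qed

section \<open>Integration of Schwartz functions\<close>

lemma prod_Basis_cart: "(\<Prod>b\<in>(Basis::(real^'n::finite) set). F b) = (\<Prod>i\<in>UNIV. F (axis i 1))"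
proof -
  have 1: "(Basis::(real^'n) set) = range (\<lambda>i. axis i 1)" by (auto simp: Basis_vec_def)
  have 2: "inj (\<lambda>i::'n. axis i (1::real))" by (auto simp: inj_on_def axis_eq_axis)
  show ?thesis unfolding 1 by (subst prod.reindex[OF 2]) simp
qed

text \<open>Lebesgue measure on the Cartesian power is the image of a product measure indexed by the standard
basis. This is used for the Gaussian, for the orthogonality of characters on a cube, and for the
integrability of the weights below.\<close>

lemma integral_prod_cart:
  fixes f :: "'n::finite \<Rightarrow> real \<Rightarrow> complex"
  assumes "\<And>i. integrable lborel (f i)"
  shows "(LINT x|lborel. (\<Prod>i\<in>UNIV. f i ((x::real^'n) $ i))) = (\<Prod>i\<in>UNIV. (LINT t|lborel. f i t))"
    and "integrable lborel (\<lambda>x::real^'n. \<Prod>i\<in>UNIV. f i (x $ i))"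
proof -
  interpret product_sigma_finite "\<lambda>_::real^'n. lborel :: real measure" by standard
  define g where "g b = f (THE i. b = axis i (1::real))" for b :: "real^'n"
  have g: "g (axis i 1) = f i" for i by (simp add: g_def axis_eq_axis)
  have gi: "integrable lborel (g b)" if "b \<in> Basis" for b using assms that by (auto simp: Basis_vec_def g)
  have [measurable]: "g b \<in> borel_measurable borel" if "b \<in> Basis" for b using gi[OF that] by auto
  have eq: "(\<Prod>i\<in>UNIV. f i (x $ i)) = (\<Prod>b\<in>Basis. g b (x \<bullet> b))" for x
    by (simp add: prod_Basis_cart g inner_axis)
  have m1: "(\<lambda>f. \<Sum>b\<in>Basis. f b *\<^sub>R b) \<in> (\<Pi>\<^sub>M b\<in>(Basis::(real^'n) set). lborel) \<rightarrow>\<^sub>M borel"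
    by measurable
  have m2: "(\<lambda>x. \<Prod>b\<in>Basis. g b (x \<bullet> b)) \<in> borel_measurable borel" by measurable
  have s: "(\<Prod>b\<in>Basis. g b ((\<Sum>b\<in>Basis. x b *\<^sub>R b) \<bullet> b)) = (\<Prod>b\<in>Basis. g b (x b))" for x
    by (intro prod.cong refl) (simp add: inner_sum_left inner_Basis if_distrib
        comm_monoid_add_class.sum.If_cases cong: if_cong)
  have L: "(lborel :: (real^'n) measure) = distr (\<Pi>\<^sub>M b\<in>Basis. lborel) borel (\<lambda>f. \<Sum>b\<in>Basis. f b *\<^sub>R b)"
    by (rule lborel_eq)
  show "(LINT x|lborel. (\<Prod>i\<in>UNIV. f i ((x::real^'n) $ i))) = (\<Prod>i\<in>UNIV. (LINT t|lborel. f i t))"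
    unfolding eq L integral_distr[OF m1 m2] s
    by (subst product_integral_prod) (auto simp: gi prod_Basis_cart g)
  show "integrable lborel (\<lambda>x::real^'n. \<Prod>i\<in>UNIV. f i (x $ i))"
    unfolding eq L integrable_distr_eq[OF m1 m2] s
    by (intro product_integrable_prod) (auto simp: gi)
qed

lemma integrable_weight:
  assumes "M \<ge> 2 * CARD('n)"
  shows "integrable lborel (\<lambda>x::real^'n::finite. 1 / (1 + norm x) ^ M)"
proof -
  have 1: "integrable lborel (\<lambda>t::real. complex_of_real (inverse (1 + t\<^sup>2)))"
    using integrable_inverse_1_plus_square by (intro integrable_of_real) (simp add: set_integrable_def)
  have 2: "integrable lborel (\<lambda>x::real^'n. \<Prod>i\<in>UNIV. complex_of_real (inverse (1 + (x $ i)\<^sup>2)))"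
    by (rule integral_prod_cart(2)) (rule 1)
  show ?thesis
  proof (rule Bochner_Integration.integrable_bound[OF 2])
    show "AE x in lborel. norm (1 / (1 + norm x) ^ M) \<le> norm (\<Prod>i\<in>UNIV. complex_of_real (inverse (1
        + ((x::real^'n) $ i)\<^sup>2)))"
    proof (rule AE_I2)
      fix x :: "real^'n"
      have "(\<Prod>i\<in>(UNIV::'n set). 1 + (x $ i)\<^sup>2) \<le> (\<Prod>i\<in>(UNIV::'n set). (1 + norm x)\<^sup>2)"
      proof (rule prod_mono)
        fix i :: 'n
        have "\<bar>x $ i\<bar> \<le> norm x" by (rule component_le_norm_cart)
        then have "(x $ i)\<^sup>2 \<le> (norm x)\<^sup>2" by (metis abs_ge_zero power2_abs power_mono)
        then show "0 \<le> 1 + (x $ i)\<^sup>2 \<and> 1 + (x $ i)\<^sup>2 \<le> (1 + norm x)\<^sup>2"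
          using norm_ge_zero[of x] unfolding power2_sum by (simp del: norm_ge_zero)
      qed
      also have "\<dots> = (1 + norm x) ^ (2 * CARD('n))" by (simp add: power_mult)
      also have "\<dots> \<le> (1 + norm x) ^ M" using assms by (intro power_increasing) auto
      finally have "1 / (1 + norm x) ^ M \<le> 1 / (\<Prod>i\<in>(UNIV::'n set). 1 + (x $ i)\<^sup>2)"
        by (intro divide_left_mono) (auto intro!: prod_pos mult_pos_pos simp: add_pos_nonneg)
      also have "\<dots> = norm (\<Prod>i\<in>UNIV. complex_of_real (inverse (1 + (x $ i)\<^sup>2)))"
        by (simp add: prod_norm[symmetric] norm_of_real del: of_real_inverse of_real_power of_real_add)
           (simp add: prod_dividef inverse_eq_divide)
      finally show "norm (1 / (1 + norm x) ^ M) \<le> norm (\<Prod>i\<in>UNIV. complex_of_real (inverse (1 + (x $ i)\<^sup>2)))"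
        by simp
    qed
  qed measurable
qed

lemma rapid_le:
  assumes "rapid f" obtains C where "\<And>x. norm (f x) \<le> C / (1 + norm x) ^ M" "C \<ge> 0"
proof -
  obtain C where C: "\<And>x. (1 + norm x) ^ M * norm (f x) \<le> C" using assms unfolding rapid_def by blast
  have "norm (f x) \<le> C / (1 + norm x) ^ M" for x
    using C[of x] by (subst pos_le_divide_eq) (auto simp: mult.commute add_pos_nonneg)
  moreover have "C \<ge> 0" using C[of 0] norm_ge_zero[of "f 0"] by (simp del: norm_ge_zero)
  ultimately show ?thesis using that by blast
qed

lemma rapid_integrable:
  assumes "rapid f" "f \<in> borel_measurable borel" shows "integrable lborel f"
proof -
  obtain C where C: "\<And>x. norm (f x) \<le> C / (1 + norm x) ^ (2 * CARD('a))" "C \<ge> 0"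
    using rapid_le[OF assms(1)] by metis
  show ?thesis
  proof (rule Bochner_Integration.integrable_bound)
    show "integrable lborel (\<lambda>x::real^'a. C * (1 / (1 + norm x) ^ (2 * CARD('a))))"
      by (intro integrable_mult_right integrable_weight) auto
    show "AE x in lborel. norm (f x) \<le> norm (C * (1 / (1 + norm x) ^ (2 * CARD('a))))"
      using C by (auto simp: abs_mult)
  qed (use assms in auto)
qed

lemma schwartz_borel: "f \<in> schwartz \<Longrightarrow> f \<in> borel_measurable borel"
  by (intro borel_measurable_continuous_onI schwartz_continuous_on)

lemma schwartz_integrable: "f \<in> schwartz \<Longrightarrow> integrable lborel f"
  by (simp add: rapid_integrable schwartz_borel schwartz_rapid)

lemma integral_affine:
  fixes f :: "real^'n::finite \<Rightarrow> complex"
  assumes [measurable]: "f \<in> borel_measurable borel" and "r \<noteq> 0"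
  shows "(LINT x|lborel. f x) = complex_of_real (\<bar>r\<bar> ^ CARD('n)) * (LINT x|lborel. f (c + r *\<^sub>R x))"
  using assms(2)
  by (subst lborel_affine[of r c]) (simp_all add: integral_density integral_distr
      scaleR_conv_of_real[where 'a=complex])

lemma integral_translate:
  fixes f :: "real^'n::finite \<Rightarrow> complex"
  assumes "f \<in> borel_measurable borel"
  shows "(LINT x|lborel. f (x + c)) = (LINT x|lborel. f x)"
  using integral_affine[OF assms, of 1 c] by (simp add: add.commute)

lemma integrable_affine:
  fixes f :: "real^'n::finite \<Rightarrow> complex"
  assumes "integrable lborel f" and r: "r \<noteq> 0"
  shows "integrable lborel (\<lambda>x. f (c + r *\<^sub>R x))"
proof -
  have [measurable]: "f \<in> borel_measurable borel" using assms by auto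
  have "integrable (density (distr lborel borel (\<lambda>x. c + r *\<^sub>R x)) (\<lambda>_. ennreal (\<bar>r\<bar> ^ CARD('n)))) f"
    using assms(1) by (subst (asm) lborel_affine[OF r, of c]) simp
  then have "integrable lborel (\<lambda>x. \<bar>r\<bar> ^ CARD('n) *\<^sub>R f (c + r *\<^sub>R x))"
    by (subst (asm) integrable_density) (auto simp: integrable_distr_eq)
  then have "integrable lborel (\<lambda>x. (1 / \<bar>r\<bar> ^ CARD('n)) *\<^sub>R (\<bar>r\<bar> ^ CARD('n) *\<^sub>R f (c + r *\<^sub>R x)))"
    by (rule integrable_scaleR_right)
  moreover have "(1 / \<bar>r\<bar> ^ CARD('n)) *\<^sub>R (\<bar>r\<bar> ^ CARD('n) *\<^sub>R z) = z" for z :: complex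
    using r unfolding scaleR_scaleR by simp
  ultimately show ?thesis by simp
qed

lemma directional_bound:
  assumes f: "f \<in> schwartz" and s: "0 \<le> s"
    and B: "\<And>u. 0 \<le> u \<Longrightarrow> u \<le> s \<Longrightarrow> norm (partial_deriv i f (x + u *\<^sub>R axis i 1)) \<le> B"
  shows "norm (f (x + s *\<^sub>R axis i 1) - f x) \<le> B * s"
proof -
  have 1: "((\<lambda>u. f (x + u *\<^sub>R axis i 1)) has_derivative (\<lambda>h. h *\<^sub>R partial_deriv i f (x
      + u *\<^sub>R axis i 1))) (at u within {0..s})" for u
  proof -
    let ?D = "frechet_derivative f (at (x + u *\<^sub>R axis i 1))"
    have D: "(f has_derivative ?D) (at (x + u *\<^sub>R axis i 1))"
      using schwartz_differentiable[OF f] by (simp add: frechet_derivative_works)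
    have "((\<lambda>u. x + u *\<^sub>R axis i 1) has_derivative (\<lambda>h. h *\<^sub>R axis i 1)) (at u within {0..s})"
      by (auto intro!: derivative_eq_intros)
    from has_derivative_compose[OF this D]
    show ?thesis
      using linear_scale[OF has_derivative_linear[OF D]] schwartz_differentiable[OF f]
      by (simp add: partial_deriv_frechet)
  qed
  have 2: "onorm (\<lambda>h::real. h *\<^sub>R partial_deriv i f (x + u *\<^sub>R axis i 1)) \<le> B" if "u \<in> {0..s}" for u
    using that B[of u] by (intro onorm_bound) (auto intro: order_trans[OF norm_ge_zero]
        simp: mult.commute[of B] mult_left_mono)
  have "norm (f (x + s *\<^sub>R axis i 1) - f (x + 0 *\<^sub>R axis i 1)) \<le> B * norm (s - 0)"
    using s by (intro differentiable_bound[OF _ 1 2]) auto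
  then show ?thesis using s by simp
qed

text \<open>Difference quotients integrate to zero by translation invariance, and they are dominated by the
supremum of the derivative over a unit segment, which decreases rapidly.\<close>

lemma integral_partial_deriv:
  fixes f :: "real^'n::finite \<Rightarrow> complex"
  assumes f: "f \<in> schwartz"
  shows "(LINT x|lborel. partial_deriv i f x) = 0"
proof -
  let ?e = "axis i 1 :: real^'n" and ?M = "2 * CARD('n)"
  define s where "s n = 1 / (real n + 1)" for n
  define F where "F n x = (f (x + s n *\<^sub>R ?e) - f x) /\<^sub>R s n" for n x
  have s: "0 < s n" "s n \<le> 1" for n by (auto simp: s_def)
  have s0: "s \<longlonglongrightarrow> 0" unfolding s_def using LIMSEQ_inverse_real_of_nat by (simp add: inverse_eq_divide add.commute)
  obtain C where C: "\<And>x. norm (partial_deriv i f x) \<le> C / (1 + norm x) ^ ?M" "C \<ge> 0"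
    using rapid_le[OF schwartz_rapid[OF schwartz_partial_deriv[OF f]]] by metis
  have m [measurable]: "f \<in> borel_measurable borel" "partial_deriv i f \<in> borel_measurable borel"
    using f by (auto intro: schwartz_borel schwartz_partial_deriv)
  have fi: "integrable lborel f" using f by (rule schwartz_integrable)
  have "(LINT x|lborel. F n x) = 0" for n
  proof -
    have "integrable lborel (\<lambda>x. f (x + s n *\<^sub>R ?e))"
      using integrable_affine[OF fi, of 1 "s n *\<^sub>R ?e"] by (simp add: add.commute)
    then have "(LINT x|lborel. F n x) = ((LINT x|lborel. f (x + s n *\<^sub>R ?e)) - (LINT x|lborel. f x)) /\<^sub>R s n"
      using fi by (simp add: F_def)
    then show ?thesis using integral_translate[OF m(1)] by simp
  qed
  moreover have "(\<lambda>n. LINT x|lborel. F n x) \<longlonglongrightarrow> (LINT x|lborel. partial_deriv i f x)"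
  proof (rule integral_dominated_convergence)
    show "F n \<in> borel_measurable lborel" for n unfolding F_def by measurable
    show "integrable lborel (\<lambda>x::real^'n. (C * 2 ^ ?M) * (1 / (1 + norm x) ^ ?M))"
      by (intro integrable_mult_right integrable_weight) auto
    show "AE x in lborel. (\<lambda>n. F n x) \<longlonglongrightarrow> partial_deriv i f x"
    proof (rule AE_I2)
      fix x
      have d: "((\<lambda>t. f (x + t *\<^sub>R ?e)) has_derivative (\<lambda>h. h *\<^sub>R partial_deriv i f x)) (at 0)"
      proof -
        let ?D = "frechet_derivative f (at (x + 0 *\<^sub>R ?e))"
        have D: "(f has_derivative ?D) (at (x + 0 *\<^sub>R ?e))"
          using schwartz_differentiable[OF f] by (simp add: frechet_derivative_works[symmetric])
        have "((\<lambda>u::real. x + u *\<^sub>R ?e) has_derivative (\<lambda>h. h *\<^sub>R ?e)) (at 0)"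
          by (auto intro!: derivative_eq_intros)
        from has_derivative_compose[OF this D]
        show ?thesis
          using linear_scale[OF has_derivative_linear[OF D]] schwartz_differentiable[OF f]
          by (simp add: partial_deriv_frechet)
      qed
      have "((\<lambda>t. norm ((f (x + t *\<^sub>R ?e) - f x) /\<^sub>R t - partial_deriv i f x)) \<longlongrightarrow> 0) (at 0)"
      proof (rule Lim_transform_eventually)
        show "((\<lambda>t. norm (f (x + t *\<^sub>R ?e) - f x - t *\<^sub>R partial_deriv i f x) / norm t) \<longlongrightarrow> 0) (at 0)"
          using d by (simp add: has_derivative_at)
        have "norm (a - t *\<^sub>R b) / norm t = norm (a /\<^sub>R t - b)" if "t \<noteq> 0" for a b :: complex and t :: real
        proof -
          have "a /\<^sub>R t - b = (a - t *\<^sub>R b) /\<^sub>R t" using that by (simp add: scaleR_diff_right)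
          then show ?thesis by (simp add: divide_inverse mult.commute)
        qed
        then show "\<forall>\<^sub>F t in at 0. norm (f (x + t *\<^sub>R ?e) - f x - t *\<^sub>R partial_deriv i f x) / norm t
            = norm ((f (x + t *\<^sub>R ?e) - f x) /\<^sub>R t - partial_deriv i f x)"
          by (simp add: eventually_at_filter)
      qed
      then have "((\<lambda>t. (f (x + t *\<^sub>R ?e) - f x) /\<^sub>R t) \<longlongrightarrow> partial_deriv i f x) (at 0)"
        by (simp add: tendsto_norm_zero_iff LIM_zero_iff)
      moreover have "filterlim s (at 0) sequentially"
        using s0 s(1) by (auto simp: filterlim_at intro!: always_eventually less_imp_neq[symmetric])
      ultimately show "(\<lambda>n. F n x) \<longlonglongrightarrow> partial_deriv i f x"
        unfolding F_def by (rule filterlim_compose)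
    qed
    show "AE x in lborel. norm (F n x) \<le> (C * 2 ^ ?M) * (1 / (1 + norm x) ^ ?M)" for n
    proof (rule AE_I2)
      fix x :: "real^'n"
      have "norm (partial_deriv i f (x + u *\<^sub>R ?e)) \<le> (C * 2 ^ ?M) * (1 / (1 + norm x) ^ ?M)"
        if "0 \<le> u" "u \<le> s n" for u
      proof -
        have "norm x \<le> norm (x + u *\<^sub>R ?e) + norm (u *\<^sub>R ?e)"
          using norm_triangle_ineq4[of "x + u *\<^sub>R ?e" "u *\<^sub>R ?e"] by simp
        also have "norm (u *\<^sub>R ?e) \<le> 1" using that s(2)[of n] by simp
        finally have "norm x \<le> norm (x + u *\<^sub>R ?e) + 1" by simp
        then have "1 + norm x \<le> 2 * (1 + norm (x + u *\<^sub>R ?e))" 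
          by (smt (verit) norm_ge_zero)
        then have "(1 + norm x) ^ ?M \<le> (2 * (1 + norm (x + u *\<^sub>R ?e))) ^ ?M"
          by (intro power_mono) auto
        then have "1 / (1 + norm (x + u *\<^sub>R ?e)) ^ ?M \<le> 2 ^ ?M / (1 + norm x) ^ ?M"
          by (simp only: power_mult_distrib) (simp add: divide_simps add_pos_nonneg mult.commute
              add_eq_0_iff_both_eq_0)
        then have "C * (1 / (1 + norm (x + u *\<^sub>R ?e)) ^ ?M) \<le> C * (2 ^ ?M / (1 + norm x) ^ ?M)"
          using C(2) by (rule mult_left_mono)
        then show ?thesis using C(1)[of "x + u *\<^sub>R ?e"] by simp
      qed
      then have "norm (f (x + s n *\<^sub>R ?e) - f x) \<le> (C * 2 ^ ?M) * (1 / (1 + norm x) ^ ?M) * s n"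
        using s[of n] by (intro directional_bound[OF f]) auto
      then show "norm (F n x) \<le> (C * 2 ^ ?M) * (1 / (1 + norm x) ^ ?M)"
        using s[of n] pos_divide_le_eq[OF s(1)[of n]]
        by (simp add: F_def divide_inverse[of _ "s n"] mult.commute[of "inverse (s n)"])
    qed
  qed measurable
  ultimately show ?thesis by (simp add: LIMSEQ_const_iff)
qed

lemma integration_by_parts:
  assumes f: "f \<in> schwartz" and g: "g \<in> multiplier"
  shows "(LINT x|lborel. partial_deriv i f x * g x) = - (LINT x|lborel. f x * partial_deriv i g x)"
proof -
  have g': "partial_deriv i g \<in> multiplier"
    using g diff_class_partial_deriv[of moderate g] by (simp add: multiplier_def)
  have "partial_deriv i (\<lambda>x. f x * g x) = (\<lambda>x. partial_deriv i f x * g x + f x * partial_deriv i g x)"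
    by (rule ext, rule partial_deriv_mult)
      (auto simp: f g schwartz_differentiable smooth_differentiable multiplier_smooth)
  then have "(LINT x|lborel. partial_deriv i f x * g x + f x * partial_deriv i g x) = 0"
    using integral_partial_deriv[OF schwartz_mult_multiplier[OF f g], of i] by simp
  moreover have "integrable lborel (\<lambda>x. partial_deriv i f x * g x)" "integrable lborel (\<lambda>x. f x
      * partial_deriv i g x)"
    using f g g' by (auto intro!: schwartz_integrable schwartz_mult_multiplier schwartz_partial_deriv)
  ultimately show ?thesis by (simp add: add_eq_0_iff2)
qed

section \<open>The Fourier transform\<close>

lemma cis_approx: "norm (cis a - 1 - \<i> * complex_of_real a) \<le> a\<^sup>2 / 2"
  using iexp_approx1[of a 1] by (simp add: cis_conv_exp power2_eq_square algebra_simps)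

lemma borel_measurable_cis [measurable]: "cis \<in> borel_measurable borel"
  by (intro borel_measurable_continuous_onI continuous_intros)

lemma integrable_schwartz_moderate:
  assumes "f \<in> schwartz" "moderate g" "g \<in> borel_measurable borel"
  shows "integrable lborel (\<lambda>t. f t * g t)"
  using assms schwartz_borel[OF assms(1)] by (intro rapid_integrable rapid_moderate_mult schwartz_rapid) auto

lemma integrable_cis:
  assumes "integrable lborel f" shows "integrable lborel (\<lambda>t::real^'n::finite. f t * cis (s * (t \<bullet> \<eta>)))"
proof (rule Bochner_Integration.integrable_bound[OF assms])
  have [measurable]: "f \<in> borel_measurable borel" using assms by auto
  show "(\<lambda>t. f t * cis (s * (t \<bullet> \<eta>))) \<in> borel_measurable lborel" by measurable
qed (simp add: norm_mult)

lemma integrable_cis_neg: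
  assumes "integrable lborel f" shows "integrable lborel (\<lambda>t::real^'n::finite. f t * cis (- (t \<bullet> \<eta>)))"
  using integrable_cis[OF assms, of "-1"] by simp

lemma moment_schwartz:
  assumes "f \<in> schwartz" shows "(\<lambda>t. f t * (- \<i> * complex_of_real (t $ i))) \<in> schwartz"
  by (intro schwartz_mult_multiplier[OF assms] multiplier_mult const_multiplier coordinate_multiplier)

text \<open>The total derivative, obtained from the second-order Taylor bound for the exponential: the remainder
is at most the second absolute moment of \<open>f\<close> times the square of the increment.\<close>

lemma fourier_derivative:
  fixes f :: "real^'n::finite \<Rightarrow> complex"
  assumes f: "f \<in> schwartz"
  shows "(fourier f has_derivative
    (\<lambda>h. \<Sum>i\<in>UNIV. h $ i *\<^sub>R fourier (\<lambda>t. f t * (- \<i> * complex_of_real (t $ i))) \<eta>)) (at \<eta>)"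
    (is "(_ has_derivative ?D) _")
proof -
  define K where "K = (LINT t|lborel. norm (f t) * (norm t)\<^sup>2)"
  have fi: "integrable lborel f" using f by (rule schwartz_integrable)
  have K: "integrable lborel (\<lambda>t. norm (f t) * (norm t)\<^sup>2)"
  proof -
    have "integrable lborel (\<lambda>t. f t * complex_of_real ((norm t)\<^sup>2))"
    proof (rule integrable_schwartz_moderate[OF f])
      show "moderate (\<lambda>t::real^'n. complex_of_real ((norm t)\<^sup>2))"
        by (rule moderateI[where C=1 and N=2]) (auto simp: norm_power intro!: power_mono)
    qed measurable
    from integrable_norm[OF this] show ?thesis by (simp add: norm_mult norm_power)
  qed
  have bl: "bounded_linear ?D"
    by (intro bounded_linear_sum bounded_linear_compose[OF bounded_linear_scaleR_left bounded_linear_vec_nth])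
  have bound: "norm (fourier f (\<eta> + h) - fourier f \<eta> - ?D h) \<le> K * (norm h)\<^sup>2" for h
  proof -
    have mi: "integrable lborel (\<lambda>t. h $ i *\<^sub>R (f t * (- \<i> * complex_of_real (t $ i)) * cis (- (t \<bullet> \<eta>))))" for i
      by (intro integrable_scaleR_right integrable_cis_neg schwartz_integrable moment_schwartz f)
    have "?D h = (\<Sum>i\<in>UNIV. (LINT t|lborel. h $ i *\<^sub>R (f t * (- \<i> * complex_of_real (t $ i)) * cis (- (t \<bullet> \<eta>)))))"
      by (simp add: fourier_def)
    also have "\<dots> = (LINT t|lborel. (\<Sum>i\<in>UNIV. h $ i *\<^sub>R (f t * (- \<i> * complex_of_real (t $ i))
        * cis (- (t \<bullet> \<eta>)))))"
      using mi by (subst Bochner_Integration.integral_sum) auto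
    finally have Dh: "?D h = (LINT t|lborel. (\<Sum>i\<in>UNIV. h $ i *\<^sub>R (f t * (- \<i> * complex_of_real (t $ i))
        * cis (- (t \<bullet> \<eta>)))))" .
    have si: "integrable lborel (\<lambda>t. \<Sum>i\<in>UNIV. h $ i *\<^sub>R (f t * (- \<i> * complex_of_real (t $ i))
        * cis (- (t \<bullet> \<eta>))))"
      using mi by auto
    have "fourier f (\<eta> + h) - fourier f \<eta> - ?D h =
      (LINT t|lborel. f t * cis (- (t \<bullet> (\<eta> + h))) - f t * cis (- (t \<bullet> \<eta>)) -
        (\<Sum>i\<in>UNIV. h $ i *\<^sub>R (f t * (- \<i> * complex_of_real (t $ i)) * cis (- (t \<bullet> \<eta>)))))"
      unfolding Dh unfolding fourier_def
      by (subst Bochner_Integration.integral_diff[OF Bochner_Integration.integrable_diff[OF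
          integrable_cis_neg[OF fi] integrable_cis_neg[OF fi]] si],
          subst Bochner_Integration.integral_diff[OF integrable_cis_neg[OF fi] integrable_cis_neg[OF
              fi]], rule refl)
    also have "norm \<dots> \<le> (LINT t|lborel. norm (f t) * (norm t)\<^sup>2 * (norm h)\<^sup>2)"
    proof (rule Bochner_Integration.integral_norm_bound_integral)
      fix t
      have s: "(\<Sum>i\<in>UNIV. h $ i *\<^sub>R (f t * (- \<i> * complex_of_real (t $ i)) * cis (- (t \<bullet> \<eta>)))) =
          f t * cis (- (t \<bullet> \<eta>)) * (- \<i> * complex_of_real (t \<bullet> h))"
        by (simp add: inner_vec_def sum_distrib_left sum_negf scaleR_conv_of_real mult_ac)
      have "f t * cis (- (t \<bullet> (\<eta> + h))) - f t * cis (- (t \<bullet> \<eta>)) - f t * cis (- (t \<bullet> \<eta>)) * (- \<i>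
          * complex_of_real (t \<bullet> h))
          = f t * cis (- (t \<bullet> \<eta>)) * (cis (- (t \<bullet> h)) - 1 - \<i> * complex_of_real (- (t \<bullet> h)))"
        using cis_mult[of "- (t \<bullet> \<eta>)" "- (t \<bullet> h)"] by (simp add: inner_add_right algebra_simps)
      also have "norm \<dots> \<le> norm (f t) * ((- (t \<bullet> h))\<^sup>2 / 2)"
        unfolding norm_mult norm_cis mult_1_right by (intro mult_left_mono cis_approx) auto
      also have "\<dots> \<le> norm (f t) * ((norm t)\<^sup>2 * (norm h)\<^sup>2)"
      proof -
        have "\<bar>t \<bullet> h\<bar>\<^sup>2 \<le> (norm t * norm h)\<^sup>2" by (intro power_mono Cauchy_Schwarz_ineq2) auto
        then have "(t \<bullet> h)\<^sup>2 \<le> (norm t)\<^sup>2 * (norm h)\<^sup>2" by (simp add: power_mult_distrib)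
        moreover have "0 \<le> (t \<bullet> h)\<^sup>2" by simp
        ultimately have "(- (t \<bullet> h))\<^sup>2 / 2 \<le> (norm t)\<^sup>2 * (norm h)\<^sup>2" unfolding power2_minus by linarith
        then show ?thesis by (rule mult_left_mono) simp
      qed
      finally show "norm (f t * cis (- (t \<bullet> (\<eta> + h))) - f t * cis (- (t \<bullet> \<eta>)) -
        (\<Sum>i\<in>UNIV. h $ i *\<^sub>R (f t * (- \<i> * complex_of_real (t $ i)) * cis (- (t \<bullet> \<eta>))))) \<le> norm (f t)
            * (norm t)\<^sup>2 * (norm h)\<^sup>2"
        unfolding s by (simp add: mult.assoc)
    qed (use si K fi in \<open>auto intro!: integrable_cis_neg\<close>)
    also have "\<dots> = K * (norm h)\<^sup>2" unfolding K_def by simp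
    finally show ?thesis .
  qed
  have "((\<lambda>h. norm (fourier f (\<eta> + h) - fourier f \<eta> - ?D h) / norm h) \<longlongrightarrow> 0) (at 0)"
  proof (rule Lim_null_comparison[of _ "\<lambda>h. K * norm h"])
    have "norm (norm (fourier f (\<eta> + h) - fourier f \<eta> - ?D h) / norm h) \<le> K * norm h" if "h \<noteq> 0" for h
      using bound[of h] that by (simp add: divide_le_eq power2_eq_square mult.assoc)
    then show "\<forall>\<^sub>F h in at 0. norm (norm (fourier f (\<eta> + h) - fourier f \<eta> - ?D h) / norm h) \<le> K * norm h"
      by (simp add: eventually_at_filter)
  qed (auto intro!: tendsto_eq_intros)
  then show ?thesis using bl by (simp add: has_derivative_at)
qed

lemma partial_deriv_fourier:
  assumes "f \<in> schwartz"
  shows "partial_deriv i (fourier f) = fourier (\<lambda>t. f t * (- \<i> * complex_of_real (t $ i)))"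
proof
  fix \<eta>
  have "(\<Sum>j\<in>UNIV. axis i (1::real) $ j *\<^sub>R F j) = F i" for F :: "_ \<Rightarrow> complex"
    by (simp add: axis_def if_distrib[of "\<lambda>x. x *\<^sub>R _"] cong: if_cong)
  then show "partial_deriv i (fourier f) \<eta> = fourier (\<lambda>t. f t * (- \<i> * complex_of_real (t $ i))) \<eta>"
    using partial_deriv_eq[OF fourier_derivative[OF assms], of i] by simp
qed

lemma fourier_coordinate:
  assumes f: "f \<in> schwartz"
  shows "complex_of_real (\<eta> $ i) * fourier f \<eta> = fourier (\<lambda>t. - \<i> * partial_deriv i f t) \<eta>"
proof -
  have eq: "(\<lambda>t. cis (t \<bullet> (- \<eta>))) = (\<lambda>t. cis (- (t \<bullet> \<eta>)))" by simp
  have "(LINT t|lborel. partial_deriv i f t * cis (t \<bullet> (- \<eta>))) = - (LINT t|lborel. f t * (\<i>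
      * complex_of_real ((- \<eta>) $ i) * cis (t \<bullet> (- \<eta>))))"
    using integration_by_parts[OF f cis_multiplier[of "- \<eta>"], of i] unfolding partial_deriv_cis .
  also have "\<dots> = \<i> * complex_of_real (\<eta> $ i) * fourier f \<eta>"
    unfolding fourier_def
    by (simp add: mult_ac integral_mult_right_zero[symmetric] del: integral_mult_right_zero)
  finally have "fourier (partial_deriv i f) \<eta> = \<i> * complex_of_real (\<eta> $ i) * fourier f \<eta>"
    by (simp add: fourier_def)
  moreover have "fourier (\<lambda>t. - \<i> * partial_deriv i f t) \<eta> = - \<i> * fourier (partial_deriv i f) \<eta>"
    unfolding fourier_def by (simp add: mult.assoc)
  ultimately show ?thesis by (simp add: algebra_simps)
qed

lemma norm_fourier_le: "norm (fourier f \<eta>) \<le> (LINT t|lborel. norm (f t))"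
proof -
  have "norm (fourier f \<eta>) \<le> (LINT t|lborel. norm (f t * cis (- (t \<bullet> \<eta>))))"
    unfolding fourier_def by (rule integral_norm_bound)
  then show ?thesis by (simp add: norm_mult)
qed

text \<open>A coordinate factor on the Fourier side is a derivative on the other side, so each power of
the weight costs one derivative of \<open>f\<close>.\<close>

lemma fourier_rapid:
  fixes f :: "real^'n::finite \<Rightarrow> complex"
  assumes "f \<in> schwartz" shows "rapid (fourier f)"
proof -
  have "f \<in> schwartz \<Longrightarrow> \<exists>C. \<forall>\<eta>. (1 + norm \<eta>) ^ N * norm (fourier f \<eta>) \<le> C" for N
  proof (induction N arbitrary: f)
    case 0 then show ?case using norm_fourier_le by auto
  next
    case (Suc N)
    have "(\<lambda>t. - \<i> * partial_deriv i f t) \<in> schwartz" for i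
      by (intro schwartz_cmult schwartz_partial_deriv Suc.prems)
    then have "\<forall>i. \<exists>C. \<forall>\<eta>. (1 + norm \<eta>) ^ N * norm (fourier (\<lambda>t. - \<i> * partial_deriv i f t) \<eta>) \<le> C"
      using Suc.IH by blast
    then obtain C where C: "\<And>i \<eta>. (1 + norm \<eta>) ^ N * norm (fourier (\<lambda>t. - \<i> * partial_deriv i f t) \<eta>) \<le> C i"
      by metis
    obtain D where D: "\<And>\<eta>. (1 + norm \<eta>) ^ N * norm (fourier f \<eta>) \<le> D" using Suc by blast
    have "(1 + norm \<eta>) ^ Suc N * norm (fourier f \<eta>) \<le> D + (\<Sum>i\<in>UNIV. C i)" for \<eta>
    proof -
      have "(1 + norm \<eta>) ^ Suc N * norm (fourier f \<eta>) \<le> (1 + norm \<eta>) ^ N * norm (fourier f \<eta>) * (1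
          + (\<Sum>i\<in>UNIV. \<bar>\<eta> $ i\<bar>))"
        using mult_left_mono[of "1 + norm \<eta>" "1 + (\<Sum>i\<in>UNIV. \<bar>\<eta> $ i\<bar>)" "(1 + norm \<eta>) ^ N * norm (fourier f \<eta>)"]
          norm_le_l1_cart[of \<eta>] by (simp add: mult_ac)
      also have "\<dots> = (1 + norm \<eta>) ^ N * norm (fourier f \<eta>) + (\<Sum>i\<in>UNIV. (1 + norm \<eta>) ^ N
          * norm (complex_of_real (\<eta> $ i) * fourier f \<eta>))"
        by (simp add: distrib_left sum_distrib_left norm_mult mult_ac)
      also have "\<dots> \<le> D + (\<Sum>i\<in>UNIV. C i)"
        unfolding fourier_coordinate[OF Suc.prems] by (intro add_mono sum_mono C D)
      finally show ?thesis .
    qed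
    then show ?case by blast
  qed
  then show ?thesis using assms unfolding rapid_def by blast
qed

lemma fourier_schwartz:
  assumes "f \<in> schwartz" shows "fourier f \<in> schwartz"
proof -
  have "f \<in> schwartz \<Longrightarrow> diff_class rapid n (fourier f)" for n
  proof (induction n arbitrary: f)
    case 0 then show ?case using fourier_derivative differentiable_def by (auto intro!: fourier_rapid, blast)
  next
    case (Suc n)
    then show ?case using fourier_derivative differentiable_def
      by (auto simp: partial_deriv_fourier intro!: fourier_rapid Suc.IH moment_schwartz[simplified], blast)
  qed
  then show ?thesis using assms by (simp add: schwartz_iff_diff_class)
qed

text \<open>Fubini's theorem for the kernel \<open>e\<^sup>-\<^sup>i\<^sup>x\<^sup>y\<close>, which is symmetric in both variables.\<close>

lemma fourier_multiplication:
  fixes f g :: "real^'n::finite \<Rightarrow> complex"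
  assumes f: "integrable lborel f" and g: "integrable lborel g"
  shows "(LINT y|lborel. fourier f y * g y) = (LINT x|lborel. f x * fourier g x)"
proof -
  have [measurable]: "f \<in> borel_measurable borel" "g \<in> borel_measurable borel" using f g by auto
  have "integrable (lborel \<Otimes>\<^sub>M lborel) (\<lambda>(x, y). f x * cis (- (x \<bullet> y)) * g y)"
  proof (rule lborel_pair.Fubini_integrable)
    show "integrable lborel (\<lambda>x. LINT y|lborel. norm (case (x, y) of (x, y) \<Rightarrow> f x * cis (- (x \<bullet> y)) * g y))"
      using f g by (simp add: norm_mult)
    show "AE x in lborel. integrable lborel (\<lambda>y. case (x, y) of (x, y) \<Rightarrow> f x * cis (- (x \<bullet> y)) * g y)"
    proof (rule AE_I2)
      fix x
      have "integrable lborel (\<lambda>y. f x * (g y * cis (- (y \<bullet> x))))"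
        by (intro integrable_mult_right integrable_cis_neg g)
      then show "integrable lborel (\<lambda>y. case (x, y) of (x, y) \<Rightarrow> f x * cis (- (x \<bullet> y)) * g y)"
        by (simp add: mult_ac inner_commute)
    qed
  qed measurable
  from lborel_pair.Fubini_integral[OF this]
  have 1: "(LINT y|lborel. (LINT x|lborel. f x * cis (- (x \<bullet> y)) * g y))
      = (LINT x|lborel. (LINT y|lborel. f x * cis (- (x \<bullet> y)) * g y))" .
  have 2: "(LINT x|lborel. f x * cis (- (x \<bullet> y)) * g y) = fourier f y * g y" for y
    unfolding fourier_def by (rule integral_mult_left_zero)
  have 3: "(LINT y|lborel. f x * cis (- (x \<bullet> y)) * g y) = f x * fourier g x" for x
    unfolding fourier_def integral_mult_right_zero[symmetric] by (simp add: mult_ac inner_commute)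
  show ?thesis using 1 unfolding 2 3 .
qed

lemma gaussian_integrable_real: "integrable lborel (\<lambda>s::real. complex_of_real (exp (- s\<^sup>2 / 2)))"
proof -
  have "integrable lborel (\<lambda>s. sqrt (2 * pi) * std_normal_density s)"
    using integrable_std_normal_moment[of 0] by simp
  then have "integrable lborel (\<lambda>s::real. exp (- s\<^sup>2 / 2))" by (simp add: std_normal_density_def)
  then show ?thesis by (rule integrable_of_real)
qed

lemma gaussian_fourier_real:
  "(LINT s|lborel. complex_of_real (exp (- s\<^sup>2 / 2)) * cis (s * t)) = complex_of_real (sqrt (2 * pi)
      * exp (- t\<^sup>2 / 2))"
proof -
  have "complex_of_real (exp (- t\<^sup>2 / 2)) = (LINT s|std_normal_distribution. iexp (t * s))"
    using fun_cong[OF char_std_normal_distribution, of t] by (simp add: char_def)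
  also have "\<dots> = (LINT s|lborel. std_normal_density s *\<^sub>R iexp (t * s))"
    by (subst integral_density) (auto simp: normal_density_nonneg)
  also have "\<dots> = (LINT s|lborel. complex_of_real (1 / sqrt (2 * pi)) * (complex_of_real (exp (- s\<^sup>2 / 2))
      * cis (s * t)))"
    by (simp add: std_normal_density_def scaleR_conv_of_real cis_conv_exp mult_ac)
  finally show ?thesis by (simp add: field_simps)
qed

definition gauss :: "real^'n::finite \<Rightarrow> complex" where
  "gauss x = complex_of_real (exp (- (x \<bullet> x) / 2))"

lemma gauss_prod: "gauss x = (\<Prod>i\<in>UNIV. complex_of_real (exp (- (x $ i)\<^sup>2 / 2)))"
  by (simp add: gauss_def inner_vec_def exp_sum[symmetric] sum_divide_distrib sum_negf power2_eq_square
      flip: of_real_prod)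

lemma gauss_integrable: "integrable lborel (gauss :: real^'n::finite \<Rightarrow> complex)"
  unfolding gauss_prod[abs_def] by (rule integral_prod_cart(2)) (rule gaussian_integrable_real)

lemma gauss_fourier:
  fixes \<eta> :: "real^'n::finite"
  shows "(LINT x|lborel. gauss x * cis (x \<bullet> \<eta>)) = complex_of_real (sqrt (2 * pi) ^ CARD('n)) * gauss \<eta>"
proof -
  have c: "cis (x \<bullet> \<eta>) = (\<Prod>i\<in>UNIV. cis (x $ i * \<eta> $ i))" for x :: "real^'n"
    by (simp add: inner_vec_def cis_conv_exp exp_sum[symmetric] sum_distrib_left)
  have i: "integrable lborel (\<lambda>s::real. complex_of_real (exp (- s\<^sup>2 / 2)) * cis (s * t))" for t
    by (rule Bochner_Integration.integrable_bound[OF gaussian_integrable_real]) (auto simp: norm_mult)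
  have "(LINT x|lborel. gauss x * cis (x \<bullet> \<eta>)) =
      (LINT x|lborel. (\<Prod>i\<in>UNIV. complex_of_real (exp (- (x $ i)\<^sup>2 / 2)) * cis (x $ i * \<eta> $ i)))"
    by (simp add: gauss_prod c prod.distrib)
  also have "\<dots> = (\<Prod>i\<in>UNIV. complex_of_real (sqrt (2 * pi) * exp (- (\<eta> $ i)\<^sup>2 / 2)))"
    by (subst integral_prod_cart(1)[where f="\<lambda>i s. complex_of_real (exp (- s\<^sup>2 / 2)) * cis (s
        * \<eta> $ i)"]) (rule i, simp only: gaussian_fourier_real)
  also have "\<dots> = complex_of_real (sqrt (2 * pi) ^ CARD('n)) * gauss \<eta>"
    by (simp add: gauss_prod prod.distrib)
  finally show ?thesis .
qed

text \<open>A Gaussian factor that tends to \<open>1\<close> makes the double integral absolutely convergent; on the other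
side of the multiplication formula it becomes an approximate identity. The Gaussian reproduces
itself by the product formula and the one-dimensional characteristic function of the normal
distribution.\<close>

theorem fourier_inversion:
  fixes u :: "real^'n::finite \<Rightarrow> complex"
  assumes u: "u \<in> schwartz"
  shows "fourier (fourier u) (- x) = complex_of_real ((2 * pi) ^ CARD('n)) * u x"
proof -
  define e where "e n = 1 / (real n + 1)" for n
  have e: "0 < e n" for n by (simp add: e_def)
  have e0: "e \<longlonglongrightarrow> 0" unfolding e_def using LIMSEQ_inverse_real_of_nat by (simp add: inverse_eq_divide add.commute)
  let ?d = "CARD('n)" and ?S = "complex_of_real (sqrt (2 * pi) ^ CARD('n))"
  have uh: "fourier u \<in> schwartz" using u by (rule fourier_schwartz)
  have gc: "continuous_on UNIV (gauss :: real^'n \<Rightarrow> complex)" unfolding gauss_def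
      by (intro continuous_intros) auto
  have um [measurable]: "u \<in> borel_measurable borel" "fourier u \<in> borel_measurable borel"
    "(gauss :: real^'n \<Rightarrow> complex) \<in> borel_measurable borel"
    using u uh gc by (auto intro: schwartz_borel borel_measurable_continuous_onI)
  have g1: "norm (gauss y) \<le> 1" for y :: "real^'n" by (simp add: gauss_def)
  define A where "A n = (LINT \<eta>|lborel. fourier u \<eta> * (gauss (e n *\<^sub>R \<eta>) * cis (\<eta> \<bullet> x)))" for n
  have "A \<longlonglongrightarrow> (LINT \<eta>|lborel. fourier u \<eta> * (gauss (0::real^'n) * cis (\<eta> \<bullet> x)))"
    unfolding A_def
  proof (rule integral_dominated_convergence[where w="\<lambda>\<eta>. norm (fourier u \<eta>)"])
    show "AE \<eta> in lborel. (\<lambda>n. fourier u \<eta> * (gauss (e n *\<^sub>R \<eta>) * cis (\<eta> \<bullet> x))) \<longlonglongrightarrow> fourier u \<eta>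
        * (gauss (0::real^'n) * cis (\<eta> \<bullet> x))"
    proof (rule AE_I2)
      fix \<eta> :: "real^'n"
      have "(\<lambda>n. gauss (e n *\<^sub>R \<eta>)) \<longlonglongrightarrow> gauss (0 *\<^sub>R \<eta>)"
        by (intro continuous_on_tendsto_compose[OF gc] tendsto_scaleR e0 tendsto_const) auto
      then show "(\<lambda>n. fourier u \<eta> * (gauss (e n *\<^sub>R \<eta>) * cis (\<eta> \<bullet> x))) \<longlonglongrightarrow> fourier u \<eta>
          * (gauss (0::real^'n) * cis (\<eta> \<bullet> x))"
        by (auto intro!: tendsto_intros)
    qed
    show "AE \<eta> in lborel. norm (fourier u \<eta> * (gauss (e n *\<^sub>R \<eta>) * cis (\<eta> \<bullet> x))) \<le> norm (fourier u \<eta>)" for n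
      using g1 by (auto simp: norm_mult intro!: mult_left_le)
  qed (use schwartz_integrable[OF uh] in \<open>auto\<close>)
  moreover have "(LINT \<eta>|lborel. fourier u \<eta> * (gauss (0::real^'n) * cis (\<eta> \<bullet> x))) = fourier (fourier u) (- x)"
    by (simp add: fourier_def[of "fourier u"] gauss_def)
  ultimately have 1: "A \<longlonglongrightarrow> fourier (fourier u) (- x)" by simp
  have "A n = ?S * (LINT s|lborel. u (x + e n *\<^sub>R s) * gauss s)" for n
  proof -
    have gi: "integrable lborel (\<lambda>\<eta>::real^'n. gauss (e n *\<^sub>R \<eta>))"
      using integrable_affine[OF gauss_integrable, of "e n" 0] e[of n] by simp
    have F: "fourier (\<lambda>\<eta>. gauss (e n *\<^sub>R \<eta>) * cis (\<eta> \<bullet> x)) t = ?S * gauss ((x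
        - t) /\<^sub>R e n) / complex_of_real (e n ^ ?d)" for t
    proof -
      have "?S * gauss ((x - t) /\<^sub>R e n) = (LINT \<eta>|lborel. gauss \<eta> * cis (\<eta> \<bullet> ((x - t) /\<^sub>R e n)))"
        by (rule gauss_fourier[symmetric])
      also have "\<dots> = complex_of_real (\<bar>e n\<bar> ^ ?d) * (LINT \<eta>|lborel. gauss (0 + e n *\<^sub>R \<eta>) * cis ((0
          + e n *\<^sub>R \<eta>) \<bullet> ((x - t) /\<^sub>R e n)))"
        by (rule integral_affine[where r="e n"]) (use e[of n] in auto)
      also have "(LINT \<eta>|lborel. gauss (0 + e n *\<^sub>R \<eta>) * cis ((0 + e n *\<^sub>R \<eta>) \<bullet> ((x - t) /\<^sub>R e n)))
          = fourier (\<lambda>\<eta>. gauss (e n *\<^sub>R \<eta>) * cis (\<eta> \<bullet> x)) t"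
          unfolding fourier_def
        proof (rule Bochner_Integration.integral_cong[OF refl])
          fix \<eta>
          have "(0 + e n *\<^sub>R \<eta>) \<bullet> ((x - t) /\<^sub>R e n) = \<eta> \<bullet> x + - (\<eta> \<bullet> t)"
            using e[of n] by (simp add: inner_diff_right field_simps)
          then show "gauss (0 + e n *\<^sub>R \<eta>) * cis ((0 + e n *\<^sub>R \<eta>) \<bullet> ((x - t) /\<^sub>R e n)) =
              gauss (e n *\<^sub>R \<eta>) * cis (\<eta> \<bullet> x) * cis (- (\<eta> \<bullet> t))"
            by (simp only: cis_mult[symmetric] add_0 mult.assoc)
        qed
      finally show ?thesis using e[of n] by (simp add: field_simps)
    qed
    have "A n = (LINT t|lborel. u t * fourier (\<lambda>\<eta>. gauss (e n *\<^sub>R \<eta>) * cis (\<eta> \<bullet> x)) t)"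
      unfolding A_def using integrable_cis[OF gi, of 1 x] schwartz_integrable[OF u]
      by (intro fourier_multiplication) auto
    also have "\<dots> = (LINT t|lborel. u t * (?S * gauss ((x - t) /\<^sub>R e n) / complex_of_real (e n ^ ?d)))"
      unfolding F ..
    also have "\<dots> = complex_of_real (\<bar>e n\<bar> ^ ?d) * (LINT s|lborel. u (x + e n *\<^sub>R s) * (?S * gauss ((x
        - (x + e n *\<^sub>R s)) /\<^sub>R e n) / complex_of_real (e n ^ ?d)))"
      by (rule integral_affine[where r="e n"]) (use e[of n] in auto)
    also have "\<dots> = complex_of_real (\<bar>e n\<bar> ^ ?d) * (LINT s|lborel. (?S / complex_of_real (e n ^ ?d))
        * (u (x + e n *\<^sub>R s) * gauss s))"
      using e[of n] by (simp add: gauss_def mult_ac)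
    also have "\<dots> = ?S * (LINT s|lborel. u (x + e n *\<^sub>R s) * gauss s)"
      using e[of n] by (simp add: abs_of_pos)
    finally show ?thesis .
  qed
  then have "A = (\<lambda>n. ?S * (LINT s|lborel. u (x + e n *\<^sub>R s) * gauss s))" by auto
  moreover have "(\<lambda>n. LINT s|lborel. u (x + e n *\<^sub>R s) * gauss s) \<longlonglongrightarrow> (LINT s|lborel. u x * gauss (s::real^'n))"
  proof -
    obtain C where C: "\<And>x. norm (u x) \<le> C / (1 + norm x) ^ 0"
        using rapid_le[OF schwartz_rapid[OF u], of 0] by metis
    show ?thesis
    proof (rule integral_dominated_convergence[where w="\<lambda>s. C * norm (gauss s)"])
      show "AE s in lborel. (\<lambda>n. u (x + e n *\<^sub>R s) * gauss s) \<longlonglongrightarrow> u x * gauss s"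
      proof (rule AE_I2)
        fix s :: "real^'n"
        have "(\<lambda>n. u (x + e n *\<^sub>R s)) \<longlonglongrightarrow> u (x + 0 *\<^sub>R s)"
          by (intro continuous_on_tendsto_compose[OF schwartz_continuous_on[OF u, of UNIV]]
              tendsto_intros e0) auto
        then show "(\<lambda>n. u (x + e n *\<^sub>R s) * gauss s) \<longlonglongrightarrow> u x * gauss s" by (auto intro!: tendsto_intros)
      qed
    qed (use C gauss_integrable in \<open>auto simp: norm_mult intro!: mult_right_mono integrable_norm\<close>)
  qed
  ultimately have "A \<longlonglongrightarrow> ?S * (LINT s|lborel. u x * gauss (s::real^'n))" by (auto intro!: tendsto_intros)
  moreover have "(LINT s|lborel. u x * gauss (s::real^'n)) = u x * ?S"
    using gauss_fourier[of "0::real^'n"] by (simp add: gauss_def[of 0])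
  ultimately have "A \<longlonglongrightarrow> ?S * (u x * ?S)" by (simp only:)
  then have "fourier (fourier u) (- x) = ?S * (u x * ?S)"
    by (rule LIMSEQ_unique[OF 1])
  also have "?S * (u x * ?S) = complex_of_real (sqrt (2 * pi) ^ ?d * sqrt (2 * pi) ^ ?d) * u x"
    by (simp only: of_real_mult mult_ac)
  also have "sqrt (2 * pi) ^ ?d * sqrt (2 * pi) ^ ?d = (2 * pi) ^ ?d"
    unfolding power_mult_distrib[symmetric] real_sqrt_mult_self by simp
  finally show ?thesis .
qed

section \<open>Packing estimates and infinite sums\<close>

text \<open>On a ball of radius at most \<open>1\<close> the weight varies by at most the factor \<open>2\<^sup>M\<close>. Hence each
summand is bounded by the integral of the weight over its ball, and disjoint balls share a single
convergent integral. The radii may vary; they are constant for lattices, and for the centers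
of a subdyadic lattice they shrink like a negative power of the weight.\<close>

lemma packing_bound:
  assumes "M \<ge> 2 * CARD('n)"
  obtains P where "P \<ge> 0" and
    "\<And>I (y :: 'i \<Rightarrow> real^'n::finite) s. finite I \<Longrightarrow> (\<And>i. i \<in> I \<Longrightarrow> 0 < s i \<and> s i \<le> 1) \<Longrightarrow>
      (\<And>i j. i \<in> I \<Longrightarrow> j \<in> I \<Longrightarrow> i \<noteq> j \<Longrightarrow> ball (y i) (s i) \<inter> ball (y j) (s j) = {}) \<Longrightarrow>
      (\<Sum>i\<in>I. s i ^ CARD('n) / (1 + norm (y i)) ^ M) \<le> P"
proof
  let ?w = "\<lambda>x::real^'n. 2 ^ M * (1 / (1 + norm x) ^ M)"
  let ?v = "unit_ball_vol (real CARD('n))"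
  let ?P = "(LINT x|lborel. ?w x) / ?v"
  have wi: "integrable lborel ?w" by (intro integrable_mult_right integrable_weight assms)
  have v: "?v > 0" by simp
  show "?P \<ge> 0" by (intro divide_nonneg_pos v integral_nonneg_AE) auto
  fix I and y :: "'i \<Rightarrow> real^'n" and s
  assume fin: "finite I" and s: "\<And>i. i \<in> I \<Longrightarrow> 0 < s i \<and> s i \<le> 1"
    and disj: "\<And>i j. i \<in> I \<Longrightarrow> j \<in> I \<Longrightarrow> i \<noteq> j \<Longrightarrow> ball (y i) (s i) \<inter> ball (y j) (s j) = {}"
  have bi: "integrable lborel (\<lambda>x. indicator (ball (y i) (s i)) x * ?w x)" for i
    by (rule Bochner_Integration.integrable_bound[OF wi]) (auto simp: indicator_def)
  have ii: "integrable lborel (\<lambda>x. indicator (ball (y i) (s i)) x * (1 / (1 + norm (y i)) ^ M))" for i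
    by (intro integrable_mult_left integrable_real_indicator) (use emeasure_lborel_ball_finite[unfolded
        infinity_ennreal_def] in auto)
  have "?v * (\<Sum>i\<in>I. s i ^ CARD('n) / (1 + norm (y i)) ^ M) =
      (\<Sum>i\<in>I. (LINT x|lborel. indicator (ball (y i) (s i)) x * (1 / (1 + norm (y i)) ^ M)))"
    unfolding sum_distrib_left
  proof (rule sum.cong[OF refl])
    fix i assume "i \<in> I"
    have "measure lborel (ball (y i) (s i)) = ?v * s i ^ CARD('n)"
      using content_ball[of "s i" "y i"] s[OF \<open>i \<in> I\<close>] by simp
    then show "?v * (s i ^ CARD('n) / (1 + norm (y i)) ^ M) =
        (LINT x|lborel. indicator (ball (y i) (s i)) x * (1 / (1 + norm (y i)) ^ M))"
      by simp
  qed
  also have "\<dots> \<le> (\<Sum>i\<in>I. (LINT x|lborel. indicator (ball (y i) (s i)) x * ?w x))"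
  proof (intro sum_mono integral_mono[OF ii bi])
    fix i x assume i: "i \<in> I"
    show "indicator (ball (y i) (s i)) x * (1 / (1 + norm (y i)) ^ M) \<le> indicator (ball (y i) (s i)) x * ?w x"
    proof (cases "x \<in> ball (y i) (s i)")
      case True
      then have "dist (y i) x < 1" using s[OF i] by auto
      then have "norm x \<le> norm (y i) + 1"
        using norm_triangle_ineq2[of x "y i"] by (simp add: dist_norm norm_minus_commute)
      then have "1 + norm x \<le> 2 * (1 + norm (y i))"
        by (smt (verit) norm_ge_zero)
      then have "(1 + norm x) ^ M \<le> (2 * (1 + norm (y i))) ^ M" by (intro power_mono) auto
      then have "(1 + norm x) ^ M \<le> 2 ^ M * (1 + norm (y i)) ^ M" by (simp only: power_mult_distrib)
      moreover have "0 < (1 + norm x) ^ M" "0 < (1 + norm (y i)) ^ M"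
          by (auto intro!: zero_less_power add_pos_nonneg)
      ultimately have "1 / (1 + norm (y i)) ^ M \<le> ?w x" by (simp add: divide_simps mult_ac)
      then show ?thesis using True by simp
    qed simp
  qed
  also have "\<dots> = (LINT x|lborel. (\<Sum>i\<in>I. indicator (ball (y i) (s i)) x * ?w x))"
    using bi by (subst Bochner_Integration.integral_sum) auto
  also have "\<dots> \<le> (LINT x|lborel. ?w x)"
  proof (intro integral_mono wi Bochner_Integration.integrable_sum bi)
    fix x
    have "(\<Sum>i\<in>I. indicator (ball (y i) (s i)) x :: real) \<le> 1"
    proof (cases "\<exists>i\<in>I. x \<in> ball (y i) (s i)")
      case True
      then obtain i where i: "i \<in> I" "x \<in> ball (y i) (s i)" by blast
      have "indicator (ball (y j) (s j)) x = (if j = i then 1 else 0 :: real)" if "j \<in> I" for j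
        using disj[OF that i(1)] i(2) by (cases "j = i") (auto
            simp: indicator_def disjoint_iff simp del: mem_ball)
      then show ?thesis using fin by simp
    qed simp
    then have "(\<Sum>i\<in>I. indicator (ball (y i) (s i)) x) * ?w x \<le> 1 * ?w x"
      by (intro mult_right_mono) auto
    then show "(\<Sum>i\<in>I. indicator (ball (y i) (s i)) x * ?w x) \<le> ?w x"
      by (simp only: sum_distrib_right mult_1)
  qed
  finally show "(\<Sum>i\<in>I. s i ^ CARD('n) / (1 + norm (y i)) ^ M) \<le> ?P"
    by (subst pos_le_divide_eq[OF v]) (simp only: mult.commute)
qed

definition intvec :: "int^'n::finite \<Rightarrow> real^'n" where
  "intvec j = (\<chi> i. real_of_int (j $ i))"

lemma intvec_diff: "intvec (j - k) = intvec j - intvec k"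
  and intvec_add: "intvec (j + k) = intvec j + intvec k"
  and intvec_axis: "intvec (axis i m) = axis i (real_of_int m)"
  by (auto simp: intvec_def vec_eq_iff axis_def)

lemma norm_intvec_ge: assumes "j \<noteq> 0" shows "norm (intvec j) \<ge> 1"
proof -
  obtain i where "j $ i \<noteq> 0" using assms by (auto simp: vec_eq_iff)
  then have "1 \<le> \<bar>real_of_int (j $ i)\<bar>" by linarith
  also have "\<dots> = \<bar>intvec j $ i\<bar>" by (simp add: intvec_def)
  also have "\<dots> \<le> norm (intvec j)" by (rule component_le_norm_cart)
  finally show ?thesis .
qed

text \<open>The bound is uniform over all translates of the lattice, because packing does not see where the
lattice is placed.\<close>

lemma lattice_sum_bound:
  assumes M: "M \<ge> 2 * CARD('n::finite)" and d: "\<delta> > 0"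
  obtains P where "P \<ge> 0" "\<And>x J. finite J \<Longrightarrow> (\<Sum>j\<in>J. 1 / (1 + norm (\<delta> *\<^sub>R intvec j + (x::real^'n))) ^ M) \<le> P"
proof -
  obtain P where P0: "P \<ge> 0" and P: "\<And>I (y :: int^'n \<Rightarrow> real^'n) s. finite I \<Longrightarrow> (\<And>i. i \<in> I \<Longrightarrow> 0 < s i \<and> s i \<le> 1) \<Longrightarrow>
      (\<And>i j. i \<in> I \<Longrightarrow> j \<in> I \<Longrightarrow> i \<noteq> j \<Longrightarrow> ball (y i) (s i) \<inter> ball (y j) (s j) = {}) \<Longrightarrow>
      (\<Sum>i\<in>I. s i ^ CARD('n) / (1 + norm (y i)) ^ M) \<le> P"
    by (rule packing_bound[OF M, where 'i="int^'n"]) blast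
  define s where "s = min 1 (\<delta> / 2)"
  have s: "0 < s" "s \<le> 1" "s \<le> \<delta> / 2" using d by (auto simp: s_def)
  have disj: "ball (\<delta> *\<^sub>R intvec i + x) s \<inter> ball (\<delta> *\<^sub>R intvec j + x) s = {}" if "i \<noteq> j" for i j
      and x :: "real^'n"
  proof -
    have "1 \<le> norm (intvec (i - j))" using that by (intro norm_intvec_ge) auto
    then have "\<delta> * 1 \<le> \<delta> * norm (intvec (i - j))" using d by (intro mult_left_mono) auto
    also have "\<dots> = dist (\<delta> *\<^sub>R intvec i + x) (\<delta> *\<^sub>R intvec j + x)"
      using d by (simp add: dist_norm intvec_diff flip: scaleR_diff_right)
    finally show ?thesis using s by (intro disjoint_ballI) auto
  qed
  show ?thesis
  proof
    show "P / s ^ CARD('n) \<ge> 0" using P0 s by auto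
    fix x :: "real^'n" and J :: "(int^'n) set" assume "finite J"
    then have "(\<Sum>j\<in>J. s ^ CARD('n) / (1 + norm (\<delta> *\<^sub>R intvec j + x)) ^ M) \<le> P"
      using P[of J "\<lambda>_. s" "\<lambda>j. \<delta> *\<^sub>R intvec j + x"] s disj by auto
    moreover have "(\<Sum>j\<in>J. s ^ CARD('n) / (1 + norm (\<delta> *\<^sub>R intvec j + x)) ^ M) =
        (\<Sum>j\<in>J. 1 / (1 + norm (\<delta> *\<^sub>R intvec j + x)) ^ M) * s ^ CARD('n)"
      by (simp add: sum_distrib_right)
    ultimately show "(\<Sum>j\<in>J. 1 / (1 + norm (\<delta> *\<^sub>R intvec j + x)) ^ M) \<le> P / s ^ CARD('n)"
      using s by (simp add: pos_le_divide_eq)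
  qed
qed

lemma lattice_sum_rapid:
  fixes G :: "real^'n::finite \<Rightarrow> complex"
  assumes G: "rapid G" and d: "\<delta> > 0"
  obtains P where "P \<ge> 0" "\<And>x J. finite J \<Longrightarrow> (\<Sum>j\<in>J. norm (G (\<delta> *\<^sub>R intvec j + x)) * (1
      + norm (\<delta> *\<^sub>R intvec j + x)) ^ N) \<le> P"
proof -
  let ?M = "2 * CARD('n)"
  obtain C where C: "\<And>x. norm (G x) \<le> C / (1 + norm x) ^ (?M + N)" "C \<ge> 0" using rapid_le[OF G] by metis
  obtain P where P: "P \<ge> 0" "\<And>x J. finite J \<Longrightarrow> (\<Sum>j\<in>J. 1 / (1 + norm (\<delta> *\<^sub>R intvec j + (x::real^'n))) ^ ?M) \<le> P"
    using lattice_sum_bound[OF _ d, of ?M] by (metis order_refl)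
  show ?thesis
  proof
    show "C * P \<ge> 0" using C P by simp
    fix x :: "real^'n" and J :: "(int^'n) set" assume J: "finite J"
    have le: "norm (G z) * (1 + norm z) ^ N \<le> C * (1 / (1 + norm z) ^ ?M)" for z
    proof -
      have p: "(1 + norm z) ^ k > 0" for k by (intro zero_less_power) (simp add: add_pos_nonneg)
      have "norm (G z) * (1 + norm z) ^ N \<le> C / (1 + norm z) ^ (?M + N) * (1 + norm z) ^ N"
        by (intro mult_right_mono C) auto
      also have "\<dots> = C * (1 / (1 + norm z) ^ ?M)" using p[of N] by (simp add: power_add)
      finally show ?thesis .
    qed
    have "(\<Sum>j\<in>J. norm (G (\<delta> *\<^sub>R intvec j + x)) * (1 + norm (\<delta> *\<^sub>R intvec j + x)) ^ N) \<le>
        (\<Sum>j\<in>J. C * (1 / (1 + norm (\<delta> *\<^sub>R intvec j + x)) ^ ?M))"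
      by (intro sum_mono le)
    also have "\<dots> \<le> C * P" unfolding sum_distrib_left[symmetric] by (intro mult_left_mono P C J)
    finally show "(\<Sum>j\<in>J. norm (G (\<delta> *\<^sub>R intvec j + x)) * (1 + norm (\<delta> *\<^sub>R intvec j + x)) ^ N) \<le> C * P" .
  qed
qed

lemma summable_onI_bound:
  fixes f :: "'i \<Rightarrow> real"
  assumes "\<And>i. f i \<ge> 0" "\<And>J. finite J \<Longrightarrow> sum f J \<le> B"
  shows "f summable_on UNIV"
  using assms by (intro nonneg_bdd_above_summable_on bdd_aboveI2[where M=B]) auto

lemma has_sum_diff:
  fixes f g :: "'i \<Rightarrow> 'b::real_normed_vector"
  assumes "(f has_sum a) S" "(g has_sum b) S"
  shows "((\<lambda>x. f x - g x) has_sum a - b) S"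
  using assms unfolding has_sum_def sum_subtractf by (rule tendsto_diff)

lemma has_sum_tail_bound:
  fixes f :: "'i \<Rightarrow> 'b::banach"
  assumes f: "(f has_sum s) UNIV" and b: "(b has_sum B) UNIV" and le: "\<And>j. norm (f j) \<le> b j" and J: "finite J"
  shows "norm (s - sum f J) \<le> B - sum b J"
  by (rule norm_infsum_le[where X="UNIV - J" and f=f and g=b])
    (auto intro!: has_sum_Diff f b has_sum_finite J le)

text \<open>Termwise integration of a series dominated by a summable sequence times one integrable function.\<close>

lemma has_sum_integral:
  fixes F :: "'i \<Rightarrow> 'a::euclidean_space \<Rightarrow> complex"
  assumes F: "\<And>j. F j \<in> borel_measurable \<mu>" and S: "S \<in> borel_measurable \<mu>" and w: "integrable \<mu> w"
    and le: "\<And>j x. norm (F j x) \<le> b j * w x" and b: "b summable_on UNIV" and w0: "\<And>x. w x \<ge> 0"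
    and b0: "\<And>j. b j \<ge> 0"
    and sum: "\<And>x. ((\<lambda>j. F j x) has_sum S x) UNIV"
  shows "((\<lambda>j. integral\<^sup>L \<mu> (F j)) has_sum integral\<^sup>L \<mu> S) UNIV"
proof -
  obtain B where B: "(b has_sum B) UNIV" using b by (auto simp: summable_on_def)
  have Fi: "integrable \<mu> (F j)" for j
  proof (rule Bochner_Integration.integrable_bound)
    show "integrable \<mu> (\<lambda>x. b j * w x)" using w by simp
    show "AE x in \<mu>. norm (F j x) \<le> norm (b j * w x)" using le w0 b0 by simp
  qed (rule F)
  have tail: "norm (S x - (\<Sum>j\<in>J. F j x)) \<le> (B - sum b J) * w x" if "finite J" for J x
  proof -
    have "norm (S x - (\<Sum>j\<in>J. F j x)) \<le> B * w x - (\<Sum>j\<in>J. b j * w x)"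
      by (rule has_sum_tail_bound[OF sum has_sum_cmult_left[OF B] le that])
    then show ?thesis by (simp add: left_diff_distrib sum_distrib_right)
  qed
  have Si: "integrable \<mu> S"
  proof (rule Bochner_Integration.integrable_bound)
    show "integrable \<mu> (\<lambda>x. B * w x)" using w by simp
    have "B \<ge> 0" using has_sum_nonneg[OF B] b0 by simp
    then show "AE x in \<mu>. norm (S x) \<le> norm (B * w x)" using tail[of "{}"] w0 by simp
  qed (rule S)
  have "((\<lambda>J. sum (\<lambda>j. integral\<^sup>L \<mu> (F j)) J - integral\<^sup>L \<mu> S) \<longlongrightarrow> 0) (finite_subsets_at_top UNIV)"
  proof (rule Lim_null_comparison)
    have "((\<lambda>J. sum b J) \<longlongrightarrow> B) (finite_subsets_at_top UNIV)" using B by (simp add: has_sum_def)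
    then have "((\<lambda>J. (B - sum b J) * integral\<^sup>L \<mu> w) \<longlongrightarrow> (B - B) * integral\<^sup>L \<mu> w) (finite_subsets_at_top UNIV)"
      by (intro tendsto_intros)
    then show "((\<lambda>J. (B - sum b J) * integral\<^sup>L \<mu> w) \<longlongrightarrow> 0) (finite_subsets_at_top UNIV)" by simp
    show "\<forall>\<^sub>F J in finite_subsets_at_top UNIV. norm (sum (\<lambda>j. integral\<^sup>L \<mu> (F j)) J - integral\<^sup>L \<mu> S) \<le> (B
        - sum b J) * integral\<^sup>L \<mu> w"
    proof (rule eventually_finite_subsets_at_top_weakI)
      fix J :: "'i set" assume J: "finite J"
      have "norm (sum (\<lambda>j. integral\<^sup>L \<mu> (F j)) J - integral\<^sup>L \<mu> S) = norm (\<integral>x. S x - (\<Sum>j\<in>J. F j x) \<partial>\<mu>)"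
        using Si Fi by (simp add: Bochner_Integration.integral_diff Bochner_Integration.integral_sum
            norm_minus_commute)
      also have "\<dots> \<le> (\<integral>x. (B - sum b J) * w x \<partial>\<mu>)"
        by (rule Bochner_Integration.integral_norm_bound_integral) (use Si Fi w tail J in auto)
      finally show "norm (sum (\<lambda>j. integral\<^sup>L \<mu> (F j)) J - integral\<^sup>L \<mu> S) \<le> (B - sum b J) * integral\<^sup>L \<mu> w"
        by simp
    qed
  qed
  then show ?thesis unfolding has_sum_def by (simp add: LIM_zero_iff)
qed

section \<open>Fourier series on cubes\<close>

definition open_cube :: "real^'n::finite \<Rightarrow> real \<Rightarrow> (real^'n) set" where
  "open_cube c \<Lambda> = {\<eta>. \<forall>i. \<bar>\<eta> $ i - c $ i\<bar> < \<Lambda>}"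

definition closed_cube :: "real^'n::finite \<Rightarrow> real \<Rightarrow> (real^'n) set" where
  "closed_cube c \<Lambda> = {\<eta>. \<forall>i. \<bar>\<eta> $ i - c $ i\<bar> \<le> \<Lambda>}"

lemma closed_cube_cbox: "closed_cube c \<Lambda> = cbox (\<chi> i. c $ i - \<Lambda>) (\<chi> i. c $ i + \<Lambda>)"
  by (auto simp: closed_cube_def mem_box_cart abs_le_iff algebra_simps)

lemma compact_closed_cube: "compact (closed_cube c \<Lambda>)"
  by (simp add: closed_cube_cbox)

lemma open_open_cube: "open (open_cube c \<Lambda>)"
proof -
  have "open_cube c \<Lambda> = (\<Inter>i\<in>UNIV. {\<eta>. \<bar>\<eta> $ i - c $ i\<bar> < \<Lambda>})" by (auto simp: open_cube_def)
  then show ?thesis by (auto intro!: open_INT open_Collect_less continuous_intros)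
qed

lemma open_cube_subset: "open_cube c \<Lambda> \<subseteq> closed_cube c \<Lambda>"
  by (auto simp: open_cube_def closed_cube_def less_imp_le)

text \<open>The frequencies of the exponentials that are periodic with respect to a cube of half-side
\<open>\<Lambda>\<close>. In the frame, the cube is a frequency cube and these are the spatial nodes.\<close>

definition dual_node :: "real \<Rightarrow> int^'n::finite \<Rightarrow> real^'n" where
  "dual_node \<Lambda> j = (pi / \<Lambda>) *\<^sub>R intvec j"

lemma dual_node_component: "dual_node \<Lambda> j $ i = pi / \<Lambda> * real_of_int (j $ i)"
  by (simp add: dual_node_def intvec_def)

lemma dual_node_diff: "dual_node \<Lambda> (j - k) = dual_node \<Lambda> j - dual_node \<Lambda> k"
  and dual_node_add: "dual_node \<Lambda> (j + k) = dual_node \<Lambda> j + dual_node \<Lambda> k"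
  by (simp_all add: dual_node_def intvec_diff intvec_add scaleR_diff_right scaleR_add_right)

lemma integral_interval_cis:
  assumes L: "\<Lambda> > 0"
  shows "(LINT t|lborel. indicator {a - \<Lambda>..a + \<Lambda>} t *\<^sub>R cis (t * (pi / \<Lambda> * real_of_int m))) =
    (if m = 0 then complex_of_real (2 * \<Lambda>) else 0)"
proof (cases "m = 0")
  case True
  then show ?thesis using L by (simp add: scaleR_conv_of_real)
next
  case False
  define w where "w = pi / \<Lambda> * real_of_int m"
  have w: "w \<noteq> 0" using False L by (simp add: w_def)
  have Lw: "\<Lambda> * w = pi * of_int m" using L by (simp add: w_def)
  let ?F = "\<lambda>t. cis (t * w) / (\<i> * complex_of_real w)"
  have D: "(?F has_vector_derivative cis (t * w)) (at t within S)" for t S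
  proof -
    have "((\<lambda>t. exp (complex_of_real t * (\<i> * complex_of_real w)) / (\<i>
        * complex_of_real w)) has_vector_derivative
        exp (complex_of_real t * (\<i> * complex_of_real w))) (at t within S)"
      using w by (auto intro!: derivative_eq_intros has_vector_derivative_real_field)
    then show ?thesis by (simp add: cis_conv_exp mult_ac)
  qed
  have "(LINT t|lborel. indicator {a - \<Lambda>..a + \<Lambda>} t *\<^sub>R cis (t * w)) = ?F (a + \<Lambda>) - ?F (a - \<Lambda>)"
    using L by (intro integral_FTC_Icc D continuous_intros) auto
  also have "\<dots> = cis (a * w) * (cis (pi * of_int m) - cis (- (pi * of_int m))) / (\<i> * complex_of_real w)"
    by (simp add: distrib_right left_diff_distrib Lw diff_divide_distrib right_diff_distrib cis_mult)
  also have "cis (pi * of_int m) - cis (- (pi * of_int m)) = 0"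
    by (simp add: complex_eq_iff)
  finally show ?thesis using False by (simp add: w_def)
qed

lemma integral_cube_cis:
  fixes c :: "real^'n::finite"
  assumes L: "\<Lambda> > 0"
  shows "(LINT \<eta>|lborel. indicator (closed_cube c \<Lambda>) \<eta> *\<^sub>R cis (\<eta> \<bullet> dual_node \<Lambda> j)) =
    (if j = 0 then complex_of_real ((2 * \<Lambda>) ^ CARD('n)) else 0)"
proof -
  have i: "integrable lborel (\<lambda>t::real. indicator {a - \<Lambda>..a + \<Lambda>} t *\<^sub>R cis (t * w))" for a w
    by (intro borel_integrable_compact continuous_intros) auto
  have ind: "(indicator (closed_cube c \<Lambda>) \<eta> :: real) = (\<Prod>i\<in>UNIV. indicator {c $ i - \<Lambda>..c $ i
      + \<Lambda>} (\<eta> $ i))" for \<eta>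
  proof (cases "\<eta> \<in> closed_cube c \<Lambda>")
    case True
    then have "\<eta> $ i \<in> {c $ i - \<Lambda>..c $ i + \<Lambda>}" for i by (auto simp: closed_cube_def abs_le_iff algebra_simps)
    then show ?thesis using True by simp
  next
    case False
    then obtain i where "\<eta> $ i \<notin> {c $ i - \<Lambda>..c $ i + \<Lambda>}" by (auto
        simp: closed_cube_def abs_le_iff algebra_simps)
    then have "\<exists>i. indicator {c $ i - \<Lambda>..c $ i + \<Lambda>} (\<eta> $ i) = (0::real)" by (auto simp: indicator_def)
    then show ?thesis using False by (subst prod_zero) auto
  qed
  have cis: "cis (\<eta> \<bullet> y) = (\<Prod>i\<in>UNIV. cis (\<eta> $ i * y $ i))" for \<eta> y :: "real^'n"
    by (simp add: inner_vec_def cis_conv_exp exp_sum[symmetric] sum_distrib_left)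
  have "(LINT \<eta>|lborel. indicator (closed_cube c \<Lambda>) \<eta> *\<^sub>R cis (\<eta> \<bullet> dual_node \<Lambda> j)) =
      (LINT \<eta>|lborel. (\<Prod>i\<in>UNIV. indicator {c $ i - \<Lambda>..c $ i + \<Lambda>} (\<eta> $ i) *\<^sub>R cis (\<eta> $ i * (pi / \<Lambda>
          * real_of_int (j $ i)))))"
    unfolding ind cis dual_node_component scaleR_conv_of_real of_real_prod prod.distrib ..
  also have "\<dots> = (\<Prod>i\<in>UNIV. (if j $ i = 0 then complex_of_real (2 * \<Lambda>) else 0))"
    by (subst integral_prod_cart(1)[where f="\<lambda>i t. indicator {c $ i - \<Lambda>..c $ i + \<Lambda>} t *\<^sub>R cis (t
        * (pi / \<Lambda> * real_of_int (j $ i)))"])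
      (rule i, simp only: integral_interval_cis[OF L])
  also have "\<dots> = (if j = 0 then complex_of_real ((2 * \<Lambda>) ^ CARD('n)) else 0)"
  proof (cases "j = 0")
    case False
    then obtain i where "j $ i \<noteq> 0" by (auto simp: vec_eq_iff)
    then show ?thesis using False by (subst prod_zero) auto
  qed simp
  finally show ?thesis .
qed

text \<open>Let \<open>T\<close> be the average over the coordinates of \<open>(1 + cos) / 2\<close>, centred at \<open>\<eta>0\<close>. Its powers are
trigonometric polynomials, so the integrals of \<open>D T\<^sup>k\<close> vanish. But on the closed cube \<open>T\<close> takes the
value \<open>1\<close> only at the interior point \<open>\<eta>0\<close>, so \<open>T\<^sup>k\<close> concentrates there. If
\<open>D \<eta>0\<close> were not zero, then for large \<open>k\<close> the integral times the conjugate of \<open>D \<eta>0\<close> would have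
positive real part.\<close>

lemma fourier_coefficients_unique:
  fixes D :: "real^'n::finite \<Rightarrow> complex"
  assumes L: "\<Lambda> > 0" and cont: "continuous_on (closed_cube c \<Lambda>) D"
    and zero: "\<And>j. (LINT \<eta>|lborel. indicator (closed_cube c \<Lambda>) \<eta> *\<^sub>R (D \<eta> * cis (\<eta> \<bullet> dual_node \<Lambda> j))) = 0"
    and \<eta>0: "\<eta>0 \<in> open_cube c \<Lambda>"
  shows "D \<eta>0 = 0"
proof (rule ccontr)
  assume D0: "D \<eta>0 \<noteq> 0"
  let ?Q = "closed_cube c \<Lambda>" and ?d = "real CARD('n)"
  define T where "T \<eta> = (\<Sum>i\<in>UNIV. 1 + cos (pi / \<Lambda> * (\<eta> $ i - \<eta>0 $ i))) / (2 * ?d)" for \<eta> :: "real^'n"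
  have dpos: "?d > 0" by simp
  have Tc: "continuous_on S T" for S unfolding T_def by (intro continuous_intros) auto
  have T0: "0 \<le> T \<eta>" for \<eta>
  proof -
    have "0 \<le> 1 + cos z" for z :: real using cos_ge_minus_one[of z] by linarith
    then show ?thesis unfolding T_def by (intro divide_nonneg_pos sum_nonneg) auto
  qed
  have T1: "T \<eta> \<le> 1" for \<eta>
  proof -
    have "(\<Sum>i\<in>(UNIV::'n set). 1 + cos (pi / \<Lambda> * (\<eta> $ i - \<eta>0 $ i))) \<le> (\<Sum>i\<in>(UNIV::'n set). 2)"
      by (intro sum_mono) simp
    then show ?thesis unfolding T_def by (simp add: divide_le_eq_1)
  qed
  have T\<eta>0: "T \<eta>0 = 1" unfolding T_def by simp
  have Tlt: "T \<eta> < 1" if in_Q: "\<eta> \<in> ?Q" and ne: "\<eta> \<noteq> \<eta>0" for \<eta>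
  proof -
    obtain i where i: "\<eta> $ i \<noteq> \<eta>0 $ i" using ne by (auto simp: vec_eq_iff)
    have "\<bar>\<eta> $ i - c $ i\<bar> \<le> \<Lambda>" "\<bar>\<eta>0 $ i - c $ i\<bar> < \<Lambda>"
      using in_Q \<eta>0 by (auto simp: closed_cube_def open_cube_def)
    then have lt: "\<bar>\<eta> $ i - \<eta>0 $ i\<bar> < 2 * \<Lambda>" by linarith
    have "cos (pi / \<Lambda> * (\<eta> $ i - \<eta>0 $ i)) \<noteq> 1"
    proof
      assume "cos (pi / \<Lambda> * (\<eta> $ i - \<eta>0 $ i)) = 1"
      then obtain m :: int where "pi / \<Lambda> * (\<eta> $ i - \<eta>0 $ i) = of_int m * 2 * pi"
        using cos_one_2pi_int by blast
      then have "pi * (\<eta> $ i - \<eta>0 $ i) = pi * (2 * \<Lambda> * of_int m)" using L by (simp add: field_simps)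
      then have m: "\<eta> $ i - \<eta>0 $ i = 2 * \<Lambda> * of_int m" by (simp only: mult_cancel_left) simp
      then have "\<bar>real_of_int m\<bar> < 1" using lt L by (simp add: abs_mult)
      then have "m = 0" by linarith
      then show False using m i by simp
    qed
    then have "(\<Sum>i\<in>(UNIV::'n set). 1 + cos (pi / \<Lambda> * (\<eta> $ i - \<eta>0 $ i))) < (\<Sum>i\<in>(UNIV::'n set). 2)"
      by (intro sum_strict_mono_ex1) (auto intro!: bexI[of _ i] simp: order.strict_iff_order)
    then show ?thesis unfolding T_def by simp
  qed
  have Qi: "integrable lborel (\<lambda>\<eta>. indicator ?Q \<eta> *\<^sub>R f \<eta>)" if "continuous_on ?Q f" for f :: "real^'n \<Rightarrow> complex"
    using that by (intro borel_integrable_compact compact_closed_cube)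
  have zeroT: "(LINT \<eta>|lborel. indicator ?Q \<eta> *\<^sub>R (D \<eta> * complex_of_real (T \<eta>) ^ k
      * cis (\<eta> \<bullet> dual_node \<Lambda> j))) = 0" for k j
  proof (induction k arbitrary: j)
    case 0 then show ?case using zero by simp
  next
    case (Suc k)
    let ?I = "\<lambda>j. (LINT \<eta>|lborel. indicator ?Q \<eta> *\<^sub>R (D \<eta> * complex_of_real (T \<eta>) ^ k
        * cis (\<eta> \<bullet> dual_node \<Lambda> j)))"
    let ?f = "\<lambda>j \<eta>. indicator ?Q \<eta> *\<^sub>R (D \<eta> * complex_of_real (T \<eta>) ^ k * cis (\<eta> \<bullet> dual_node \<Lambda> j))"
    let ?a = "\<lambda>i. cis (- (pi / \<Lambda> * \<eta>0 $ i)) / 2" and ?b = "\<lambda>i. cis (pi / \<Lambda> * \<eta>0 $ i) / 2"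
    have fi: "integrable lborel (?f j)" for j
      by (intro Qi continuous_intros cont Tc)
    have e: "complex_of_real (1 + cos (pi / \<Lambda> * (\<eta> $ i - \<eta>0 $ i))) * cis (\<eta> \<bullet> dual_node \<Lambda> j) =
        cis (\<eta> \<bullet> dual_node \<Lambda> j) + ?a i * cis (\<eta> \<bullet> dual_node \<Lambda> (j + axis i 1)) + ?b i
            * cis (\<eta> \<bullet> dual_node \<Lambda> (j - axis i 1))" for \<eta> i
    proof -
      have n: "\<eta> \<bullet> dual_node \<Lambda> (axis i 1) = pi / \<Lambda> * \<eta> $ i"
        by (simp add: dual_node_def intvec_axis inner_axis)
      have cos: "complex_of_real (cos x) = (cis x + cis (- x)) / 2" for x by (simp add: complex_eq_iff)
      show ?thesis
        unfolding dual_node_add dual_node_diff inner_add_right inner_diff_right n of_real_add cos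
        by (simp add: right_diff_distrib distrib_right add_divide_distrib cis_mult algebra_simps)
    qed
    have "indicator ?Q \<eta> *\<^sub>R (D \<eta> * complex_of_real (T \<eta>) ^ Suc k * cis (\<eta> \<bullet> dual_node \<Lambda> j)) =
       (\<Sum>i\<in>UNIV. (?f j \<eta> + ?a i * ?f (j + axis i 1) \<eta> + ?b i * ?f (j - axis i 1) \<eta>) / complex_of_real (2
           * ?d))" for \<eta>
    proof -
      have "complex_of_real (T \<eta>) * cis (\<eta> \<bullet> dual_node \<Lambda> j) = (\<Sum>i\<in>UNIV. complex_of_real (1 + cos (pi / \<Lambda>
          * (\<eta> $ i - \<eta>0 $ i))) * cis (\<eta> \<bullet> dual_node \<Lambda> j)) / complex_of_real (2 * ?d)"
        by (simp add: T_def sum_distrib_right)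
      then have "indicator ?Q \<eta> *\<^sub>R (D \<eta> * complex_of_real (T \<eta>) ^ Suc k * cis (\<eta> \<bullet> dual_node \<Lambda> j)) =
          indicator ?Q \<eta> *\<^sub>R (D \<eta> * complex_of_real (T \<eta>) ^ k * ((\<Sum>i\<in>UNIV. complex_of_real (1
              + cos (pi / \<Lambda> * (\<eta> $ i - \<eta>0 $ i))) * cis (\<eta> \<bullet> dual_node \<Lambda> j)) / complex_of_real (2 * ?d)))"
        by (simp only: power_Suc2 mult.assoc)
      also have "\<dots> = (\<Sum>i\<in>UNIV. (?f j \<eta> + ?a i * ?f (j + axis i 1) \<eta> + ?b i * ?f (j
          - axis i 1) \<eta>) / complex_of_real (2 * ?d))"
        unfolding e sum_divide_distrib[symmetric] scaleR_conv_of_real times_divide_eq_right sum_distrib_left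
        by (intro arg_cong2[where f="(/)"] sum.cong refl) (simp only: distrib_left mult_ac)
      finally show ?thesis .
    qed
    then have "(LINT \<eta>|lborel. indicator ?Q \<eta> *\<^sub>R (D \<eta> * complex_of_real (T \<eta>) ^ Suc k
        * cis (\<eta> \<bullet> dual_node \<Lambda> j))) =
       (LINT \<eta>|lborel. (\<Sum>i\<in>UNIV. (?f j \<eta> + ?a i * ?f (j + axis i 1) \<eta> + ?b i * ?f (j
           - axis i 1) \<eta>) / complex_of_real (2 * ?d)))"
      by simp
    also have "\<dots> = (\<Sum>i\<in>UNIV. (?I j + ?a i * ?I (j + axis i 1) + ?b i * ?I (j
        - axis i 1)) / complex_of_real (2 * ?d))"
    proof (rule has_bochner_integral_integral_eq)
      have hb: "has_bochner_integral lborel (?f j) (?I j)" for j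
        using fi by (rule has_bochner_integral_integrable)
      show "has_bochner_integral lborel
          (\<lambda>\<eta>. \<Sum>i\<in>UNIV. (?f j \<eta> + ?a i * ?f (j + axis i 1) \<eta> + ?b i * ?f (j
              - axis i 1) \<eta>) / complex_of_real (2 * ?d))
          (\<Sum>i\<in>UNIV. (?I j + ?a i * ?I (j + axis i 1) + ?b i * ?I (j - axis i 1)) / complex_of_real (2 * ?d))"
        by (intro has_bochner_integral_sum has_bochner_integral_divide_zero has_bochner_integral_add
            has_bochner_integral_mult_right hb)
    qed
    finally show ?case unfolding Suc.IH by simp
  qed
  define g where "g \<eta> = Re (cnj (D \<eta>0) * D \<eta>)" for \<eta>
  define m where "m = (norm (D \<eta>0))\<^sup>2 / 2"
  have m: "m > 0" using D0 by (simp add: m_def)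
  have gc: "continuous_on ?Q g" unfolding g_def by (intro continuous_intros cont)
  have g0: "g \<eta>0 = 2 * m" unfolding g_def m_def by (simp add: cmod_power2) (simp add: power2_eq_square)
  have \<eta>0Q: "\<eta>0 \<in> ?Q" using \<eta>0 open_cube_subset by blast
  have "bounded (g ` ?Q)" by (rule compact_imp_bounded[OF compact_continuous_image[OF gc compact_closed_cube]])
  then obtain B where "\<forall>y\<in>g ` ?Q. norm y \<le> B" unfolding bounded_iff by blast
  then have B: "\<bar>g \<eta>\<bar> \<le> B" if "\<eta> \<in> ?Q" for \<eta> using that by auto
  have B0: "B \<ge> 0" using B[OF \<eta>0Q] by linarith
  have "open_cube c \<Lambda> \<subseteq> interior ?Q" by (rule interior_maximal[OF open_cube_subset open_open_cube])
  then have "isCont g \<eta>0" using \<eta>0 by (intro continuous_on_interior[OF gc]) auto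
  then obtain r1 where r1: "r1 > 0" "\<And>\<eta>. dist \<eta> \<eta>0 < r1 \<Longrightarrow> \<bar>g \<eta> - g \<eta>0\<bar> < m"
    using m unfolding continuous_at_eps_delta dist_real_def by blast
  obtain r2 where r2: "r2 > 0" "ball \<eta>0 r2 \<subseteq> open_cube c \<Lambda>"
    using open_contains_ball[THEN iffD1, OF open_open_cube] \<eta>0 by blast
  define r where "r = min r1 r2"
  have r: "r > 0" "\<And>\<eta>. \<eta> \<in> ball \<eta>0 r \<Longrightarrow> \<eta> \<in> ?Q \<and> m \<le> g \<eta>"
  proof -
    show "r > 0" using r1 r2 by (simp add: r_def)
    fix \<eta> assume "\<eta> \<in> ball \<eta>0 r"
    then have "dist \<eta> \<eta>0 < r1" "\<eta> \<in> ball \<eta>0 r2" by (auto simp: r_def dist_commute)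
    then show "\<eta> \<in> ?Q \<and> m \<le> g \<eta>" using r1(2)[of \<eta>] r2(2) g0 open_cube_subset[of c \<Lambda>] by auto
  qed
  obtain \<tau>2 where \<tau>2: "0 < \<tau>2" "\<tau>2 < 1" "\<And>\<eta>. \<eta> \<in> ?Q - ball \<eta>0 r \<Longrightarrow> T \<eta> \<le> \<tau>2"
  proof (cases "?Q - ball \<eta>0 r = {}")
    case True
    show ?thesis by (rule that[of "1/2"]) (simp, simp, use True in blast)
  next
    case False
    have "compact (?Q - ball \<eta>0 r)" by (intro compact_diff compact_closed_cube open_ball)
    then obtain z where z: "z \<in> ?Q - ball \<eta>0 r" "\<And>\<eta>. \<eta> \<in> ?Q - ball \<eta>0 r \<Longrightarrow> T \<eta> \<le> T z"
      using continuous_attains_sup[OF _ False Tc] by blast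
    have "T z < 1" using z(1) r(1) by (intro Tlt) auto
    then show ?thesis using that[of "max (1/2) (T z)"] z(2) by fastforce
  qed
  obtain \<tau>1 where \<tau>1: "\<tau>2 < \<tau>1" "\<tau>1 < 1" using dense \<tau>2(2) by blast
  have "isCont T \<eta>0" using Tc[of UNIV] by (simp add: continuous_on_eq_continuous_at)
  then obtain r3 where r3: "r3 > 0" "\<And>\<eta>. dist \<eta> \<eta>0 < r3 \<Longrightarrow> \<bar>T \<eta> - T \<eta>0\<bar> < 1 - \<tau>1"
    using \<tau>1(2) unfolding continuous_at_eps_delta dist_real_def by (metis diff_gt_0_iff_gt)
  define s where "s = min r r3"
  have s: "s > 0" "\<And>\<eta>. \<eta> \<in> ball \<eta>0 s \<Longrightarrow> \<eta> \<in> ball \<eta>0 r \<and> \<tau>1 \<le> T \<eta>"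
  proof -
    show "s > 0" using r r3 by (simp add: s_def)
    fix \<eta> assume "\<eta> \<in> ball \<eta>0 s"
    then have "dist \<eta> \<eta>0 < r3" "\<eta> \<in> ball \<eta>0 r" by (auto simp: s_def dist_commute)
    then show "\<eta> \<in> ball \<eta>0 r \<and> \<tau>1 \<le> T \<eta>" using r3(2)[of \<eta>] T\<eta>0 by auto
  qed
  have key: "m * \<tau>1 ^ k * measure lborel (ball \<eta>0 s) \<le> B * \<tau>2 ^ k * measure lborel ?Q" for k
  proof -
    have ci: "continuous_on ?Q (\<lambda>\<eta>. D \<eta> * complex_of_real (T \<eta>) ^ k)" by (intro continuous_intros cont Tc)
    have gTi: "integrable lborel (\<lambda>\<eta>. indicator ?Q \<eta> *\<^sub>R (g \<eta> * T \<eta> ^ k))"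
      by (intro borel_integrable_compact compact_closed_cube continuous_intros gc Tc)
    have i0: "(LINT \<eta>|lborel. indicator ?Q \<eta> *\<^sub>R (D \<eta> * complex_of_real (T \<eta>) ^ k)) = 0"
      using zeroT[of k 0] by (simp add: dual_node_def intvec_def flip: zero_vec_def)
    have "(LINT \<eta>|lborel. indicator ?Q \<eta> *\<^sub>R (g \<eta> * T \<eta> ^ k)) =
        (LINT \<eta>|lborel. Re (cnj (D \<eta>0) * (indicator ?Q \<eta> *\<^sub>R (D \<eta> * complex_of_real (T \<eta>) ^ k))))"
    proof (rule Bochner_Integration.integral_cong[OF refl])
      fix \<eta>
      have "cnj (D \<eta>0) * (indicator ?Q \<eta> *\<^sub>R (D \<eta> * complex_of_real (T \<eta>) ^ k)) =
        complex_of_real (indicator ?Q \<eta> * T \<eta> ^ k) * (cnj (D \<eta>0) * D \<eta>)"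
        by (simp add: scaleR_conv_of_real mult_ac)
      moreover have "Re (complex_of_real a * z) = a * Re z" for a z by simp
      ultimately have "Re (cnj (D \<eta>0) * (indicator ?Q \<eta> *\<^sub>R (D \<eta> * complex_of_real (T \<eta>) ^ k)))
          = indicator ?Q \<eta> * T \<eta> ^ k * g \<eta>"
        by (simp only: g_def)
      then show "indicator ?Q \<eta> *\<^sub>R (g \<eta> * T \<eta> ^ k) = Re (cnj (D \<eta>0) * (indicator ?Q \<eta> *\<^sub>R (D \<eta>
          * complex_of_real (T \<eta>) ^ k)))"
        by (simp only: real_scaleR_def mult_ac)
    qed
    also have "\<dots> = Re (LINT \<eta>|lborel. cnj (D \<eta>0) * (indicator ?Q \<eta> *\<^sub>R (D \<eta> * complex_of_real (T \<eta>) ^ k)))"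
      by (intro integral_Re integrable_mult_right Qi ci)
    also have "\<dots> = 0" unfolding integral_mult_right_zero i0 by simp
    finally have 0: "(LINT \<eta>|lborel. indicator ?Q \<eta> *\<^sub>R (g \<eta> * T \<eta> ^ k)) = 0" .
    have fin: "emeasure lborel ?Q < \<infinity>" "emeasure lborel (ball \<eta>0 s) < \<infinity>"
      by (intro emeasure_bounded_finite compact_imp_bounded compact_closed_cube bounded_ball)+
    have Qm: "?Q \<in> sets lborel" using borel_compact[OF compact_closed_cube] by simp
    have bi: "integrable lborel (\<lambda>\<eta>. indicator (ball \<eta>0 s) \<eta> * (m * \<tau>1 ^ k))"
      "integrable lborel (\<lambda>\<eta>. indicator ?Q \<eta> * (B * \<tau>2 ^ k))"
      using fin Qm by (auto intro!: integrable_mult_left integrable_real_indicator)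
    have "(LINT \<eta>|lborel. indicator (ball \<eta>0 s) \<eta> * (m * \<tau>1 ^ k) - indicator ?Q \<eta> * (B * \<tau>2 ^ k)) \<le>
        (LINT \<eta>|lborel. indicator ?Q \<eta> *\<^sub>R (g \<eta> * T \<eta> ^ k))"
    proof (rule integral_mono[OF Bochner_Integration.integrable_diff[OF bi] gTi])
      fix \<eta>
      have Bk: "0 \<le> B * \<tau>2 ^ k" using B0 \<tau>2 by simp
      show "indicator (ball \<eta>0 s) \<eta> * (m * \<tau>1 ^ k) - indicator ?Q \<eta> * (B * \<tau>2 ^ k)
          \<le> indicator ?Q \<eta> *\<^sub>R (g \<eta> * T \<eta> ^ k)"
      proof (cases "\<eta> \<in> ball \<eta>0 r")
        case True
        then have Q: "\<eta> \<in> ?Q" "m \<le> g \<eta>" using r(2) by auto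
        show ?thesis
        proof (cases "\<eta> \<in> ball \<eta>0 s")
          case True
          then have "m * \<tau>1 ^ k \<le> g \<eta> * T \<eta> ^ k"
            using s(2) Q m \<tau>1 \<tau>2 by (intro mult_mono power_mono) auto
          then show ?thesis using True Q Bk by simp
        next
          case False
          have "0 \<le> g \<eta> * T \<eta> ^ k" using Q m T0 by (intro mult_nonneg_nonneg zero_le_power) auto
          then show ?thesis using False Q Bk by simp
        qed
      next
        case False
        then have ns: "\<eta> \<notin> ball \<eta>0 s" using s(2) by blast
        show ?thesis
        proof (cases "\<eta> \<in> ?Q")
          case True
          have "\<bar>g \<eta> * T \<eta> ^ k\<bar> \<le> B * \<tau>2 ^ k"
            unfolding abs_mult using B[OF True] B0 T0[of \<eta>] \<tau>2(3)[of \<eta>] True False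
            by (intro mult_mono) (auto intro!: power_mono simp: power_abs)
          then show ?thesis using True ns by (simp add: abs_le_iff)
        qed (use ns in simp)
      qed
    qed
    then have "(LINT \<eta>|lborel. indicator (ball \<eta>0 s) \<eta> * (m * \<tau>1 ^ k)) - (LINT \<eta>|lborel. indicator ?Q \<eta>
        * (B * \<tau>2 ^ k)) \<le> 0"
      unfolding 0 using bi by (subst (asm) Bochner_Integration.integral_diff) auto
    then show ?thesis using fin Qm by (simp add: mult_ac)
  qed
  let ?b = "measure lborel (ball \<eta>0 s)" and ?q = "B * measure lborel ?Q"
  have b: "m * ?b > 0" using m s(1) by simp
  have \<tau>10: "\<tau>1 > 0" using \<tau>1 \<tau>2 by linarith
  have "(\<lambda>k. ?q * (\<tau>2 / \<tau>1) ^ k) \<longlonglongrightarrow> ?q * 0"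
    using \<tau>1 \<tau>2 \<tau>10 by (intro tendsto_intros LIMSEQ_power_zero) auto
  then have "\<forall>\<^sub>F k in sequentially. ?q * (\<tau>2 / \<tau>1) ^ k < m * ?b"
    using b by (intro order_tendstoD(2)) auto
  then obtain k where "?q * (\<tau>2 / \<tau>1) ^ k < m * ?b"
    using eventually_sequentially by auto
  then have "?q * \<tau>2 ^ k < m * ?b * \<tau>1 ^ k"
    using \<tau>10 by (simp add: power_divide divide_less_eq)
  then show False using key[of k] by (simp add: mult_ac)
qed

text \<open>The Fourier coefficients of a function supported in the cube are the values of its Fourier transform
at the dual nodes. Rapid decrease of these values makes the series a continuous function, which has
the same coefficients as \<open>G\<close> by orthogonality, hence equals \<open>G\<close>.\<close>

theorem fourier_series:
  fixes G :: "real^'n::finite \<Rightarrow> complex"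
  assumes L: "\<Lambda> > 0" and G: "G \<in> schwartz" and supp: "\<And>\<eta>. \<eta> \<notin> open_cube c \<Lambda> \<Longrightarrow> G \<eta> = 0"
    and \<eta>: "\<eta> \<in> open_cube c \<Lambda>"
  shows "((\<lambda>j. fourier G (dual_node \<Lambda> j) / complex_of_real ((2 * \<Lambda>) ^ CARD('n))
      * cis (\<eta> \<bullet> dual_node \<Lambda> j)) has_sum G \<eta>) UNIV"
proof -
  let ?K = "complex_of_real ((2 * \<Lambda>) ^ CARD('n))" and ?Q = "closed_cube c \<Lambda>"
  define a where "a j = fourier G (dual_node \<Lambda> j) / ?K" for j
  have K: "?K \<noteq> 0" using L by simp
  have as: "(\<lambda>j. norm (a j)) summable_on UNIV"
  proof -
    obtain P where P: "\<And>x J. finite J \<Longrightarrow> (\<Sum>j\<in>J. norm (fourier G ((pi / \<Lambda>) *\<^sub>R intvec j + x)) * (1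
        + norm ((pi / \<Lambda>) *\<^sub>R intvec j + x)) ^ 0) \<le> P"
      by (rule lattice_sum_rapid[OF fourier_rapid[OF G] divide_pos_pos[OF pi_gt_zero L], where N=0]) blast
    have "(\<lambda>j. norm (fourier G (dual_node \<Lambda> j))) summable_on UNIV"
      using P[of _ 0] by (intro summable_onI_bound[where B=P]) (auto simp: dual_node_def)
    then have "(\<lambda>j. norm (fourier G (dual_node \<Lambda> j)) * (1 / norm ?K)) summable_on UNIV"
      by (rule summable_on_cmult_left)
    then show ?thesis by (simp add: a_def norm_divide)
  qed
  define V where "V \<eta> = (\<Sum>\<^sub>\<infinity>j. a j * cis (\<eta> \<bullet> dual_node \<Lambda> j))" for \<eta>
  have V: "((\<lambda>j. a j * cis (\<eta> \<bullet> dual_node \<Lambda> j)) has_sum V \<eta>) UNIV" for \<eta>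
    unfolding V_def by (rule has_sum_infsum, rule abs_summable_summable) (use as in \<open>simp add: norm_mult\<close>)
  have ul: "uniform_limit UNIV (\<lambda>J \<eta>. \<Sum>j\<in>J. a j * cis (\<eta> \<bullet> dual_node \<Lambda> j)) V (finite_subsets_at_top UNIV)"
    by (rule Weierstrass_m_test_general'[OF _ V as]) (simp add: norm_mult)
  have Vc: "continuous_on UNIV V"
    by (rule uniform_limit_theorem[OF _ ul]) (auto intro!: always_eventually continuous_intros)
  have Gc: "continuous_on S G" for S using G by (rule schwartz_continuous_on)
  have Qm: "?Q \<in> sets borel" by (rule borel_compact[OF compact_closed_cube])
  have Gm [measurable]: "G \<in> borel_measurable borel" "V \<in> borel_measurable borel" "indicator ?Q
      \<in> borel_measurable borel"
    using Gc Vc Qm by (auto intro: borel_measurable_continuous_onI)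
  have "V \<eta> - G \<eta> = 0"
  proof (rule fourier_coefficients_unique[OF L _ _ \<eta>])
    show "continuous_on ?Q (\<lambda>\<eta>. V \<eta> - G \<eta>)" by (intro continuous_intros continuous_on_subset[OF Vc] Gc
        subset_UNIV)
    fix l
    have "((\<lambda>j. LINT \<eta>|lborel. a j * (indicator ?Q \<eta> *\<^sub>R cis (\<eta> \<bullet> dual_node \<Lambda> (j + l)))) has_sum
        (LINT \<eta>|lborel. indicator ?Q \<eta> *\<^sub>R (V \<eta> * cis (\<eta> \<bullet> dual_node \<Lambda> l)))) UNIV"
    proof (rule has_sum_integral[where w="indicator ?Q", OF _ _ _ _ as])
      show "((\<lambda>j. a j * (indicator ?Q \<eta> *\<^sub>R cis (\<eta> \<bullet> dual_node \<Lambda> (j + l))))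
          has_sum indicator ?Q \<eta> *\<^sub>R (V \<eta> * cis (\<eta> \<bullet> dual_node \<Lambda> l))) UNIV" for \<eta>
      proof -
        have "((\<lambda>j. a j * cis (\<eta> \<bullet> dual_node \<Lambda> j) * (complex_of_real (indicator ?Q \<eta>)
            * cis (\<eta> \<bullet> dual_node \<Lambda> l))) has_sum
            (V \<eta> * (complex_of_real (indicator ?Q \<eta>) * cis (\<eta> \<bullet> dual_node \<Lambda> l)))) UNIV"
          by (rule has_sum_cmult_left[OF V])
        then show ?thesis by (simp add: scaleR_conv_of_real dual_node_add inner_add_right
            cis_mult[symmetric] mult_ac)
      qed
      show "integrable lborel (indicator ?Q :: _ \<Rightarrow> real)"
        using Qm emeasure_bounded_finite[OF compact_imp_bounded[OF compact_closed_cube]]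
        by (intro integrable_real_indicator) auto
      show "(\<lambda>\<eta>. a j * (indicator ?Q \<eta> *\<^sub>R cis (\<eta> \<bullet> dual_node \<Lambda> (j + l)))) \<in> borel_measurable lborel" for j
        by measurable
      show "(\<lambda>\<eta>. indicator ?Q \<eta> *\<^sub>R (V \<eta> * cis (\<eta> \<bullet> dual_node \<Lambda> l))) \<in> borel_measurable lborel"
        by measurable
    qed (auto simp: norm_mult indicator_def)
    moreover have "(LINT \<eta>|lborel. a j * (indicator ?Q \<eta> *\<^sub>R cis (\<eta> \<bullet> dual_node \<Lambda> (j + l)))) = (if j =
        - l then a (- l) * ?K else 0)" for j
      unfolding integral_mult_right_zero integral_cube_cis[OF L] by (auto simp: add_eq_0_iff2)
    ultimately have "((\<lambda>j. if j = - l then a (- l) * ?K else 0) has_sum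
        (LINT \<eta>|lborel. indicator ?Q \<eta> *\<^sub>R (V \<eta> * cis (\<eta> \<bullet> dual_node \<Lambda> l)))) UNIV"
      by simp
    moreover have "((\<lambda>j. if j = - l then a (- l) * ?K else 0) has_sum a (- l) * ?K) UNIV"
      by (rule has_sum_finite_neutralI[where B="{- l}"]) auto
    ultimately have 1: "(LINT \<eta>|lborel. indicator ?Q \<eta> *\<^sub>R (V \<eta> * cis (\<eta> \<bullet> dual_node \<Lambda> l))) = a (- l) * ?K"
      using has_sum_unique by blast
    have 2: "(LINT \<eta>|lborel. indicator ?Q \<eta> *\<^sub>R (G \<eta> * cis (\<eta> \<bullet> dual_node \<Lambda> l))) = a (- l) * ?K"
    proof -
      have "indicator ?Q \<eta> *\<^sub>R (G \<eta> * cis (\<eta> \<bullet> dual_node \<Lambda> l)) = G \<eta> * cis (- (\<eta> \<bullet> dual_node \<Lambda> (- l)))" for \<eta>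
        using supp[of \<eta>] open_cube_subset[of c \<Lambda>] dual_node_diff[of \<Lambda> 0 l]
        by (cases "\<eta> \<in> ?Q") (auto simp: dual_node_def intvec_def simp flip: zero_vec_def)
      then show ?thesis using K by (simp add: a_def fourier_def)
    qed
    show "(LINT \<eta>|lborel. indicator ?Q \<eta> *\<^sub>R ((V \<eta> - G \<eta>) * cis (\<eta> \<bullet> dual_node \<Lambda> l))) = 0"
    proof -
      have "integrable lborel (\<lambda>\<eta>. indicator ?Q \<eta> *\<^sub>R (V \<eta> * cis (\<eta> \<bullet> dual_node \<Lambda> l)))"
        "integrable lborel (\<lambda>\<eta>. indicator ?Q \<eta> *\<^sub>R (G \<eta> * cis (\<eta> \<bullet> dual_node \<Lambda> l)))"
        by (intro borel_integrable_compact compact_closed_cube continuous_intros continuous_on_subset[OF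
            Vc] Gc subset_UNIV)+
      then show ?thesis using 1 2 by (simp add: left_diff_distrib scaleR_diff_right)
    qed
  qed
  then show ?thesis using V[of \<eta>] by (simp add: a_def)
qed

section \<open>Tempered distributions\<close>

lemma tempered_add: "f \<in> tempered \<Longrightarrow> g \<in> schwartz \<Longrightarrow> h \<in> schwartz \<Longrightarrow> f (\<lambda>t. g t + h t) = f g + f h"
  and tempered_cmult: "f \<in> tempered \<Longrightarrow> g \<in> schwartz \<Longrightarrow> f (\<lambda>t. c * g t) = c * f g"
  by (auto simp: tempered_def)

lemma tempered_sum:
  assumes f: "f \<in> tempered" and h: "\<And>j. j \<in> J \<Longrightarrow> h j \<in> schwartz"
  shows "f (\<lambda>t. \<Sum>j\<in>J. a j * h j t) = (\<Sum>j\<in>J. a j * f (h j))"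
proof -
  have z: "f (\<lambda>t. 0) = 0" using tempered_cmult[OF f schwartz_zero, of 0] by simp
  show ?thesis using h
  proof (induction J rule: infinite_finite_induct)
    case (insert x J)
    have "f (\<lambda>t. a x * h x t + (\<Sum>j\<in>J. a j * h j t)) = f (\<lambda>t. a x * h x t) + f (\<lambda>t. \<Sum>j\<in>J. a j * h j t)"
      by (rule tempered_add[OF f]) (auto intro!: schwartz_sum schwartz_cmult insert.prems)
    then show ?case using insert by (simp add: tempered_cmult[OF f])
  qed (auto simp: z)
qed

lemma iter_partial_add:
  "f \<in> schwartz \<Longrightarrow> g \<in> schwartz \<Longrightarrow>
    iter_partial is (\<lambda>t. f t + g t) = (\<lambda>t. iter_partial is f t + iter_partial is g t)"
proof (induction "is")
  case (Cons i "is")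
  then show ?case
    by (auto simp: iter_partial_Cons partial_deriv_add schwartz_differentiable schwartz_iter_partial)
qed simp

lemma iter_partial_cmult:
  "f \<in> schwartz \<Longrightarrow> iter_partial is (\<lambda>t. c * f t) = (\<lambda>t. c * iter_partial is f t)"
proof (induction "is")
  case (Cons i "is")
  then show ?case
    by (auto simp: iter_partial_Cons partial_deriv_mult schwartz_differentiable schwartz_iter_partial)
qed simp

lemma iter_partial_zero: "iter_partial is (\<lambda>_. 0) = (\<lambda>_. 0)"
  by (induction "is") (auto simp: iter_partial_Cons)

lemma iter_partial_sum:
  assumes "\<And>j. j \<in> J \<Longrightarrow> h j \<in> schwartz"
  shows "iter_partial is (\<lambda>t. \<Sum>j\<in>J. a j * h j t) = (\<lambda>t. \<Sum>j\<in>J. a j * iter_partial is (h j) t)"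
  using assms
  by (induction J rule: infinite_finite_induct)
    (auto simp: iter_partial_zero iter_partial_add iter_partial_cmult schwartz_cmult schwartz_sum)

lemma schwartz_seminorm_le:
  assumes "\<And>is x. length is \<le> N \<Longrightarrow> (1 + norm x) ^ N * norm (iter_partial is f x) \<le> K"
  shows "schwartz_seminorm N f \<le> K"
  unfolding schwartz_seminorm_def
proof (rule cSUP_least)
  have "([], 0) \<in> {is. length is \<le> N} \<times> UNIV" by simp
  then show "{is. length is \<le> N} \<times> UNIV \<noteq> {}" by blast
qed (use assms in auto)

lemma finite_short_lists: "finite {is :: 'n::finite list. length is \<le> N}"
  using finite_lists_length_le[of "UNIV :: 'n set" N] by simp

lemma schwartz_seminorm_ge:
  fixes f :: "real^'n::finite \<Rightarrow> complex"
  assumes f: "f \<in> schwartz" and l: "length is \<le> N"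
  shows "(1 + norm x) ^ N * norm (iter_partial is f x) \<le> schwartz_seminorm N f"
proof -
  have "\<forall>is. \<exists>M. \<forall>x. (1 + norm x) ^ N * norm (iter_partial is f x) \<le> M"
    using schwartz_rapid[OF schwartz_iter_partial[OF f]] unfolding rapid_def by blast
  from choice[OF this] obtain M where M: "\<And>is x. (1 + norm x) ^ N * norm (iter_partial is f x) \<le> M is" by blast
  have "(1 + norm x) ^ N * norm (iter_partial is f x) \<le> (\<Sum>is\<in>{is. length is \<le> N}. \<bar>M is\<bar>)"
    if "length is \<le> N" for "is" x
  proof -
    have "\<bar>M is\<bar> \<le> (\<Sum>is\<in>{is. length is \<le> N}. \<bar>M is\<bar>)"
      using that by (intro member_le_sum finite_short_lists) auto
    then show ?thesis using M[of x "is"] by linarith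
  qed
  then have "bdd_above ((\<lambda>(is, x). (1 + norm x) ^ N * norm (iter_partial is f x)) ` ({is. length is
      \<le> N} \<times> UNIV))"
    by (intro bdd_aboveI2[where M="\<Sum>is\<in>{is. length is \<le> N}. \<bar>M is\<bar>"]) auto
  then have "(case (is, x) of (is, x) \<Rightarrow> (1 + norm x) ^ N * norm (iter_partial is f x)) \<le> schwartz_seminorm N f"
    unfolding schwartz_seminorm_def using l by (intro cSUP_upper) auto
  then show ?thesis by simp
qed

text \<open>A tempered distribution is controlled by one seminorm, which involves finitely many derivatives and
one power of the weight. A series that converges pointwise with all derivatives, and whose terms have
polynomially growing seminorms against rapidly decreasing coefficients, converges in that seminorm.\<close>

lemma tempered_has_sum:
  fixes h :: "'i \<Rightarrow> real^'n::finite \<Rightarrow> complex"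
  assumes f: "f \<in> tempered" and g: "g \<in> schwartz" and h: "\<And>j. h j \<in> schwartz"
    and sum: "\<And>is t. ((\<lambda>j. a j * iter_partial is (h j) t) has_sum iter_partial is g t) UNIV"
    and bound: "\<And>is N. \<exists>C. \<forall>j t. (1 + norm t) ^ N * norm (iter_partial is (h j) t) \<le> C * w j ^ N"
    and w: "\<And>N. (\<lambda>j. norm (a j) * w j ^ N) summable_on UNIV"
  shows "((\<lambda>j. a j * f (h j)) has_sum f g) UNIV"
proof -
  obtain C N where C: "\<And>g. g \<in> schwartz \<Longrightarrow> norm (f g) \<le> C * schwartz_seminorm N g"
    using f unfolding tempered_def by blast
  obtain K where K: "\<And>is j t. (1 + norm t) ^ N * norm (iter_partial is (h j) t) \<le> K is * w j ^ N"
    using bound[where N=N] by metis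
  define L where "L = (\<Sum>is\<in>{is. length is \<le> N}. \<bar>K is\<bar>)"
  have L: "(1 + norm t) ^ N * norm (iter_partial is (h j) t) \<le> L * \<bar>w j ^ N\<bar>" if "length is \<le> N" for "is" j t
  proof -
    have "(1 + norm t) ^ N * norm (iter_partial is (h j) t) \<le> \<bar>K is\<bar> * \<bar>w j ^ N\<bar>"
      using K[of t "is" j] abs_ge_self[of "K is * w j ^ N"] unfolding abs_mult by linarith
    also have "\<bar>K is\<bar> \<le> L" unfolding L_def
      using that by (intro member_le_sum finite_short_lists) auto
    finally show ?thesis by (simp add: mult_right_mono)
  qed
  have "(\<lambda>j. \<bar>norm (a j) * w j ^ N\<bar>) summable_on UNIV"
    using w[of N] by (subst (asm) summable_on_iff_abs_summable_on_real) simp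
  then have bs: "(\<lambda>j. norm (a j) * \<bar>w j ^ N\<bar>) summable_on UNIV" by (simp add: abs_mult)
  then obtain B where B: "((\<lambda>j. norm (a j) * \<bar>w j ^ N\<bar>) has_sum B) UNIV" by (auto simp: summable_on_def)
  let ?b = "\<lambda>j. norm (a j) * \<bar>w j ^ N\<bar>"
  have main: "norm (f g - (\<Sum>j\<in>J. a j * f (h j))) \<le> \<bar>C\<bar> * (L * (B - sum ?b J))" if J: "finite J" for J
  proof -
    let ?s = "\<lambda>t. \<Sum>j\<in>J. a j * h j t"
    have s: "?s \<in> schwartz" by (intro schwartz_sum schwartz_cmult h)
    have d: "(\<lambda>t. g t + (- 1) * ?s t) \<in> schwartz" by (intro schwartz_add g schwartz_cmult s)
    have "f (\<lambda>t. g t + (- 1) * ?s t) = f g - (\<Sum>j\<in>J. a j * f (h j))"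
      using tempered_add[OF f g schwartz_cmult[OF s, of "-1"]] tempered_cmult[OF f s, of "-1"]
        tempered_sum[OF f, of J h a] h by simp
    moreover have "schwartz_seminorm N (\<lambda>t. g t + (- 1) * ?s t) \<le> L * (B - sum ?b J)"
    proof (rule schwartz_seminorm_le)
      fix "is" :: "'n list" and t :: "real^'n" assume l: "length is \<le> N"
      have "iter_partial is (\<lambda>t. g t + (- 1) * ?s t) t = iter_partial is g t - (\<Sum>j\<in>J. a j
          * iter_partial is (h j) t)"
        using iter_partial_add[OF g schwartz_cmult[OF s, of "-1"], of "is"] iter_partial_cmult[OF s, of
            "is" "-1"]
          iter_partial_sum[of J h "is" a] h by simp
      then have "(1 + norm t) ^ N * norm (iter_partial is (\<lambda>t. g t + (- 1) * ?s t) t) =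
          norm (complex_of_real ((1 + norm t) ^ N) * iter_partial is g t - (\<Sum>j\<in>J. complex_of_real ((1
              + norm t) ^ N) * (a j * iter_partial is (h j) t)))"
        by (simp add: norm_mult norm_power flip: sum_distrib_left right_diff_distrib of_real_add of_real_power)
      also have "\<dots> \<le> L * B - (\<Sum>j\<in>J. L * ?b j)"
      proof (rule has_sum_tail_bound[OF has_sum_cmult_right[OF sum] has_sum_cmult_right[OF B] _ J])
        fix j
        have "norm (a j) * ((1 + norm t) ^ N * norm (iter_partial is (h j) t)) \<le> norm (a j) * (L * \<bar>w j ^ N\<bar>)"
          by (intro mult_left_mono L l) auto
        then show "norm (complex_of_real ((1 + norm t) ^ N) * (a j * iter_partial is (h j) t)) \<le> L * ?b j"
          by (simp add: norm_mult norm_power mult_ac flip: of_real_add of_real_power)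
      qed
      finally show "(1 + norm t) ^ N * norm (iter_partial is (\<lambda>t. g t + (- 1) * ?s t) t) \<le> L * (B - sum ?b J)"
        by (simp add: right_diff_distrib sum_distrib_left)
    qed
    ultimately show ?thesis
    proof -
      have "norm (f (\<lambda>t. g t + (- 1) * ?s t)) \<le> C * schwartz_seminorm N (\<lambda>t. g t + (- 1) * ?s t)"
          by (rule C[OF d])
      also have "\<dots> \<le> \<bar>C\<bar> * \<bar>schwartz_seminorm N (\<lambda>t. g t + (- 1) * ?s t)\<bar>"
        unfolding abs_mult[symmetric] by (rule abs_ge_self)
      also have "\<bar>schwartz_seminorm N (\<lambda>t. g t + (- 1) * ?s t)\<bar> = schwartz_seminorm N (\<lambda>t. g t + (- 1) * ?s t)"
      proof -
        have "0 \<le> (1 + norm (0 :: real^'n)) ^ N * norm (iter_partial [] (\<lambda>t. g t + (- 1) * ?s t) 0)" by simp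
        also have "\<dots> \<le> schwartz_seminorm N (\<lambda>t. g t + (- 1) * ?s t)"
          by (rule schwartz_seminorm_ge[OF d]) simp
        finally show ?thesis by simp
      qed
      also have "\<bar>C\<bar> * \<dots> \<le> \<bar>C\<bar> * (L * (B - sum ?b J))"
        by (intro mult_left_mono \<open>schwartz_seminorm N (\<lambda>t. g t + (- 1) * ?s t) \<le> L * (B - sum ?b J)\<close>) auto
      finally show ?thesis
        using \<open>f (\<lambda>t. g t + (- 1) * ?s t) = f g - (\<Sum>j\<in>J. a j * f (h j))\<close> by simp
    qed
  qed
  have "((\<lambda>J. (\<Sum>j\<in>J. a j * f (h j)) - f g) \<longlongrightarrow> 0) (finite_subsets_at_top UNIV)"
  proof (rule Lim_null_comparison)
    have "((\<lambda>J. \<bar>C\<bar> * (L * (B - sum ?b J))) \<longlongrightarrow> \<bar>C\<bar> * (L * (B - B))) (finite_subsets_at_top UNIV)"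
      using B unfolding has_sum_def by (intro tendsto_intros)
    then show "((\<lambda>J. \<bar>C\<bar> * (L * (B - sum ?b J))) \<longlongrightarrow> 0) (finite_subsets_at_top UNIV)" by simp
    show "\<forall>\<^sub>F J in finite_subsets_at_top UNIV. norm ((\<Sum>j\<in>J. a j * f (h j)) - f g) \<le> \<bar>C\<bar> * (L * (B - sum ?b J))"
      by (rule eventually_finite_subsets_at_top_weakI) (use main in \<open>simp add: norm_minus_commute\<close>)
  qed
  then show ?thesis unfolding has_sum_def by (simp add: LIM_zero_iff)
qed

section \<open>Sampling of band-limited distributions\<close>

text \<open>The value at \<open>x\<close> of the smooth function obtained by convolving \<open>f\<close> with the test function whose
Fourier transform is \<open>U\<close>, up to a factor \<open>(2\<pi>)\<^sup>n\<close>. The modulation moves the sample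
point into the test function, so this is a single pairing.\<close>

definition band_value :: "((real^'n::finite \<Rightarrow> complex) \<Rightarrow> complex) \<Rightarrow> (real^'n \<Rightarrow> complex) \<Rightarrow> real^'n
    \<Rightarrow> complex" where
  "band_value f U x = f (fourier (\<lambda>\<eta>. U \<eta> * cis (\<eta> \<bullet> x)))"

text \<open>The multiplier that a string of derivatives of a Fourier transform puts on the original function.\<close>

primrec moment :: "'n list \<Rightarrow> real^'n::finite \<Rightarrow> complex" where
  "moment [] t = 1"
| "moment (i # is) t = moment is t * (- \<i> * complex_of_real (t $ i))"

lemma moment_multiplier: "moment is \<in> multiplier"
proof (induction "is")
  case Nil
  have "moment [] = (\<lambda>_::real^'n. 1)" by auto
  then show ?case using const_multiplier by auto
next
  case (Cons i "is")
  have "moment (i # is) = (\<lambda>t. moment is t * (- \<i> * complex_of_real (t $ i)))" by auto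
  then show ?case by (simp only:) (intro multiplier_mult const_multiplier coordinate_multiplier Cons)
qed

lemma iter_partial_fourier:
  "f \<in> schwartz \<Longrightarrow> iter_partial is (fourier f) = fourier (\<lambda>t. f t * moment is t)"
proof (induction "is")
  case (Cons i "is")
  have "(\<lambda>t. f t * moment is t) \<in> schwartz" by (intro schwartz_mult_multiplier Cons.prems moment_multiplier)
  then show ?case using Cons by (simp add: iter_partial_Cons partial_deriv_fourier mult.assoc)
qed simp

lemma fourier_shift: "fourier (\<lambda>\<eta>. U \<eta> * cis (\<eta> \<bullet> x)) t = fourier U (t - x)"
  unfolding fourier_def
  by (intro Bochner_Integration.integral_cong refl) (simp add: inner_diff_right mult.assoc cis_mult)

lemma schwartz_modulate: "U \<in> schwartz \<Longrightarrow> (\<lambda>\<eta>. U \<eta> * cis (\<eta> \<bullet> x)) \<in> schwartz"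
  by (intro schwartz_mult_multiplier cis_multiplier)

lemma weight_submult: "1 + norm (x + y) \<le> (1 + norm x) * (1 + norm y)"
proof -
  have "norm (x + y) \<le> norm x + norm y" by (rule norm_triangle_ineq)
  moreover have "0 \<le> norm x * norm y" by simp
  moreover have "(1 + norm x) * (1 + norm y) = 1 + norm x + norm y + norm x * norm y"
      by (simp add: algebra_simps)
  ultimately show ?thesis by linarith
qed

text \<open>A multiplier \<open>G\<close> acts on band-limited samples as a discrete convolution. Expand
\<open>G(\<eta>) e\<^sup>i\<^sup>x\<^sup>\<eta>\<close> in a Fourier series on the cube; its coefficients are values of the Fourier
transform of \<open>G\<close> at translated nodes. After multiplication by \<open>U\<close>, which vanishes off the cube, the
identity holds everywhere, and the distribution may be applied term by term.\<close>

theorem sampling: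
  fixes f :: "(real^'n::finite \<Rightarrow> complex) \<Rightarrow> complex"
  assumes f: "f \<in> tempered" and L: "\<Lambda> > 0" and G: "G \<in> schwartz" and U: "U \<in> schwartz"
    and Gs: "\<And>\<eta>. \<eta> \<notin> open_cube c \<Lambda> \<Longrightarrow> G \<eta> = 0" and Us: "\<And>\<eta>. \<eta> \<notin> open_cube c \<Lambda> \<Longrightarrow> U \<eta> = 0"
  shows "((\<lambda>j. fourier G (dual_node \<Lambda> j - x) / complex_of_real ((2 * \<Lambda>) ^ CARD('n))
      * band_value f U (dual_node \<Lambda> j))
    has_sum band_value f (\<lambda>\<eta>. G \<eta> * U \<eta>) x) UNIV"
proof -
  let ?K = "complex_of_real ((2 * \<Lambda>) ^ CARD('n))" and ?x = "dual_node \<Lambda> :: int^'n \<Rightarrow> real^'n"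
  let ?a = "\<lambda>j. fourier G (?x j - x) / ?K" and ?h = "\<lambda>j. fourier (\<lambda>\<eta>. U \<eta> * cis (\<eta> \<bullet> ?x j))"
  let ?g = "fourier (\<lambda>\<eta>. (G \<eta> * U \<eta>) * cis (\<eta> \<bullet> x))"
  have GU: "(\<lambda>\<eta>. G \<eta> * U \<eta>) \<in> schwartz" by (intro schwartz_mult G U)
  obtain P where P: "\<And>N x J. finite J \<Longrightarrow> (\<Sum>j\<in>J. norm (fourier G ((pi / \<Lambda>) *\<^sub>R intvec j + x)) * (1
      + norm ((pi / \<Lambda>) *\<^sub>R intvec j + x)) ^ N) \<le> P N"
  proof -
    have "\<exists>P. \<forall>x J. finite J \<longrightarrow> (\<Sum>j\<in>J. norm (fourier G ((pi / \<Lambda>) *\<^sub>R intvec j + x)) * (1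
        + norm ((pi / \<Lambda>) *\<^sub>R intvec j + x)) ^ N) \<le> P" for N
      by (rule lattice_sum_rapid[OF fourier_rapid[OF G] divide_pos_pos[OF pi_gt_zero L], where N=N]) blast
    then have "\<forall>N. \<exists>P. \<forall>x J. finite J \<longrightarrow> (\<Sum>j\<in>J. norm (fourier G ((pi / \<Lambda>) *\<^sub>R intvec j + x)) * (1
        + norm ((pi / \<Lambda>) *\<^sub>R intvec j + x)) ^ N) \<le> P" ..
    from choice[OF this] show ?thesis using that by blast
  qed
  have "((\<lambda>j. ?a j * f (?h j)) has_sum f ?g) UNIV"
  proof (rule tempered_has_sum[OF f, where w="\<lambda>j. 1 + norm (?x j)"])
    show "?g \<in> schwartz" by (intro fourier_schwartz schwartz_modulate GU)
    show "?h j \<in> schwartz" for j by (intro fourier_schwartz schwartz_modulate U)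
    show "((\<lambda>j. ?a j * iter_partial is (?h j) t) has_sum iter_partial is ?g t) UNIV" for "is" t
    proof -
      define W where "W \<eta> = U \<eta> * moment is \<eta> * cis (- (\<eta> \<bullet> t))" for \<eta>
      have Ws: "(\<lambda>\<eta>. U \<eta> * moment is \<eta>) \<in> schwartz" by (intro schwartz_mult_multiplier U moment_multiplier)
      have Wi: "integrable lborel W" unfolding W_def by (intro integrable_cis_neg schwartz_integrable Ws)
      have [measurable]: "W \<in> borel_measurable borel" "G \<in> borel_measurable borel"
        using Wi schwartz_borel[OF G] by auto
      have ga: "fourier (\<lambda>\<eta>. G \<eta> * cis (\<eta> \<bullet> x)) (?x j) = fourier G (?x j - x)" for j by (rule fourier_shift)
      have "((\<lambda>j. LINT \<eta>|lborel. ?a j * cis (\<eta> \<bullet> ?x j) * W \<eta>) has_sum (LINT \<eta>|lborel. G \<eta> * cis (\<eta> \<bullet> x)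
          * W \<eta>)) UNIV"
      proof (rule has_sum_integral[where w="\<lambda>\<eta>. norm (W \<eta>)" and b="\<lambda>j. norm (?a j)"])
        show "((\<lambda>j. ?a j * cis (\<eta> \<bullet> ?x j) * W \<eta>) has_sum G \<eta> * cis (\<eta> \<bullet> x) * W \<eta>) UNIV" for \<eta>
        proof (cases "\<eta> \<in> open_cube c \<Lambda>")
          case True
          have "((\<lambda>j. ?a j * cis (\<eta> \<bullet> ?x j)) has_sum G \<eta> * cis (\<eta> \<bullet> x)) UNIV"
            unfolding ga[symmetric]
            by (rule fourier_series[OF L schwartz_modulate[OF G] _ True]) (simp add: Gs)
          then show ?thesis by (rule has_sum_cmult_left)
        qed (simp add: W_def Us)
        have "(\<lambda>j. norm (fourier G (?x j - x))) summable_on UNIV"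
          using P[of _ "- x" 0] by (intro summable_onI_bound[where B="P 0"]) (auto simp: dual_node_def)
        then have "(\<lambda>j. norm (fourier G (?x j - x)) * (1 / norm ?K)) summable_on UNIV"
          by (rule summable_on_cmult_left)
        then show "(\<lambda>j. norm (?a j)) summable_on UNIV" by (simp add: norm_divide)
        show "norm (?a j * cis (\<eta> \<bullet> ?x j) * W \<eta>) \<le> norm (?a j) * norm (W \<eta>)" for j \<eta>
          by (simp only: norm_mult norm_cis mult_1_right order_refl)
      qed (use Wi in \<open>auto simp: norm_mult\<close>)
      moreover have "(LINT \<eta>|lborel. ?a j * cis (\<eta> \<bullet> ?x j) * W \<eta>) = ?a j * iter_partial is (?h j) t" for j
      proof -
        have "iter_partial is (?h j) t = (LINT \<eta>|lborel. cis (\<eta> \<bullet> ?x j) * W \<eta>)"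
          unfolding iter_partial_fourier[OF schwartz_modulate[OF U]] by (simp add: fourier_def W_def mult_ac)
        then show ?thesis by (simp only: mult.assoc integral_mult_right_zero)
      qed
      moreover have "(LINT \<eta>|lborel. G \<eta> * cis (\<eta> \<bullet> x) * W \<eta>) = iter_partial is ?g t"
        unfolding iter_partial_fourier[OF schwartz_modulate[OF GU]] by (simp add: fourier_def W_def mult_ac)
      ultimately show ?thesis by (simp only:)
    qed
    show "\<exists>C. \<forall>j t. (1 + norm t) ^ N * norm (iter_partial is (?h j) t) \<le> C * (1 + norm (?x j)) ^ N" for "is" N
    proof -
      have Us: "(\<lambda>\<eta>. U \<eta> * moment is \<eta>) \<in> schwartz" by (intro schwartz_mult_multiplier U moment_multiplier)
      obtain C where C: "\<And>t. (1 + norm t) ^ N * norm (fourier (\<lambda>\<eta>. U \<eta> * moment is \<eta>) t) \<le> C"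
        using fourier_rapid[OF Us] unfolding rapid_def by blast
      have "(1 + norm t) ^ N * norm (iter_partial is (?h j) t) \<le> C * (1 + norm (?x j)) ^ N" for j t
      proof -
        have "(\<lambda>\<eta>. U \<eta> * cis (\<eta> \<bullet> ?x j) * moment is \<eta>) = (\<lambda>\<eta>. U \<eta> * moment is \<eta> * cis (\<eta> \<bullet> ?x j))"
          by (simp add: mult_ac)
        then have e: "iter_partial is (?h j) t = fourier (\<lambda>\<eta>. U \<eta> * moment is \<eta>) (t - ?x j)"
          unfolding iter_partial_fourier[OF schwartz_modulate[OF U]] by (simp only: fourier_shift)
        have "(1 + norm t) ^ N \<le> ((1 + norm (t - ?x j)) * (1 + norm (?x j))) ^ N"
          using weight_submult[of "t - ?x j" "?x j"] by (intro power_mono) auto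
        then have "(1 + norm t) ^ N * norm (iter_partial is (?h j) t) \<le>
            ((1 + norm (t - ?x j)) * (1 + norm (?x j))) ^ N * norm (fourier (\<lambda>\<eta>. U \<eta> * moment is \<eta>) (t - ?x j))"
          unfolding e by (rule mult_right_mono) simp
        also have "\<dots> = ((1 + norm (t - ?x j)) ^ N * norm (fourier (\<lambda>\<eta>. U \<eta> * moment is \<eta>) (t - ?x j)))
            * (1 + norm (?x j)) ^ N"
          by (simp add: power_mult_distrib)
        also have "\<dots> \<le> C * (1 + norm (?x j)) ^ N" by (intro mult_right_mono C) auto
        finally show ?thesis .
      qed
      then show ?thesis by blast
    qed
    show "(\<lambda>j. norm (?a j) * (1 + norm (?x j)) ^ N) summable_on UNIV" for N
    proof (rule summable_onI_bound[where B="(1 / norm ?K) * (1 + norm x) ^ N * P N"])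
      fix J :: "(int^'n) set" assume J: "finite J"
      have "(\<Sum>j\<in>J. norm (?a j) * (1 + norm (?x j)) ^ N) \<le>
          (\<Sum>j\<in>J. (1 / norm ?K) * (1 + norm x) ^ N * (norm (fourier G (?x j - x)) * (1 + norm (?x j - x)) ^ N))"
      proof (rule sum_mono)
        fix j
        have "(1 + norm (?x j)) ^ N \<le> ((1 + norm (?x j - x)) * (1 + norm x)) ^ N"
          using weight_submult[of "?x j - x" x] by (intro power_mono) auto
        then have "norm (?a j) * (1 + norm (?x j)) ^ N \<le> norm (?a j) * ((1 + norm (?x j - x)) * (1
            + norm x)) ^ N"
          by (rule mult_left_mono) simp
        also have "\<dots> = (1 / norm ?K) * (1 + norm x) ^ N * (norm (fourier G (?x j - x)) * (1 + norm (?x j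
            - x)) ^ N)"
          by (simp add: norm_divide power_mult_distrib)
        finally show "norm (?a j) * (1 + norm (?x j)) ^ N \<le> (1 / norm ?K) * (1 + norm x) ^ N
            * (norm (fourier G (?x j - x)) * (1 + norm (?x j - x)) ^ N)" .
      qed
      also have "\<dots> \<le> (1 / norm ?K) * (1 + norm x) ^ N * P N"
        unfolding sum_distrib_left[symmetric] using P[OF J, of "- x" N]
        by (intro mult_left_mono) (auto simp: dual_node_def)
      finally show "(\<Sum>j\<in>J. norm (?a j) * (1 + norm (?x j)) ^ N) \<le> (1 / norm ?K) * (1 + norm x) ^ N * P N" .
    qed auto
  qed
  then show ?thesis by (simp add: band_value_def)
qed

section \<open>Sequence spaces\<close>

text \<open>Jensen's inequality for weights of total mass at most \<open>A\<close>. Terms with a zero weight or value are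
removed first, since convexity of the power is taken on the open half-line.\<close>

lemma weighted_power_mean:
  fixes k v :: "'i \<Rightarrow> real"
  assumes J: "finite J" and k: "\<And>j. j \<in> J \<Longrightarrow> k j \<ge> 0" and v: "\<And>j. j \<in> J \<Longrightarrow> v j \<ge> 0"
    and A: "(\<Sum>j\<in>J. k j) \<le> A" and P: "P \<ge> 1"
  shows "(\<Sum>j\<in>J. k j * v j) powr P \<le> A powr (P - 1) * (\<Sum>j\<in>J. k j * v j powr P)"
proof -
  define S where "S = {j \<in> J. k j > 0 \<and> v j > 0}"
  define W where "W = (\<Sum>j\<in>S. k j)"
  have S: "finite S" "S \<subseteq> J" using J by (auto simp: S_def)
  have z: "k j * v j = 0" "k j * v j powr P = 0" if "j \<in> J - S" for j
    using that k[of j] v[of j] by (auto simp: S_def)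
  have e1: "(\<Sum>j\<in>J. k j * v j) = (\<Sum>j\<in>S. k j * v j)"
    using z(1) by (intro sum.mono_neutral_right J S) auto
  have e2: "(\<Sum>j\<in>J. k j * v j powr P) = (\<Sum>j\<in>S. k j * v j powr P)"
    using z(2) by (intro sum.mono_neutral_right J S) auto
  show ?thesis
  proof (cases "S = {}")
    case True then show ?thesis unfolding e1 e2 by simp
  next
    case False
    have W: "W > 0" unfolding W_def using False S(1) by (intro sum_pos) (auto simp: S_def)
    have WA: "W \<le> A" unfolding W_def using A k S J by (intro order_trans[OF sum_mono2[of J S k] A]) auto
    have "(\<Sum>j\<in>S. (k j / W) *\<^sub>R v j) powr P \<le> (\<Sum>j\<in>S. k j / W * v j powr P)"
      using W by (intro convex_on_sum[OF S(1) False powr_convex[OF P]])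
        (auto simp: S_def sum_divide_distrib[symmetric] W_def)
    moreover have "(\<Sum>j\<in>S. (k j / W) *\<^sub>R v j) = (\<Sum>j\<in>S. k j * v j) / W" by (simp add: sum_divide_distrib)
    moreover have "(\<Sum>j\<in>S. k j / W * v j powr P) = (\<Sum>j\<in>S. k j * v j powr P) / W"
        by (simp add: sum_divide_distrib)
    ultimately have "((\<Sum>j\<in>S. k j * v j) / W) powr P \<le> (\<Sum>j\<in>S. k j * v j powr P) / W" by simp
    moreover have "(\<Sum>j\<in>S. k j * v j) \<ge> 0" by (intro sum_nonneg) (auto simp: S_def)
    ultimately have "(\<Sum>j\<in>S. k j * v j) powr P / W powr P \<le> (\<Sum>j\<in>S. k j * v j powr P) / W"
      using W by (simp add: powr_divide)
    then have "(\<Sum>j\<in>S. k j * v j) powr P \<le> (\<Sum>j\<in>S. k j * v j powr P) / W * W powr P"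
      using W by (subst (asm) pos_divide_le_eq) auto
    also have "\<dots> = W powr (P - 1) * (\<Sum>j\<in>S. k j * v j powr P)" using W by (simp add: powr_diff)
    also have "\<dots> \<le> A powr (P - 1) * (\<Sum>j\<in>S. k j * v j powr P)"
      using W WA P by (intro mult_right_mono powr_mono2 sum_nonneg) (auto simp: S_def)
    finally show ?thesis unfolding e1 e2 .
  qed
qed

lemma sum_power_le:
  fixes v :: "'i \<Rightarrow> real"
  assumes J: "finite J" and v: "\<And>j. j \<in> J \<Longrightarrow> v j \<ge> 0" and P: "P \<ge> 1"
  shows "(\<Sum>j\<in>J. v j) powr P \<le> real (card J) powr (P - 1) * (\<Sum>j\<in>J. v j powr P)"
  using weighted_power_mean[OF J _ v _ P, where k="\<lambda>_. 1" and A="real (card J)"] by simp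

lemma powr_add_le:
  fixes x y :: real
  assumes "x \<ge> 0" "y \<ge> 0" "P \<ge> 1"
  shows "(x + y) powr P \<le> 2 powr P * (x powr P + y powr P)"
proof -
  have "(x + y) powr P \<le> (2 * max x y) powr P" using assms by (intro powr_mono2) auto
  also have "\<dots> = 2 powr P * max x y powr P" using assms by (simp add: powr_mult)
  also have "\<dots> \<le> 2 powr P * (x powr P + y powr P)" using assms by (intro mult_left_mono) (auto simp: max_def)
  finally show ?thesis .
qed

lemma powr_superadditive:
  fixes x y :: real
  assumes "x \<ge> 0" "y \<ge> 0" "P \<ge> 1"
  shows "x powr P + y powr P \<le> (x + y) powr P"
proof (cases "x + y = 0")
  case False
  then have s: "x + y > 0" using assms by linarith
  have le: "z powr P \<le> z * (x + y) powr (P - 1)" if "0 \<le> z" "z \<le> x + y" for z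
  proof (cases "z = 0")
    case False
    then have "z powr P = z * z powr (P - 1)" using that by (simp add: powr_mult_base)
    also have "\<dots> \<le> z * (x + y) powr (P - 1)" using that assms by (intro mult_left_mono powr_mono2) auto
    finally show ?thesis .
  qed (use assms in simp)
  have "x powr P + y powr P \<le> x * (x + y) powr (P - 1) + y * (x + y) powr (P - 1)"
    using le assms by (intro add_mono) auto
  also have "\<dots> = (x + y) * (x + y) powr (P - 1)" by (simp add: distrib_right)
  also have "\<dots> = (x + y) powr P" using s by (simp add: powr_mult_base)
  finally show ?thesis .
next
  case True
  then have "x = 0" "y = 0" using assms by linarith+
  then show ?thesis by simp
qed

lemma sum_powr_le_powr_sum:
  fixes x :: "'i \<Rightarrow> real"
  assumes x: "\<And>j. j \<in> J \<Longrightarrow> x j \<ge> 0" and P: "P \<ge> 1"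
  shows "(\<Sum>j\<in>J. x j powr P) \<le> (\<Sum>j\<in>J. x j) powr P"
  using x
proof (induction J rule: infinite_finite_induct)
  case (insert j J)
  have "(\<Sum>j\<in>insert j J. x j powr P) \<le> x j powr P + (\<Sum>j\<in>J. x j) powr P" using insert by simp
  also have "\<dots> \<le> (x j + (\<Sum>j\<in>J. x j)) powr P"
    using insert.prems P by (intro powr_superadditive sum_nonneg) auto
  finally show ?case using insert by simp
qed (use P in auto)

text \<open>A matrix with absolutely bounded row and column sums acts on \<open>\<ell>\<^sup>P\<close>. Norm bounds are expressed
throughout as bounds for all finite partial sums; this avoids infinite sums of real
powers and passes to the limit in the number of columns.\<close>

lemma schur_test:
  fixes \<kappa> :: "'i \<Rightarrow> 'j \<Rightarrow> complex" and v :: "'j \<Rightarrow> complex"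
  assumes P: "P \<ge> 1" and A: "A \<ge> 0" and B: "B \<ge> 0"
    and rows: "\<And>i J. finite J \<Longrightarrow> (\<Sum>j\<in>J. norm (\<kappa> i j)) \<le> A"
    and cols: "\<And>j I. finite I \<Longrightarrow> (\<Sum>i\<in>I. norm (\<kappa> i j)) \<le> A"
    and v: "\<And>J. finite J \<Longrightarrow> (\<Sum>j\<in>J. norm (v j) powr P) \<le> B powr P"
    and u: "\<And>i. ((\<lambda>j. \<kappa> i j * v j) has_sum u i) UNIV" and I: "finite I"
  shows "(\<Sum>i\<in>I. norm (u i) powr P) \<le> (A * B) powr P"
proof -
  have fin: "(\<Sum>i\<in>I. norm (\<Sum>j\<in>J. \<kappa> i j * v j) powr P) \<le> (A * B) powr P" if J: "finite J" for J
  proof -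
    have "(\<Sum>i\<in>I. norm (\<Sum>j\<in>J. \<kappa> i j * v j) powr P) \<le> (\<Sum>i\<in>I. A powr (P - 1) * (\<Sum>j\<in>J. norm (\<kappa> i j)
        * norm (v j) powr P))"
    proof (rule sum_mono)
      fix i
      have "norm (\<Sum>j\<in>J. \<kappa> i j * v j) \<le> (\<Sum>j\<in>J. norm (\<kappa> i j) * norm (v j))"
        by (rule order_trans[OF norm_sum]) (simp add: norm_mult)
      then have "norm (\<Sum>j\<in>J. \<kappa> i j * v j) powr P \<le> (\<Sum>j\<in>J. norm (\<kappa> i j) * norm (v j)) powr P"
        using P by (intro powr_mono2) auto
      also have "\<dots> \<le> A powr (P - 1) * (\<Sum>j\<in>J. norm (\<kappa> i j) * norm (v j) powr P)"
        by (rule weighted_power_mean[OF J _ _ rows[OF J] P]) auto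
      finally show "norm (\<Sum>j\<in>J. \<kappa> i j * v j) powr P \<le> A powr (P - 1) * (\<Sum>j\<in>J. norm (\<kappa> i j)
          * norm (v j) powr P)" .
    qed
    also have "\<dots> = A powr (P - 1) * (\<Sum>j\<in>J. (\<Sum>i\<in>I. norm (\<kappa> i j)) * norm (v j) powr P)"
      unfolding sum_distrib_left[symmetric] sum_distrib_right by (subst sum.swap) (rule refl)
    also have "\<dots> \<le> A powr (P - 1) * (\<Sum>j\<in>J. A * norm (v j) powr P)"
      by (intro mult_left_mono sum_mono mult_right_mono cols I) auto
    also have "\<dots> = A powr P * (\<Sum>j\<in>J. norm (v j) powr P)"
      using A P by (cases "A = 0") (auto simp: sum_distrib_left[symmetric] powr_mult_base
          mult.assoc[symmetric] mult.commute)
    also have "\<dots> \<le> A powr P * B powr P" by (intro mult_left_mono v J) auto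
    also have "\<dots> = (A * B) powr P" using A B by (simp add: powr_mult)
    finally show ?thesis .
  qed
  have "((\<lambda>J. \<Sum>i\<in>I. norm (\<Sum>j\<in>J. \<kappa> i j * v j) powr P) \<longlongrightarrow> (\<Sum>i\<in>I. norm (u i) powr P)) (finite_subsets_at_top UNIV)"
    using P u unfolding has_sum_def by (intro tendsto_sum tendsto_powr2 tendsto_norm tendsto_const) auto
  then show ?thesis
    by (rule tendsto_upperbound) (auto intro!: eventually_finite_subsets_at_top_weakI fin)
qed

lemma small_tail:
  fixes w :: "'i \<Rightarrow> real"
  assumes w: "\<And>i. w i \<ge> 0" and B: "\<And>J. finite J \<Longrightarrow> sum w J \<le> B" and \<epsilon>: "\<epsilon> > 0"
  obtains J0 where "finite J0" "\<And>J. finite J \<Longrightarrow> J \<inter> J0 = {} \<Longrightarrow> sum w J \<le> \<epsilon>"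
proof -
  have "w summable_on UNIV" by (rule summable_onI_bound[OF w B])
  then obtain S where S: "(w has_sum S) UNIV" by (auto simp: summable_on_def)
  then have "\<forall>\<^sub>F J in finite_subsets_at_top UNIV. dist (sum w J) S < \<epsilon>"
    using \<epsilon> unfolding has_sum_def by (rule tendstoD)
  then obtain J0 where J0: "finite J0" "\<And>Y. finite Y \<Longrightarrow> J0 \<subseteq> Y \<Longrightarrow> dist (sum w Y) S < \<epsilon>"
    unfolding eventually_finite_subsets_at_top by auto
  show ?thesis
  proof (rule that[OF J0(1)])
    fix J assume J: "finite J" "J \<inter> J0 = {}"
    have "sum w (J \<union> J0) \<le> S"
      using finite_sum_le_has_sum[OF S] J J0(1) w by auto
    moreover have "sum w (J \<union> J0) = sum w J + sum w J0" using J J0(1) by (intro sum.union_disjoint) auto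
    moreover have "dist (sum w J0) S < \<epsilon>" using J0 by auto
    ultimately show "sum w J \<le> \<epsilon>" unfolding dist_real_def by linarith
  qed
qed

lemma ennreal_powr_ennreal: "x \<ge> 0 \<Longrightarrow> ennreal_powr (ennreal x) r = ennreal (x powr r)"
  by (simp add: ennreal_powr_def)

lemma ell_norm_le:
  assumes P: "P \<ge> 1" and B: "B \<ge> 0" and c: "\<And>i. c i \<ge> 0" and v: "\<And>i. v i \<le> ennreal (c i)"
    and sum: "\<And>J. finite J \<Longrightarrow> (\<Sum>j\<in>J. c j powr P) \<le> B powr P"
  shows "ell_norm (ennreal P) v \<le> ennreal B"
proof -
  let ?X = "\<Sum>\<^sub>\<infinity>i. ennreal_powr (v i) P"
  have le: "ennreal_powr (v i) P \<le> ennreal (c i powr P)" for i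
  proof -
    obtain x where x: "v i = ennreal x" "x \<ge> 0"
      using v[of i] by (cases "v i") (auto simp: top_unique)
    then have "x \<le> c i" using v[of i] c[of i] by (simp add: ennreal_le_iff)
    then show ?thesis unfolding x(1) ennreal_powr_ennreal[OF x(2)]
      using x P by (intro ennreal_leI powr_mono2) auto
  qed
  have X: "?X \<le> ennreal (B powr P)"
  proof (rule infsum_le_finite_sums)
    fix J :: "'a set" assume J: "finite J"
    have "(\<Sum>i\<in>J. ennreal_powr (v i) P) \<le> (\<Sum>i\<in>J. ennreal (c i powr P))" by (intro sum_mono le)
    also have "\<dots> = ennreal (\<Sum>i\<in>J. c i powr P)" by (simp add: sum_ennreal)
    also have "\<dots> \<le> ennreal (B powr P)" by (intro ennreal_leI sum J)
    finally show "(\<Sum>i\<in>J. ennreal_powr (v i) P) \<le> ennreal (B powr P)" .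
  qed (rule nonneg_summable_on_complete, simp)
  then obtain x where x: "?X = ennreal x" "x \<ge> 0"
    by (metis ennreal_cases ennreal_neq_top neq_top_trans)
  have "x \<le> B powr P" using X x by (simp add: ennreal_le_iff)
  then have "x powr (1 / P) \<le> (B powr P) powr (1 / P)" using x P by (intro powr_mono2) auto
  also have "\<dots> = B" using B P by (simp add: powr_powr)
  finally have "ennreal (x powr (1 / P)) \<le> ennreal B" by (rule ennreal_leI)
  then show ?thesis using P x by (simp add: ell_norm_def ennreal_powr_ennreal)
qed

text \<open>A finite extended norm has finite entries, so that the rest of the argument takes place in the reals.\<close>

lemma ell_norm_finiteD:
  assumes P: "P \<ge> 1" and fin: "ell_norm (ennreal P) v < \<infinity>"
  obtains c B where "\<And>i. c i \<ge> 0" "B \<ge> 0" "\<And>i. v i = ennreal (c i)" "ell_norm (ennreal P) v = ennreal B"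
    "\<And>J. finite J \<Longrightarrow> (\<Sum>j\<in>J. c j powr P) \<le> B powr P"
proof -
  let ?X = "\<Sum>\<^sub>\<infinity>i. ennreal_powr (v i) P"
  have en: "ell_norm (ennreal P) v = ennreal_powr ?X (1 / P)" using P by (simp add: ell_norm_def)
  then have "?X \<noteq> \<infinity>" using fin by (auto simp: ennreal_powr_def)
  then obtain x where x: "?X = ennreal x" "x \<ge> 0" by (cases ?X) auto
  have le: "(\<Sum>i\<in>J. ennreal_powr (v i) P) \<le> ennreal x" if "finite J" for J
    unfolding x(1)[symmetric] by (subst nonneg_infsum_complete) (auto intro!: SUP_upper that)
  have vfin: "v i \<noteq> \<infinity>" for i
    using le[of "{i}"] by (auto simp: ennreal_powr_def top_unique)
  define c where "c i = enn2real (v i)" for i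
  have vc: "v i = ennreal (c i)" for i using vfin by (simp add: c_def less_top)
  have c0: "c i \<ge> 0" for i by (simp add: c_def)
  show ?thesis
  proof (rule that[of c "x powr (1 / P)"])
    show "ell_norm (ennreal P) v = ennreal (x powr (1 / P))" unfolding en x(1) using x(2)
        by (rule ennreal_powr_ennreal)
    fix J :: "'a set" assume "finite J"
    then have "ennreal (\<Sum>i\<in>J. c i powr P) \<le> ennreal x"
      using le[of J] c0 by (simp add: vc ennreal_powr_ennreal sum_ennreal)
    then show "(\<Sum>j\<in>J. c j powr P) \<le> (x powr (1 / P)) powr P"
      using x(2) P by (simp add: powr_powr ennreal_le_iff)
  qed (use c0 vc in auto)
qed

section \<open>Rescaled windows\<close>

text \<open>The window \<open>V\<close> transplanted to the frequency cell with centre \<open>\<xi>\<close> and radius proportional to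
\<open>r\<close>.\<close>

definition cell :: "real \<Rightarrow> real^'n::finite \<Rightarrow> (real^'n \<Rightarrow> complex) \<Rightarrow> real^'n \<Rightarrow> complex" where
  "cell r \<xi> V \<eta> = V ((1 / r) *\<^sub>R (\<eta> - \<xi>))"

definition supported :: "real \<Rightarrow> (real^'n::finite \<Rightarrow> complex) \<Rightarrow> bool" where
  "supported R V \<longleftrightarrow> smooth V \<and> (\<forall>\<zeta>. norm \<zeta> > R \<longrightarrow> V \<zeta> = 0)"

lemma supported_schwartz: "supported R V \<Longrightarrow> V \<in> schwartz"
  by (auto simp: supported_def intro: schwartz_compact_support)

lemma supported_mult: "supported R V \<Longrightarrow> smooth W \<Longrightarrow> supported R (\<lambda>\<eta>. V \<eta> * W \<eta>)"
  by (auto simp: supported_def smooth_mult)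

lemma supported_cell:
  assumes V: "supported R V" and r: "r > 0" shows "supported (r * R + norm \<xi>) (cell r \<xi> V)"
  unfolding supported_def
proof (intro conjI allI impI)
  have "smooth V" using V by (simp add: supported_def)
  from smooth_affine[OF this, of "1 / r" "- ((1 / r) *\<^sub>R \<xi>)"] show "smooth (cell r \<xi> V)"
    by (simp add: cell_def[abs_def] scaleR_diff_right)
  fix \<eta> :: "real^'a" assume "norm \<eta> > r * R + norm \<xi>"
  moreover have "norm \<eta> - norm \<xi> \<le> norm (\<eta> - \<xi>)" by (rule norm_triangle_ineq2)
  ultimately have "norm (\<eta> - \<xi>) > R * r" by (simp add: mult.commute)
  then have "norm ((1 / r) *\<^sub>R (\<eta> - \<xi>)) > R" using r by (simp add: pos_less_divide_eq)
  then show "cell r \<xi> V \<eta> = 0" using V by (simp add: supported_def cell_def)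
qed

lemma cell_eq_0: "supported R V \<Longrightarrow> r > 0 \<Longrightarrow> norm (\<eta> - \<xi>) > r * R \<Longrightarrow> cell r \<xi> V \<eta> = 0"
  by (auto simp: supported_def cell_def pos_less_divide_eq mult.commute)

text \<open>The Fourier transform of a cell of size \<open>r\<close> decreases at the scale \<open>1 / r\<close>, which is the spacing of its dual nodes; this is why
all bounds for sums over nodes below are independent of \<open>r\<close> up to the volume factor.\<close>

lemma fourier_cell:
  fixes V :: "real^'n::finite \<Rightarrow> complex"
  assumes V: "V \<in> schwartz" and r: "r > 0"
  shows "fourier (cell r \<xi> V) s = complex_of_real (r ^ CARD('n)) * (cis (- (\<xi> \<bullet> s)) * fourier V (r *\<^sub>R s))"
proof -
  have [measurable]: "V \<in> borel_measurable borel" using V by (rule schwartz_borel)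
  have "fourier (cell r \<xi> V) s =
      complex_of_real (\<bar>r\<bar> ^ CARD('n)) * (LINT \<zeta>|lborel. V ((1 / r) *\<^sub>R (\<xi> + r *\<^sub>R \<zeta> - \<xi>)) * cis (- ((\<xi>
          + r *\<^sub>R \<zeta>) \<bullet> s)))"
    unfolding fourier_def cell_def by (rule integral_affine) (use r in auto)
  also have "(LINT \<zeta>|lborel. V ((1 / r) *\<^sub>R (\<xi> + r *\<^sub>R \<zeta> - \<xi>)) * cis (- ((\<xi> + r *\<^sub>R \<zeta>) \<bullet> s))) =
      (LINT \<zeta>|lborel. cis (- (\<xi> \<bullet> s)) * (V \<zeta> * cis (- (\<zeta> \<bullet> (r *\<^sub>R s)))))"
  proof (rule Bochner_Integration.integral_cong[OF refl])
    fix \<zeta>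
    have "- ((\<xi> + r *\<^sub>R \<zeta>) \<bullet> s) = - (\<xi> \<bullet> s) + - (\<zeta> \<bullet> (r *\<^sub>R s))" by (simp add: inner_add_left)
    then have "cis (- ((\<xi> + r *\<^sub>R \<zeta>) \<bullet> s)) = cis (- (\<xi> \<bullet> s)) * cis (- (\<zeta> \<bullet> (r *\<^sub>R s)))"
      by (simp only: cis_mult)
    moreover have "(1 / r) *\<^sub>R (\<xi> + r *\<^sub>R \<zeta> - \<xi>) = \<zeta>" using r by simp
    ultimately show "V ((1 / r) *\<^sub>R (\<xi> + r *\<^sub>R \<zeta> - \<xi>)) * cis (- ((\<xi> + r *\<^sub>R \<zeta>) \<bullet> s)) = cis (- (\<xi> \<bullet> s))
        * (V \<zeta> * cis (- (\<zeta> \<bullet> (r *\<^sub>R s))))"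
      by (simp only: mult_ac)
  qed
  finally show ?thesis using r by (simp add: fourier_def)
qed

lemma dual_node_scale: "r \<noteq> 0 \<Longrightarrow> r *\<^sub>R dual_node (r * \<Lambda>) j = dual_node \<Lambda> j"
  by (simp add: dual_node_def)

lemma dual_node_uminus: "dual_node \<Lambda> (- j) = - dual_node \<Lambda> j"
  using dual_node_diff[of \<Lambda> 0 j] by (simp add: dual_node_def intvec_def flip: zero_vec_def)

lemma dual_node_sum:
  fixes G :: "real^'n::finite \<Rightarrow> complex"
  assumes "rapid G" "\<Lambda> > 0"
  obtains P where "P \<ge> 0" "\<And>x J. finite J \<Longrightarrow> (\<Sum>j\<in>J. norm (G (dual_node \<Lambda> j + x))) \<le> P"
  by (rule lattice_sum_rapid[OF assms(1) divide_pos_pos[OF pi_gt_zero assms(2)], where N=0])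
    (auto simp: dual_node_def)

lemma dual_node_sum_reflect:
  assumes "\<And>J. finite J \<Longrightarrow> (\<Sum>j\<in>J. norm (G (dual_node \<Lambda> j + x))) \<le> P" and "finite J"
  shows "(\<Sum>j\<in>J. norm (G (x - dual_node \<Lambda> j))) \<le> P"
proof -
  have "(\<Sum>j\<in>uminus ` J. norm (G (dual_node \<Lambda> j + x))) = (\<Sum>j\<in>J. norm (G (x - dual_node \<Lambda> j)))"
    by (subst sum.reindex) (auto simp: dual_node_uminus)
  then show ?thesis using assms(1)[of "uminus ` J"] assms(2) by simp
qed

lemma fourier_reflect:
  fixes g :: "real^'n::finite \<Rightarrow> complex"
  assumes [measurable]: "g \<in> borel_measurable borel"
  shows "fourier (\<lambda>y. g (- y)) \<eta> = fourier g (- \<eta>)"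
  unfolding fourier_def
  by (subst integral_affine[where f="\<lambda>t. g t * cis (- (t \<bullet> - \<eta>))" and r="-1" and c=0]) auto

text \<open>The convolution theorem: \<open>\<Theta>\<close> is a superposition of characters with amplitude its Fourier
transform, and each character translates the Fourier transform of \<open>X\<close>.\<close>

lemma fourier_mult:
  fixes \<Theta> X :: "real^'n::finite \<Rightarrow> complex"
  assumes T: "\<Theta> \<in> schwartz" and X: "X \<in> schwartz"
  shows "complex_of_real ((2 * pi) ^ CARD('n)) * fourier (\<lambda>\<eta>. \<Theta> \<eta> * X \<eta>) z =
    (LINT y|lborel. fourier \<Theta> (- y) * fourier X (y + z))"
proof -
  define \<tau> where "\<tau> y = fourier \<Theta> (- y)" for y
  have ft: "fourier \<Theta> \<in> schwartz" using T by (rule fourier_schwartz)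
  have [measurable]: "fourier \<Theta> \<in> borel_measurable borel" using ft by (rule schwartz_borel)
  have ti: "integrable lborel \<tau>"
    using integrable_affine[OF schwartz_integrable[OF ft], of "-1" 0] by (simp add: \<tau>_def[abs_def])
  have inv: "fourier \<tau> \<eta> = complex_of_real ((2 * pi) ^ CARD('n)) * \<Theta> \<eta>" for \<eta>
    unfolding \<tau>_def fourier_reflect[OF \<open>fourier \<Theta> \<in> borel_measurable borel\<close>] by (rule fourier_inversion[OF T])
  have "complex_of_real ((2 * pi) ^ CARD('n)) * fourier (\<lambda>\<eta>. \<Theta> \<eta> * X \<eta>) z =
      (LINT \<eta>|lborel. fourier \<tau> \<eta> * (X \<eta> * cis (\<eta> \<bullet> - z)))"
    unfolding inv unfolding fourier_def integral_mult_right_zero[symmetric] by (simp add: mult_ac)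
  also have "\<dots> = (LINT y|lborel. \<tau> y * fourier (\<lambda>\<eta>. X \<eta> * cis (\<eta> \<bullet> - z)) y)"
    by (intro fourier_multiplication ti schwartz_integrable schwartz_modulate X)
  finally show ?thesis unfolding fourier_shift \<tau>_def by simp
qed

text \<open>The total variation of the measure whose Fourier transform is \<open>\<Theta>\<close>.\<close>

definition fourier_mass :: "(real^'n::finite \<Rightarrow> complex) \<Rightarrow> real" where
  "fourier_mass \<Theta> = (LINT y|lborel. norm (fourier \<Theta> (- y))) / (2 * pi) ^ CARD('n)"

lemma fourier_mass_nonneg: "fourier_mass \<Theta> \<ge> 0"
  unfolding fourier_mass_def by (intro divide_nonneg_nonneg integral_nonneg_AE) auto

text \<open>Multiplication by \<open>\<Theta>\<close> averages translates, so any bound that holds for all translates survives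
with the factor \<open>fourier_mass \<Theta>\<close>. The factor does not change under dilations of \<open>\<Theta>\<close>; this
makes frequency cutoffs bounded uniformly in their size.\<close>

lemma fourier_mult_sum:
  fixes \<Theta> X :: "real^'n::finite \<Rightarrow> complex"
  assumes T: "\<Theta> \<in> schwartz" and X: "X \<in> schwartz" and J: "finite J"
    and P: "\<And>s. (\<Sum>j\<in>J. norm (fourier X (y j + s))) \<le> P"
  shows "(\<Sum>j\<in>J. norm (fourier (\<lambda>\<eta>. \<Theta> \<eta> * X \<eta>) (y j))) \<le> fourier_mass \<Theta> * P"
proof -
  let ?K = "(2 * pi) ^ CARD('n)"
  have K: "?K > 0" by simp
  have ft: "fourier \<Theta> \<in> schwartz" "fourier X \<in> schwartz" using T X by (auto intro: fourier_schwartz)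
  have ti: "integrable lborel (\<lambda>y. fourier \<Theta> (- y))"
    using integrable_affine[OF schwartz_integrable[OF ft(1)], of "-1" 0] by simp
  have [measurable]: "fourier X \<in> borel_measurable borel" "fourier \<Theta> \<in> borel_measurable borel"
    using ft by (auto intro: schwartz_borel)
  obtain C where C: "\<And>x. norm (fourier X x) \<le> C / (1 + norm x) ^ 0" "C \<ge> 0"
    by (rule rapid_le[OF schwartz_rapid[OF ft(2)], where M=0]) blast
  have i: "integrable lborel (\<lambda>s. fourier \<Theta> (- s) * fourier X (s + z))" for z
  proof (rule Bochner_Integration.integrable_bound)
    show "integrable lborel (\<lambda>s. C * norm (fourier \<Theta> (- s)))" using ti by auto
    have "norm (fourier \<Theta> (- s)) * norm (fourier X (s + z)) \<le> norm (fourier \<Theta> (- s)) * C" for s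
      using C(1)[of "s + z"] by (intro mult_left_mono) auto
    then show "AE s in lborel. norm (fourier \<Theta> (- s) * fourier X (s + z)) \<le> norm (C * norm (fourier \<Theta> (- s)))"
      using C(2) by (simp add: norm_mult mult.commute)
  qed measurable
  have "?K * (\<Sum>j\<in>J. norm (fourier (\<lambda>\<eta>. \<Theta> \<eta> * X \<eta>) (y j))) =
      (\<Sum>j\<in>J. norm (LINT s|lborel. fourier \<Theta> (- s) * fourier X (s + y j)))"
    unfolding sum_distrib_left fourier_mult[OF T X, symmetric] by (simp add: norm_mult norm_power)
  also have "\<dots> \<le> (\<Sum>j\<in>J. (LINT s|lborel. norm (fourier \<Theta> (- s) * fourier X (s + y j))))"
    by (intro sum_mono integral_norm_bound)
  also have "\<dots> = (LINT s|lborel. (\<Sum>j\<in>J. norm (fourier \<Theta> (- s) * fourier X (s + y j))))"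
    using i by (subst Bochner_Integration.integral_sum) auto
  also have "\<dots> \<le> (LINT s|lborel. norm (fourier \<Theta> (- s)) * P)"
  proof (rule integral_mono)
    show "integrable lborel (\<lambda>s. \<Sum>j\<in>J. norm (fourier \<Theta> (- s) * fourier X (s + y j)))" using i by auto
    show "integrable lborel (\<lambda>s. norm (fourier \<Theta> (- s)) * P)" using ti by auto
    fix s
    have "(\<Sum>j\<in>J. norm (fourier \<Theta> (- s) * fourier X (s + y j))) = norm (fourier \<Theta> (- s))
        * (\<Sum>j\<in>J. norm (fourier X (y j + s)))"
      by (simp add: norm_mult sum_distrib_left add.commute)
    also have "\<dots> \<le> norm (fourier \<Theta> (- s)) * P" by (intro mult_left_mono P) auto
    finally show "(\<Sum>j\<in>J. norm (fourier \<Theta> (- s) * fourier X (s + y j))) \<le> norm (fourier \<Theta> (- s)) * P" .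
  qed
  also have "\<dots> = ?K * (fourier_mass \<Theta> * P)" by (simp add: fourier_mass_def)
  finally show ?thesis using K by (simp only: mult_le_cancel_left_pos)
qed

lemma cell_node_sum:
  fixes V :: "real^'n::finite \<Rightarrow> complex"
  assumes V: "supported R V" and L: "\<Lambda> > 0"
  obtains P where "P \<ge> 0" and "\<And>\<Theta> r \<xi> z J. \<Theta> \<in> schwartz \<Longrightarrow> r > 0 \<Longrightarrow> finite J \<Longrightarrow>
    (\<Sum>j\<in>J. norm (fourier (\<lambda>\<eta>. \<Theta> \<eta> * cell r \<xi> V \<eta>) (dual_node (r * \<Lambda>) j + z))) \<le> fourier_mass \<Theta>
        * (r ^ CARD('n) * P)"
proof -
  have Vs: "V \<in> schwartz" using V by (rule supported_schwartz)
  obtain P where P: "P \<ge> 0" "\<And>x J. finite J \<Longrightarrow> (\<Sum>j\<in>J. norm (fourier V (dual_node \<Lambda> j + x))) \<le> P"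
    by (rule dual_node_sum[OF fourier_rapid[OF Vs] L]) blast
  show ?thesis
  proof (rule that[OF P(1)])
    fix \<Theta> :: "real^'n \<Rightarrow> complex" and r :: real and \<xi> z :: "real^'n" and J :: "(int^'n) set"
    assume T: "\<Theta> \<in> schwartz" and r: "r > 0" and J: "finite J"
    show "(\<Sum>j\<in>J. norm (fourier (\<lambda>\<eta>. \<Theta> \<eta> * cell r \<xi> V \<eta>) (dual_node (r * \<Lambda>) j + z))) \<le> fourier_mass \<Theta>
        * (r ^ CARD('n) * P)"
    proof (rule fourier_mult_sum[OF T supported_schwartz[OF supported_cell[OF V r]] J])
      fix s
      have "norm (fourier (cell r \<xi> V) (dual_node (r * \<Lambda>) j + z + s)) = r ^ CARD('n)
          * norm (fourier V (dual_node \<Lambda> j + r *\<^sub>R (z + s)))" for j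
        using r dual_node_scale[of r \<Lambda> j]
        by (simp add: fourier_cell[OF Vs r] norm_mult norm_power scaleR_add_right add.assoc)
      then have "(\<Sum>j\<in>J. norm (fourier (cell r \<xi> V) (dual_node (r * \<Lambda>) j + z + s))) = r ^ CARD('n)
          * (\<Sum>j\<in>J. norm (fourier V (dual_node \<Lambda> j + r *\<^sub>R (z + s))))"
        by (simp add: sum_distrib_left)
      also have "\<dots> \<le> r ^ CARD('n) * P" using r by (intro mult_left_mono P J) auto
      finally show "(\<Sum>j\<in>J. norm (fourier (cell r \<xi> V) (dual_node (r * \<Lambda>) j + z + s))) \<le> r ^ CARD('n) * P" .
    qed
  qed
qed

lemma fourier_mass_cell:
  fixes \<theta> :: "real^'n::finite \<Rightarrow> complex"
  assumes t: "\<theta> \<in> schwartz" and K: "K > 0"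
  shows "fourier_mass (cell K 0 \<theta>) = fourier_mass \<theta>"
proof -
  have [measurable]: "fourier \<theta> \<in> borel_measurable borel" using fourier_schwartz[OF t] by (rule schwartz_borel)
  have "complex_of_real (LINT y|lborel. norm (fourier \<theta> (- y)))
      = (LINT y|lborel. complex_of_real (norm (fourier \<theta> (- y))))"
    by simp
  also have "\<dots> = complex_of_real (\<bar>K\<bar> ^ CARD('n)) * (LINT y|lborel. complex_of_real (norm (fourier \<theta> (-
      (0 + K *\<^sub>R y)))))"
    by (rule integral_affine) (use K in auto)
  also have "\<dots> = (LINT y|lborel. complex_of_real (K ^ CARD('n))
      * complex_of_real (norm (fourier \<theta> (- (K *\<^sub>R y)))))"
    using K by simp
  also have "\<dots> = (LINT y|lborel. complex_of_real (norm (fourier (cell K 0 \<theta>) (- y))))"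
    using K by (simp add: fourier_cell[OF t K] norm_mult norm_power)
  also have "\<dots> = complex_of_real (LINT y|lborel. norm (fourier (cell K 0 \<theta>) (- y)))" by simp
  finally show ?thesis unfolding fourier_mass_def of_real_eq_iff by simp
qed

text \<open>On the cell, \<open>\<xi>\<^sub>i = \<eta>\<^sub>i - r \<zeta>\<^sub>i\<close> with \<open>\<zeta>\<close> the local coordinate: the factor \<open>\<xi>\<^sub>i\<close> can be moved to
\<open>\<Gamma>\<close> or, at the price \<open>r\<close>, to the window.\<close>

lemma cell_coordinate:
  fixes V \<Gamma> :: "real^'n::finite \<Rightarrow> complex"
  assumes V: "supported R V" and G: "\<Gamma> \<in> schwartz" and r: "r > 0"
  shows "\<bar>\<xi> $ i\<bar> * norm (fourier (\<lambda>\<eta>. \<Gamma> \<eta> * cell r \<xi> V \<eta>) s) \<le>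
    norm (fourier (\<lambda>\<eta>. \<Gamma> \<eta> * complex_of_real (\<eta> $ i) * cell r \<xi> V \<eta>) s) +
    r * norm (fourier (\<lambda>\<eta>. \<Gamma> \<eta> * cell r \<xi> (\<lambda>\<zeta>. V \<zeta> * complex_of_real (\<zeta> $ i)) \<eta>) s)"
    (is "_ * norm ?F \<le> norm ?A + r * norm ?B")
proof -
  have g: "(\<lambda>\<eta>. \<Gamma> \<eta> * complex_of_real (\<eta> $ i)) \<in> schwartz"
    by (intro schwartz_mult_multiplier G coordinate_multiplier)
  have v: "supported R (\<lambda>\<zeta>. V \<zeta> * complex_of_real (\<zeta> $ i))"
    by (intro supported_mult V multiplier_smooth coordinate_multiplier)
  have i1: "integrable lborel (\<lambda>\<eta>. \<Gamma> \<eta> * complex_of_real (\<eta> $ i) * cell r \<xi> V \<eta> * cis (- (\<eta> \<bullet> s)))"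
    by (intro integrable_cis_neg schwartz_integrable schwartz_mult g supported_schwartz[OF
        supported_cell[OF V r]])
  have i2: "integrable lborel (\<lambda>\<eta>. \<Gamma> \<eta> * cell r \<xi> (\<lambda>\<zeta>. V \<zeta> * complex_of_real (\<zeta> $ i)) \<eta> * cis (- (\<eta> \<bullet> s)))"
    by (intro integrable_cis_neg schwartz_integrable schwartz_mult G supported_schwartz[OF
        supported_cell[OF v r]])
  have e: "complex_of_real (\<xi> $ i) * (\<Gamma> \<eta> * cell r \<xi> V \<eta> * cis (- (\<eta> \<bullet> s))) =
      \<Gamma> \<eta> * complex_of_real (\<eta> $ i) * cell r \<xi> V \<eta> * cis (- (\<eta> \<bullet> s)) -
      complex_of_real r * (\<Gamma> \<eta> * cell r \<xi> (\<lambda>\<zeta>. V \<zeta> * complex_of_real (\<zeta> $ i)) \<eta> * cis (- (\<eta> \<bullet> s)))" for \<eta>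
  proof -
    have "\<xi> $ i = \<eta> $ i - r * (((1 / r) *\<^sub>R (\<eta> - \<xi>)) $ i)" using r by simp
    then have "complex_of_real (\<xi> $ i) = complex_of_real (\<eta> $ i) - complex_of_real r
        * complex_of_real (((1 / r) *\<^sub>R (\<eta> - \<xi>)) $ i)"
      by (metis of_real_diff of_real_mult)
    then show ?thesis unfolding cell_def by (simp only: left_diff_distrib right_diff_distrib mult_ac)
  qed
  have "complex_of_real (\<xi> $ i) * ?F = ?A - complex_of_real r * ?B"
    unfolding fourier_def integral_mult_right_zero[symmetric] e
    by (subst Bochner_Integration.integral_diff[OF i1 integrable_mult_right[OF i2]]) (rule refl)
  then have "\<bar>\<xi> $ i\<bar> * norm ?F = norm (?A - complex_of_real r * ?B)"
    by (metis norm_mult norm_of_real)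
  also have "\<dots> \<le> norm ?A + norm (complex_of_real r * ?B)" by (rule norm_triangle_ineq4)
  finally show ?thesis using r by (simp add: norm_mult)
qed

text \<open>Iterating the previous identity trades each power of \<open>|\<xi>|\<close> for a factor \<open>1 + r\<close>. With
\<open>r = |\<xi>|\<^sup>1\<^sup>-\<^sup>\<alpha>\<close> and \<open>|\<xi>| \<ge> 1\<close> that factor is at most twice \<open>|\<xi>|\<close> to the power
\<open>1 - min 1 \<alpha>\<close>, so this is decay of every polynomial order when \<open>\<alpha> > 0\<close>.\<close>

lemma cell_decay:
  fixes V \<Gamma> :: "real^'n::finite \<Rightarrow> complex"
  assumes L: "\<Lambda> > 0"
  shows "supported R V \<Longrightarrow> \<Gamma> \<in> schwartz \<Longrightarrow> \<exists>C. \<forall>r \<xi> J z. r > 0 \<longrightarrow> finite J \<longrightarrow>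
    norm \<xi> ^ N * (\<Sum>j\<in>J. norm (fourier (\<lambda>\<eta>. \<Gamma> \<eta> * cell r \<xi> V \<eta>) (dual_node (r * \<Lambda>) j + z)))
    \<le> C * ((1 + r) ^ N * r ^ CARD('n))"
proof (induction N arbitrary: V \<Gamma>)
  case 0
  obtain P where P: "\<And>\<Theta> r \<xi> z J. \<Theta> \<in> schwartz \<Longrightarrow> r > 0 \<Longrightarrow> finite J \<Longrightarrow>
    (\<Sum>j\<in>J. norm (fourier (\<lambda>\<eta>. \<Theta> \<eta> * cell r \<xi> V \<eta>) (dual_node (r * \<Lambda>) j + z))) \<le> fourier_mass \<Theta>
        * (r ^ CARD('n) * P)"
    by (rule cell_node_sum[OF 0(1) L]) blast
  show ?case
    using P[OF 0(2)] by (intro exI[of _ "fourier_mass \<Gamma> * P"]) (simp add: mult_ac)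
next
  case (Suc N)
  let ?S = "\<lambda>\<Gamma> V r \<xi> J z. (\<Sum>j\<in>J. norm (fourier (\<lambda>\<eta>. \<Gamma> \<eta> * cell r \<xi> V \<eta>) (dual_node (r * \<Lambda>) j + z)))"
  let ?bd = "\<lambda>C \<Gamma> V. \<forall>r \<xi> J z. r > 0 \<longrightarrow> finite J \<longrightarrow> norm \<xi> ^ N * ?S \<Gamma> V r \<xi> J z \<le> C * ((1 + r) ^ N
      * r ^ CARD('n))"
  let ?G = "\<lambda>i \<eta>. \<Gamma> \<eta> * complex_of_real (\<eta> $ i)" and ?V = "\<lambda>i \<zeta>. V \<zeta> * complex_of_real (\<zeta> $ i)"
  have "?G i \<in> schwartz" for i by (intro schwartz_mult_multiplier Suc.prems coordinate_multiplier)
  then have "\<forall>i. \<exists>C. ?bd C (?G i) V" using Suc.IH[OF Suc.prems(1)] by blast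
  from choice[OF this] obtain C where C: "\<And>i. ?bd (C i) (?G i) V" by blast
  have "supported R (?V i)" for i by (intro supported_mult Suc.prems multiplier_smooth coordinate_multiplier)
  then have "\<forall>i. \<exists>C. ?bd C \<Gamma> (?V i)" using Suc.IH[OF _ Suc.prems(2)] by blast
  from choice[OF this] obtain D where D: "\<And>i. ?bd (D i) \<Gamma> (?V i)" by blast
  show ?case
  proof (intro exI allI impI)
    fix r :: real and \<xi> z :: "real^'n" and J :: "(int^'n) set" assume r: "r > 0" and J: "finite J"
    let ?w = "(1 + r) ^ N * r ^ CARD('n)"
    have w: "0 \<le> ?w" using r by simp
    have S: "\<bar>\<xi> $ i\<bar> * ?S \<Gamma> V r \<xi> J z \<le> ?S (?G i) V r \<xi> J z + r * ?S \<Gamma> (?V i) r \<xi> J z" for i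
      unfolding sum_distrib_left sum.distrib[symmetric] by (intro sum_mono cell_coordinate[OF Suc.prems r])
    have CD: "norm \<xi> ^ N * ?S (?G i) V r \<xi> J z \<le> C i * ?w" "norm \<xi> ^ N * ?S \<Gamma> (?V i) r \<xi> J z \<le> D i * ?w" for i
      using C[of i] D[of i] r J by blast+
    have step: "norm \<xi> ^ N * (\<bar>\<xi> $ i\<bar> * ?S \<Gamma> V r \<xi> J z) \<le> (\<bar>C i\<bar> + \<bar>D i\<bar>) * ((1 + r) * ?w)" for i
    proof -
      have "norm \<xi> ^ N * (\<bar>\<xi> $ i\<bar> * ?S \<Gamma> V r \<xi> J z) \<le> norm \<xi> ^ N * (?S (?G i) V r \<xi> J z + r
          * ?S \<Gamma> (?V i) r \<xi> J z)"
        by (intro mult_left_mono S) auto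
      also have "\<dots> = norm \<xi> ^ N * ?S (?G i) V r \<xi> J z + r * (norm \<xi> ^ N * ?S \<Gamma> (?V i) r \<xi> J z)"
        by (simp only: distrib_left mult.left_commute)
      also have "\<dots> \<le> C i * ?w + r * (D i * ?w)" using r by (intro add_mono CD mult_left_mono) auto
      also have "\<dots> \<le> \<bar>C i\<bar> * ?w + r * (\<bar>D i\<bar> * ?w)" using r w
          by (intro add_mono mult_left_mono mult_right_mono) auto
      also have "\<dots> \<le> (\<bar>C i\<bar> + \<bar>D i\<bar>) * ((1 + r) * ?w)"
      proof -
        have "0 \<le> r * (\<bar>C i\<bar> * ?w)" "0 \<le> \<bar>D i\<bar> * ?w" using r w by (auto intro: mult_nonneg_nonneg)
        then show ?thesis by (simp add: distrib_left distrib_right mult_ac)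
      qed
      finally show ?thesis .
    qed
    have "norm \<xi> ^ Suc N * ?S \<Gamma> V r \<xi> J z \<le> (\<Sum>i\<in>UNIV. \<bar>\<xi> $ i\<bar>) * (norm \<xi> ^ N * ?S \<Gamma> V r \<xi> J z)"
      unfolding power_Suc mult.assoc by (intro mult_right_mono norm_le_l1_cart mult_nonneg_nonneg
          sum_nonneg) auto
    also have "\<dots> = (\<Sum>i\<in>UNIV. norm \<xi> ^ N * (\<bar>\<xi> $ i\<bar> * ?S \<Gamma> V r \<xi> J z))"
      unfolding sum_distrib_right by (simp only: mult.left_commute)
    also have "\<dots> \<le> (\<Sum>i\<in>UNIV. (\<bar>C i\<bar> + \<bar>D i\<bar>) * ((1 + r) * ?w))" by (intro sum_mono step)
    also have "\<dots> = (\<Sum>i\<in>UNIV. \<bar>C i\<bar> + \<bar>D i\<bar>) * ((1 + r) ^ Suc N * r ^ CARD('n))"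
      unfolding sum_distrib_right[symmetric] power_Suc mult.assoc ..
    finally show "norm \<xi> ^ Suc N * ?S \<Gamma> V r \<xi> J z \<le> (\<Sum>i\<in>UNIV. \<bar>C i\<bar> + \<bar>D i\<bar>) * ((1 + r) ^ Suc N
        * r ^ CARD('n))" .
  qed
qed

section \<open>Schwartz functions as distributions\<close>

lemma distr_of_tempered:
  assumes g: "g \<in> schwartz" shows "distr_of g \<in> tempered"
  unfolding tempered_def
proof (intro CollectI conjI ballI allI impI)
  have gi: "integrable lborel g" using g by (rule schwartz_integrable)
  have i: "integrable lborel (\<lambda>t. g t * h t)" if "h \<in> schwartz" for h
    by (intro schwartz_integrable schwartz_mult g that)
  show "distr_of g (\<lambda>t. h t + k t) = distr_of g h + distr_of g k" if "h \<in> schwartz" "k \<in> schwartz" for h k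
    using that i[OF that(1)] i[OF that(2)] by (simp add: distr_of_def schwartz_add distrib_left)
  show "distr_of g (\<lambda>t. c * h t) = c * distr_of g h" if "h \<in> schwartz" for c h
    using that by (simp add: distr_of_def schwartz_cmult mult.left_commute)
  show "\<exists>C N. \<forall>h\<in>schwartz. norm (distr_of g h) \<le> C * schwartz_seminorm N h"
  proof (intro exI ballI)
    fix h :: "real^'a \<Rightarrow> complex" assume h: "h \<in> schwartz"
    have "norm (distr_of g h) \<le> (LINT t|lborel. norm (g t * h t))"
      using h by (simp add: distr_of_def integral_norm_bound)
    also have "\<dots> \<le> (LINT t|lborel. norm (g t) * schwartz_seminorm 0 h)"
    proof (rule integral_mono)
      fix t
      show "norm (g t * h t) \<le> norm (g t) * schwartz_seminorm 0 h"
        using schwartz_seminorm_ge[OF h, of "[]" 0 t] by (simp add: norm_mult mult_left_mono)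
    qed (use i[OF h] gi in auto)
    finally show "norm (distr_of g h) \<le> (LINT t|lborel. norm (g t)) * schwartz_seminorm 0 h" by simp
  qed
qed (simp add: distr_of_def)

text \<open>For a distribution given by a function, the sample is the Fourier transform of a product with the
window, so the bounds for cells apply.\<close>

lemma band_value_distr_of:
  assumes g: "g \<in> schwartz" and U: "U \<in> schwartz"
  shows "band_value (distr_of g) U x = fourier (\<lambda>\<eta>. fourier g \<eta> * U \<eta>) (- x)"
proof -
  have M: "(\<lambda>\<eta>. U \<eta> * cis (\<eta> \<bullet> x)) \<in> schwartz" by (rule schwartz_modulate[OF U])
  have "band_value (distr_of g) U x = (LINT t|lborel. g t * fourier (\<lambda>\<eta>. U \<eta> * cis (\<eta> \<bullet> x)) t)"
    by (simp add: band_value_def distr_of_def fourier_schwartz[OF M])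
  also have "\<dots> = (LINT \<eta>|lborel. fourier g \<eta> * (U \<eta> * cis (\<eta> \<bullet> x)))"
    by (rule fourier_multiplication[symmetric]) (auto intro: schwartz_integrable g M)
  also have "\<dots> = fourier (\<lambda>\<eta>. fourier g \<eta> * U \<eta>) (- x)" by (simp add: fourier_def mult.assoc)
  finally show ?thesis .
qed

text \<open>The inverse transform is, up to a constant, the third iterate of the transform; this form is
visibly a Schwartz function.\<close>

lemma fourier_surj:
  fixes \<Gamma> :: "real^'n::finite \<Rightarrow> complex"
  assumes G: "\<Gamma> \<in> schwartz"
  obtains g where "g \<in> schwartz" "fourier g = \<Gamma>"
proof
  let ?K = "complex_of_real ((2 * pi) ^ CARD('n))"
  let ?h = "fourier (fourier (fourier \<Gamma>))"
  have F: "fourier (fourier u) x = ?K * u (- x)" if "u \<in> schwartz" for u :: "real^'n \<Rightarrow> complex" and x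
    using fourier_inversion[OF that, of "- x"] by simp
  have h: "?h \<in> schwartz" by (intro fourier_schwartz G)
  show "(\<lambda>t. 1 / (?K * ?K) * ?h t) \<in> schwartz" by (intro schwartz_cmult h)
  show "fourier (\<lambda>t. 1 / (?K * ?K) * ?h t) = \<Gamma>"
  proof
    fix \<eta>
    have "fourier (\<lambda>t. 1 / (?K * ?K) * ?h t) \<eta> = 1 / (?K * ?K) * fourier ?h \<eta>"
      unfolding fourier_def[of _ \<eta>] mult.assoc integral_mult_right_zero ..
    also have "fourier ?h \<eta> = ?K * (?K * \<Gamma> \<eta>)"
      using F[OF fourier_schwartz[OF fourier_schwartz[OF G]], of \<eta>] F[OF G, of "- \<eta>"] by simp
    also have "1 / (?K * ?K) * (?K * (?K * \<Gamma> \<eta>)) = \<Gamma> \<eta>" by simp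
    finally show "fourier (\<lambda>t. 1 / (?K * ?K) * ?h t) \<eta> = \<Gamma> \<eta>" .
  qed
qed

lemma band_value_sum:
  assumes f: "f \<in> tempered" and W: "\<And>k. k \<in> F \<Longrightarrow> W k \<in> schwartz"
  shows "band_value f (\<lambda>\<eta>. \<Sum>k\<in>F. W k \<eta>) x = (\<Sum>k\<in>F. band_value f (W k) x)"
proof -
  have "fourier (\<lambda>\<eta>. (\<Sum>k\<in>F. W k \<eta>) * cis (\<eta> \<bullet> x)) = (\<lambda>t. \<Sum>k\<in>F. 1 * fourier (\<lambda>\<eta>. W k \<eta> * cis (\<eta> \<bullet> x)) t)"
    unfolding fourier_def sum_distrib_right mult_1
    by (intro ext Bochner_Integration.integral_sum integrable_cis_neg schwartz_integrable schwartz_modulate W)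
  then show ?thesis
    unfolding band_value_def using tempered_sum[OF f, of F "\<lambda>k. fourier (\<lambda>\<eta>. W k \<eta> * cis (\<eta> \<bullet> x))" "\<lambda>_. 1"] W
    by (simp add: fourier_schwartz schwartz_modulate)
qed

section \<open>Packets as Fourier transforms\<close>

text \<open>By Fourier inversion a conjugated packet is the Fourier transform of a modulated cell; evenness of
the window turns the reflection in the inversion formula into the right sign.\<close>

lemma cnj_packet:
  fixes \<phi> :: "real^'n::finite \<Rightarrow> real" and \<alpha> :: real
  assumes \<phi>: "(\<lambda>t. complex_of_real (\<phi> t)) \<in> schwartz" and even: "\<And>t. \<phi> (- t) = \<phi> t" and \<xi>: "\<xi> \<noteq> 0"
    and r_def: "r = norm \<xi> powr (1 - \<alpha>)"
  shows "cnj (packet \<alpha> \<phi> x \<xi> t) = (complex_of_real (r powr (- real CARD('n) / 2) / (2 * pi) ^ CARD('n))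
      * cis (- (\<xi> \<bullet> x))) *
    fourier (\<lambda>\<eta>. cell r \<xi> (fourier (\<lambda>t. complex_of_real (\<phi> t))) \<eta> * cis (\<eta> \<bullet> x)) t"
proof -
  let ?d = "CARD('n)" and ?\<phi> = "\<lambda>t. complex_of_real (\<phi> t)"
  have r: "r > 0" using \<xi> by (simp add: r_def)
  have "fourier (\<lambda>\<eta>. cell r \<xi> (fourier ?\<phi>) \<eta> * cis (\<eta> \<bullet> x)) t =
      complex_of_real (r ^ ?d) * (cis (- (\<xi> \<bullet> (t - x))) * fourier (fourier ?\<phi>) (r *\<^sub>R (t - x)))"
    unfolding fourier_shift by (rule fourier_cell[OF fourier_schwartz[OF \<phi>] r])
  also have "fourier (fourier ?\<phi>) (r *\<^sub>R (t - x)) = complex_of_real ((2 * pi) ^ ?d) * ?\<phi> (r *\<^sub>R (t - x))"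
    using fourier_inversion[OF \<phi>, of "- (r *\<^sub>R (t - x))"] even by simp
  finally have F: "fourier (\<lambda>\<eta>. cell r \<xi> (fourier ?\<phi>) \<eta> * cis (\<eta> \<bullet> x)) t =
      complex_of_real (r ^ ?d) * (cis (- (\<xi> \<bullet> (t - x))) * (complex_of_real ((2 * pi) ^ ?d) * ?\<phi> (r *\<^sub>R (t
          - x))))" .
  have a: "r powr (- real ?d / 2) / (2 * pi) ^ ?d * r ^ ?d * (2 * pi) ^ ?d = norm \<xi> powr (real ?d / 2
      * (1 - \<alpha>))"
  proof -
    have "r powr (- real ?d / 2) * r ^ ?d = r powr (- real ?d / 2 + real ?d)"
      unfolding powr_add powr_realpow[OF r] ..
    also have "- real ?d / 2 + real ?d = real ?d / 2" by simp
    also have "r powr (real ?d / 2) = norm \<xi> powr (real ?d / 2 * (1 - \<alpha>))"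
      by (simp add: r_def powr_powr mult.commute)
    finally show ?thesis by simp
  qed
  have "- (\<xi> \<bullet> x) + - (\<xi> \<bullet> (t - x)) = - (t \<bullet> \<xi>)" by (simp add: inner_diff_right inner_commute)
  then have c: "cis (- (\<xi> \<bullet> x)) * cis (- (\<xi> \<bullet> (t - x))) = cis (- (t \<bullet> \<xi>))" by (simp only: cis_mult)
  have "(complex_of_real (r powr (- real ?d / 2) / (2 * pi) ^ ?d) * cis (- (\<xi> \<bullet> x))) *
      (complex_of_real (r ^ ?d) * (cis (- (\<xi> \<bullet> (t - x))) * (complex_of_real ((2 * pi) ^ ?d)
          * ?\<phi> (r *\<^sub>R (t - x)))))
    = complex_of_real (r powr (- real ?d / 2) / (2 * pi) ^ ?d * r ^ ?d * (2 * pi) ^ ?d) * ?\<phi> (r *\<^sub>R (t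
        - x)) * (cis (- (\<xi> \<bullet> x)) * cis (- (\<xi> \<bullet> (t - x))))"
    by (simp only: of_real_mult mult_ac)
  also have "\<dots> = cnj (packet \<alpha> \<phi> x \<xi> t)"
    unfolding a c unfolding packet_def r_def by (simp add: cis_cnj)
  finally show ?thesis unfolding F by simp
qed

lemma frame_coeff_band_value:
  fixes \<phi> :: "real^'n::finite \<Rightarrow> real"
  assumes f: "f \<in> tempered" and \<phi>: "(\<lambda>t. complex_of_real (\<phi> t)) \<in> schwartz" and even: "\<And>t. \<phi> (- t) = \<phi> t"
    and \<xi>: "\<xi> k \<noteq> 0" and r_def: "r = norm (\<xi> k) powr (1 - \<alpha>)"
    and U: "cell r (\<xi> k) (fourier (\<lambda>t. complex_of_real (\<phi> t))) \<in> schwartz"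
    and b: "b * \<rho> > 0"
  shows "frame_coeff \<alpha> b \<phi> \<rho> \<xi> f k j =
    (complex_of_real (r powr (- real CARD('n) / 2) / (2 * pi) ^ CARD('n))
        * cis (- (\<xi> k \<bullet> lattice_node \<alpha> b \<rho> \<xi> k j))) *
    band_value f (cell r (\<xi> k) (fourier (\<lambda>t. complex_of_real (\<phi> t)))) (dual_node (r * (pi / (b * \<rho>))) j)"
proof -
  let ?c = "complex_of_real (r powr (- real CARD('n) / 2) / (2 * pi) ^ CARD('n))"
  let ?x = "lattice_node \<alpha> b \<rho> \<xi> k j"
  have r: "r > 0" using \<xi> by (simp add: r_def)
  have x: "?x = dual_node (r * (pi / (b * \<rho>))) j"
  proof -
    have "norm (\<xi> k) powr (\<alpha> - 1) = inverse r"
      unfolding r_def powr_minus[symmetric] by (rule arg_cong2[where f="(powr)"]) auto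
    then have "b * \<rho> * norm (\<xi> k) powr (\<alpha> - 1) = pi / (r * (pi / (b * \<rho>)))" using r b by (simp add: field_simps)
    then show ?thesis unfolding lattice_node_def dual_node_def intvec_def by simp
  qed
  have "frame_coeff \<alpha> b \<phi> \<rho> \<xi> f k j = f (\<lambda>t. cnj (packet \<alpha> \<phi> ?x (\<xi> k) t))"
    by (simp add: frame_coeff_def pairing_def)
  also have "\<dots> = (?c * cis (- (\<xi> k \<bullet> ?x))) * band_value f (cell r (\<xi> k) (fourier (\<lambda>t. complex_of_real (\<phi>
      t)))) ?x"
    unfolding cnj_packet[OF \<phi> even \<xi> r_def] band_value_def
    by (rule tempered_cmult[OF f fourier_schwartz[OF schwartz_modulate[OF U]]])
  finally show ?thesis unfolding x .
qed

section \<open>Approximation by finitely many cells and nodes\<close>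

text \<open>What the density argument needs from a subdyadic frame pair: the cells do not vanish simultaneously,
the support of the window fits into the cube whose dual lattice carries the nodes, and only finitely
many centers lie in a bounded set.\<close>

locale cell_frame =
  fixes \<alpha> \<Lambda> R :: real and V :: "real^'n::finite \<Rightarrow> complex" and \<xi> :: "nat \<Rightarrow> real^'n"
  assumes alpha: "\<alpha> > 0" and R: "0 < R" "R < \<Lambda>" and V: "supported R V"
    and xi_ge_1: "norm (\<xi> k) \<ge> 1"
    and cover: "\<exists>k. cell (norm (\<xi> k) powr (1 - \<alpha>)) (\<xi> k) V \<eta> \<noteq> 0"
    and finite_xi: "finite {k. norm (\<xi> k) \<le> X}"
begin

definition r :: "nat \<Rightarrow> real" where "r k = norm (\<xi> k) powr (1 - \<alpha>)"
definition U :: "nat \<Rightarrow> real^'n \<Rightarrow> complex" where "U k = cell (r k) (\<xi> k) V"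
definition node :: "nat \<Rightarrow> int^'n \<Rightarrow> real^'n" where "node k = dual_node (r k * \<Lambda>)"

abbreviation val :: "((real^'n \<Rightarrow> complex) \<Rightarrow> complex) \<Rightarrow> nat \<Rightarrow> int^'n \<Rightarrow> complex" where
  "val f k j \<equiv> band_value f (U k) (node k j)"

lemma Lambda_pos: "\<Lambda> > 0" using R by simp
lemma xi_pos: "norm (\<xi> k) > 0" using xi_ge_1[of k] by linarith
lemma r_pos: "r k > 0" using xi_pos[of k] by (simp add: r_def)
lemma rL_pos: "r k * \<Lambda> > 0" by (simp add: r_pos Lambda_pos)

lemma U_schwartz: "U k \<in> schwartz" unfolding U_def by (rule supported_schwartz[OF supported_cell[OF V r_pos]])
lemma U_smooth: "smooth (U k)" by (rule schwartz_smooth[OF U_schwartz])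

lemma U_eq_0: "norm (\<eta> - \<xi> k) > r k * R \<Longrightarrow> U k \<eta> = 0"
  unfolding U_def by (rule cell_eq_0[OF V r_pos])

lemma U_cube: assumes "\<eta> \<notin> open_cube (\<xi> k) (r k * \<Lambda>)" shows "U k \<eta> = 0"
proof (rule U_eq_0)
  obtain i where "r k * \<Lambda> \<le> \<bar>\<eta> $ i - \<xi> k $ i\<bar>" using assms by (auto simp: open_cube_def not_less)
  also have "\<dots> \<le> norm (\<eta> - \<xi> k)" using component_le_norm_cart[of "\<eta> - \<xi> k" i] by simp
  finally show "r k * R < norm (\<eta> - \<xi> k)" using R r_pos[of k] by (smt (verit) mult_strict_left_mono)
qed

definition cutoff :: "real \<Rightarrow> real^'n \<Rightarrow> complex" where
  "cutoff K = cell K 0 (\<lambda>\<eta>. complex_of_real (bump 1 2 \<eta>))"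

text \<open>The sample of the frequency truncation of \<open>f\<close>, taken without forming the truncated distribution.\<close>

abbreviation low :: "((real^'n \<Rightarrow> complex) \<Rightarrow> complex) \<Rightarrow> real \<Rightarrow> nat \<Rightarrow> int^'n \<Rightarrow> complex" where
  "low f K k j \<equiv> band_value f (\<lambda>\<eta>. cutoff K \<eta> * U k \<eta>) (node k j)"

lemma bump_supported: "0 \<le> A \<Longrightarrow> A < B \<Longrightarrow> supported B (\<lambda>\<eta>. complex_of_real (bump A B \<eta>))"
  by (auto simp: supported_def smooth_bump bump_0)

lemma cutoff_supported: "K > 0 \<Longrightarrow> supported (K * 2) (cutoff K)"
  unfolding cutoff_def using supported_cell[OF bump_supported[of 1 2], of K 0] by simp

lemma cutoff_schwartz: "K > 0 \<Longrightarrow> cutoff K \<in> schwartz"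
  by (rule supported_schwartz[OF cutoff_supported])

lemma cutoff_1: "K > 0 \<Longrightarrow> norm \<eta> \<le> K \<Longrightarrow> cutoff K \<eta> = 1"
  by (simp add: cutoff_def cell_def bump_1 divide_le_eq_1)

lemma cutoff_0: "K > 0 \<Longrightarrow> norm \<eta> > 2 * K \<Longrightarrow> cutoff K \<eta> = 0"
  using cutoff_supported[of K] by (simp add: supported_def mult.commute)

text \<open>Let \<open>\<chi>\<close> be a bump that equals \<open>1\<close> on the support of the window and fits into the
cube; it exists because \<open>R < \<Lambda>\<close>. Truncating the \<open>l\<close>-th cell is the same as applying the multiplier
\<open>cutoff K\<close> times the rescaled \<open>\<chi>\<close>, hence a discrete convolution on the nodes of this cell
alone. Its kernel is summable uniformly in \<open>K\<close> and \<open>l\<close>, and the Schur test applies.\<close>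

lemma truncation_error:
  obtains A where "A \<ge> 0" and "\<And>K f P l b I. K > 0 \<Longrightarrow> f \<in> tempered \<Longrightarrow> P \<ge> 1 \<Longrightarrow> b \<ge> 0 \<Longrightarrow>
    (\<And>J. finite J \<Longrightarrow> (\<Sum>j\<in>J. norm (val f l j) powr P) \<le> b powr P) \<Longrightarrow> finite I \<Longrightarrow>
    (\<Sum>i\<in>I. norm (val f l i - low f K l i) powr P) \<le> (A * b) powr P"
proof -
  let ?\<chi> = "\<lambda>\<eta>::real^'n. complex_of_real (bump R \<Lambda> \<eta>)"
  have chi: "supported \<Lambda> ?\<chi>" using R by (intro bump_supported) auto
  let ?\<theta> = "\<lambda>\<eta>::real^'n. complex_of_real (bump 1 2 \<eta>)"
  have theta: "?\<theta> \<in> schwartz" by (rule supported_schwartz[OF bump_supported]) auto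
  obtain P0 where P0: "P0 \<ge> 0" "\<And>\<Theta> r \<xi> z J. \<Theta> \<in> schwartz \<Longrightarrow> r > 0 \<Longrightarrow> finite J \<Longrightarrow>
    (\<Sum>j\<in>J. norm (fourier (\<lambda>\<eta>. \<Theta> \<eta> * cell r \<xi> ?\<chi> \<eta>) (dual_node (r * \<Lambda>) j + z))) \<le> fourier_mass \<Theta>
        * (r ^ CARD('n) * P0)"
    by (rule cell_node_sum[OF chi Lambda_pos]) blast
  define A where "A = fourier_mass ?\<theta> * P0 / (2 * \<Lambda>) ^ CARD('n)"
  have A: "A \<ge> 0" unfolding A_def using P0(1) fourier_mass_nonneg Lambda_pos
      by (intro divide_nonneg_nonneg mult_nonneg_nonneg) auto
  show ?thesis
  proof (rule that[of "1 + A"])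
    show "1 + A \<ge> 0" using A by simp
    fix K :: real and f :: "(real^'n \<Rightarrow> complex) \<Rightarrow> complex" and P b :: real and l and I :: "(int^'n) set"
    assume K: "K > 0" and f: "f \<in> tempered" and P: "P \<ge> 1" and b: "b \<ge> 0" and I: "finite I"
      and fb: "\<And>J. finite J \<Longrightarrow> (\<Sum>j\<in>J. norm (val f l j) powr P) \<le> b powr P"
    define G where "G \<eta> = cutoff K \<eta> * cell (r l) (\<xi> l) ?\<chi> \<eta>" for \<eta>
    let ?K = "complex_of_real ((2 * (r l * \<Lambda>)) ^ CARD('n))"
    define k0 where "k0 z = fourier G z / ?K" for z
    have Gs: "G \<in> schwartz" unfolding G_def
      by (intro schwartz_mult cutoff_schwartz K supported_schwartz[OF supported_cell[OF chi r_pos]])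
    have Kn: "norm ?K = (2 * (r l * \<Lambda>)) ^ CARD('n)" unfolding norm_of_real
      using rL_pos[of l] by (intro abs_of_nonneg zero_le_power) simp
    have k0: "(\<Sum>j\<in>J. norm (k0 (node l j + z))) \<le> A" if "finite J" for J z
    proof -
      have "(\<Sum>j\<in>J. norm (fourier G (node l j + z))) \<le> fourier_mass ?\<theta> * (r l ^ CARD('n) * P0)"
        using P0(2)[OF cutoff_schwartz[OF K] r_pos that, where \<xi>="\<xi> l" and z=z]
        unfolding G_def node_def cutoff_def fourier_mass_cell[OF theta K] .
      then have "(\<Sum>j\<in>J. norm (fourier G (node l j + z))) / norm ?K \<le> fourier_mass ?\<theta> * (r l ^ CARD('n)
          * P0) / norm ?K"
        by (rule divide_right_mono) simp
      also have "\<dots> = A" unfolding Kn A_def using r_pos[of l] by (simp add: power_mult_distrib)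
      finally show ?thesis unfolding k0_def norm_divide sum_divide_distrib .
    qed
    have samp: "((\<lambda>j. k0 (node l j - x) * val f l j) has_sum band_value f (\<lambda>\<eta>. cutoff K \<eta>
        * U l \<eta>) x) UNIV" for x
    proof -
      have "((\<lambda>j. fourier G (dual_node (r l * \<Lambda>) j - x) / ?K * band_value f (U l) (dual_node (r l
          * \<Lambda>) j)) has_sum band_value f (\<lambda>\<eta>. G \<eta> * U l \<eta>) x) UNIV"
      proof (rule sampling[OF f rL_pos Gs U_schwartz _ U_cube])
        fix \<eta> assume "\<eta> \<notin> open_cube (\<xi> l) (r l * \<Lambda>)"
        then obtain i where "r l * \<Lambda> \<le> \<bar>\<eta> $ i - \<xi> l $ i\<bar>" by (auto simp: open_cube_def not_less)
        also have "\<dots> \<le> norm (\<eta> - \<xi> l)" using component_le_norm_cart[of "\<eta> - \<xi> l" i] by simp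
        finally have "\<Lambda> \<le> norm ((1 / r l) *\<^sub>R (\<eta> - \<xi> l))" using r_pos[of l]
            by (simp add: pos_le_divide_eq mult.commute)
        then show "G \<eta> = 0" using Lambda_pos by (simp add: G_def cell_def bump_0)
      qed auto
      moreover have "G \<eta> * U l \<eta> = cutoff K \<eta> * U l \<eta>" for \<eta>
      proof (cases "norm (\<eta> - \<xi> l) > r l * R")
        case True then show ?thesis by (simp add: U_eq_0)
      next
        case False
        then have "norm ((1 / r l) *\<^sub>R (\<eta> - \<xi> l)) \<le> R" using r_pos[of l]
            by (simp add: pos_divide_le_eq mult.commute)
        then show ?thesis using R by (simp add: G_def cell_def bump_1)
      qed
      ultimately show ?thesis unfolding k0_def node_def by simp
    qed
    define \<kappa> where "\<kappa> i j = (if j = i then 1 else 0) - k0 (node l j - node l i)" for i j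
    show "(\<Sum>i\<in>I. norm (val f l i - low f K l i) powr P) \<le> ((1 + A) * b) powr P"
    proof (rule schur_test[OF P _ b, where v="\<lambda>j. val f l j" and \<kappa>=\<kappa>])
      show "1 + A \<ge> 0" using A by simp
      have single: "(\<Sum>j\<in>J. norm (if j = i then 1 else 0 :: complex)) \<le> 1" if "finite J" for J and i :: "int^'n"
      proof -
        have "(\<Sum>j\<in>J. norm (if j = i then 1 else 0 :: complex)) = (if i \<in> J then 1 else 0)"
          using that by (simp add: if_distrib[of norm] cong: if_cong)
        then show ?thesis by simp
      qed
      show "(\<Sum>j\<in>J. norm (\<kappa> i j)) \<le> 1 + A" if J: "finite J" for i J
      proof -
        have "(\<Sum>j\<in>J. norm (\<kappa> i j)) \<le> (\<Sum>j\<in>J. norm (if j = i then 1 else 0 :: complex))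
            + (\<Sum>j\<in>J. norm (k0 (node l j + - node l i)))"
          unfolding sum.distrib[symmetric]
          by (intro sum_mono) (simp only: \<kappa>_def norm_triangle_ineq4 add_uminus_conv_diff)
        then show ?thesis using single[OF J, of i] k0[OF J, of "- node l i"] by linarith
      qed
      show "(\<Sum>i\<in>J. norm (\<kappa> i j)) \<le> 1 + A" if J: "finite J" for j J
      proof -
        have "(\<Sum>i\<in>J. norm (\<kappa> i j)) \<le> (\<Sum>i\<in>J. norm (if i = j then 1 else 0 :: complex))
            + (\<Sum>i\<in>J. norm (k0 (node l j - node l i)))"
          unfolding sum.distrib[symmetric]
          by (intro sum_mono) (simp only: \<kappa>_def norm_triangle_ineq4 eq_commute[of _ j])
        moreover have "(\<Sum>i\<in>J. norm (k0 (node l j - node l i))) \<le> A"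
          using dual_node_sum_reflect[of k0 "r l * \<Lambda>" "node l j" A J] k0 J by (simp add: node_def)
        ultimately show ?thesis using single[OF J, of j] by linarith
      qed
      fix i
      have "((\<lambda>j. if j = i then val f l i else 0) has_sum val f l i) UNIV"
        by (rule has_sum_finite_neutralI[where B="{i}"]) auto
      from has_sum_diff[OF this samp[of "node l i"]]
      show "((\<lambda>j. \<kappa> i j * val f l j) has_sum val f l i - low f K l i) UNIV"
        by (rule has_sum_cong[THEN iffD1, rotated]) (auto simp: \<kappa>_def left_diff_distrib)
    qed (use fb I in auto)
  qed
qed

text \<open>A cell that meets a fixed ball has \<open>|\<xi>| \<le> 2 K + R |\<xi>|\<^sup>1\<^sup>-\<^sup>\<alpha>\<close>, which bounds \<open>|\<xi>|\<close> because
\<open>\<alpha> > 0\<close>.\<close>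

lemma finite_touching: assumes "K > 0" shows "finite {l. \<exists>\<eta>. cutoff K \<eta> * U l \<eta> \<noteq> 0}"
proof (rule finite_subset[OF _ finite_xi])
  show "{l. \<exists>\<eta>. cutoff K \<eta> * U l \<eta> \<noteq> 0} \<subseteq> {l. norm (\<xi> l) \<le> max (4 * K) ((2 * R) powr (1 / \<alpha>))}"
  proof safe
    fix l \<eta> assume nz: "cutoff K \<eta> * U l \<eta> \<noteq> 0"
    then have 1: "norm \<eta> \<le> 2 * K" using cutoff_0[OF assms, of \<eta>] by (cases "norm \<eta> \<le> 2 * K") auto
    have 2: "norm (\<eta> - \<xi> l) \<le> r l * R" using nz U_eq_0[of l \<eta>] by (cases "norm (\<eta> - \<xi> l) \<le> r l * R") auto
    have le: "norm (\<xi> l) \<le> 2 * K + r l * R"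
      using norm_triangle_ineq2[of "\<xi> l" \<eta>] 1 2 by (simp add: norm_minus_commute)
    show "norm (\<xi> l) \<le> max (4 * K) ((2 * R) powr (1 / \<alpha>))"
    proof (cases "norm (\<xi> l) \<le> (2 * R) powr (1 / \<alpha>)")
      case False
      then have "((2 * R) powr (1 / \<alpha>)) powr \<alpha> \<le> norm (\<xi> l) powr \<alpha>"
        using alpha by (intro powr_mono2) auto
      then have "2 * R \<le> norm (\<xi> l) powr \<alpha>" using alpha R by (simp add: powr_powr)
      then have "r l * (2 * R) \<le> r l * norm (\<xi> l) powr \<alpha>" using r_pos[of l] by (intro mult_left_mono) auto
      also have "\<dots> = norm (\<xi> l)" using xi_pos[of l] unfolding r_def powr_add[symmetric] by simp
      finally show ?thesis using le by simp
    qed simp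
  qed
qed

text \<open>Finitely many cells cover the support of the cutoff. Dividing by \<open>\<Phi>\<close>, the sum of their
squares, writes each truncated cell as \<open>\<Sum>\<^sub>k h\<^sub>k U\<^sub>l U\<^sub>k\<close>, and sampling expands the truncated sample into a
series over the coefficients of \<open>f\<close> in these cells. Keeping finitely many coefficients is the same
as replacing \<open>f\<close> by the Schwartz function \<open>g\<close>. The omitted part is a bounded matrix applied to
tails of \<open>\<ell>\<^sup>P\<close> sequences. Finitely many pairs of cells interact, so a common bound for the
matrices exists.\<close>

lemma finite_approximation:
  assumes K: "K > 0" and f: "f \<in> tempered" and P: "P \<ge> 1" and \<epsilon>: "\<epsilon> > 0"
    and b: "\<And>l J. finite J \<Longrightarrow> (\<Sum>j\<in>J. norm (val f l j) powr P) \<le> b l powr P"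
  obtains g where "g \<in> schwartz"
    "\<And>l I. finite I \<Longrightarrow> (\<Sum>i\<in>I. norm (low f K l i - val (distr_of g) l i) powr P)
      \<le> (if \<exists>\<eta>. cutoff K \<eta> * U l \<eta> \<noteq> 0 then \<epsilon> else 0) powr P"
proof -
  let ?L = "{l. \<exists>\<eta>. cutoff K \<eta> * U l \<eta> \<noteq> 0}"
  obtain F where F: "finite F" "\<And>\<eta>. norm \<eta> \<le> 3 * K \<Longrightarrow> \<exists>k\<in>F. U k \<eta> \<noteq> 0"
  proof -
    have op: "open {\<eta>. U k \<eta> \<noteq> 0}" for k
      by (intro open_Collect_neq smooth_continuous_on U_smooth continuous_on_const)
    have cov: "cball 0 (3 * K) \<subseteq> (\<Union>k\<in>UNIV. {\<eta>. U k \<eta> \<noteq> 0})" using cover by (auto simp: U_def r_def)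
    obtain F where "finite F" "cball 0 (3 * K) \<subseteq> (\<Union>k\<in>F. {\<eta>. U k \<eta> \<noteq> 0})"
      by (rule compactE_image[OF compact_cball _ cov]) (use op in auto)
    then show ?thesis by (intro that[of F]) (auto simp: subset_eq)
  qed
  \<comment> \<open>equals \<open>1\<close> on the support of the cutoff and vanishes outside the region covered by \<open>F\<close>, so that \<open>\<Phi>\<close> is positive everywhere\<close>
  define \<theta>2 where "\<theta>2 = cell K 0 (\<lambda>\<eta>::real^'n. complex_of_real (bump 2 3 \<eta>))"
  have "supported (K * 3 + norm (0 :: real^'n)) \<theta>2"
    unfolding \<theta>2_def by (rule supported_cell[OF bump_supported K]) auto
  then have s2: "smooth \<theta>2" by (simp add: supported_def)
  define \<Phi> where "\<Phi> \<eta> = (\<Sum>k\<in>F. U k \<eta> * cnj (U k \<eta>)) + (1 + (-1) * \<theta>2 \<eta>)" for \<eta>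
  have \<Phi>s: "smooth \<Phi>" unfolding \<Phi>_def
    by (intro smooth_add smooth_sum smooth_mult smooth_cnj smooth_const U_smooth s2)
  have \<Phi>nz: "\<Phi> \<eta> \<noteq> 0" for \<eta>
  proof -
    have e: "\<Phi> \<eta> = complex_of_real ((\<Sum>k\<in>F. (norm (U k \<eta>))\<^sup>2) + (1 - bump 2 3 ((1 / K) *\<^sub>R \<eta>)))"
      unfolding \<Phi>_def \<theta>2_def cell_def complex_norm_square[symmetric] by simp
    have "(\<Sum>k\<in>F. (norm (U k \<eta>))\<^sup>2) + (1 - bump 2 3 ((1 / K) *\<^sub>R \<eta>)) > 0"
    proof (cases "norm \<eta> \<le> 3 * K")
      case True
      then obtain k where k: "k \<in> F" "U k \<eta> \<noteq> 0" using F(2) by blast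
      have "0 < (\<Sum>k\<in>F. (norm (U k \<eta>))\<^sup>2)" using F(1) k by (intro sum_pos2[of F k]) auto
      then show ?thesis using bump_range(2)[of 2 3 "(1 / K) *\<^sub>R \<eta>"] by linarith
    next
      case False
      then have "bump 2 3 ((1 / K) *\<^sub>R \<eta>) = 0" using K by (intro bump_0) (auto simp: pos_le_divide_eq)
      moreover have "0 \<le> (\<Sum>k\<in>F. (norm (U k \<eta>))\<^sup>2)" by (intro sum_nonneg) auto
      ultimately show ?thesis by linarith
    qed
    then show ?thesis unfolding e of_real_eq_0_iff by linarith
  qed
  define h where "h k \<eta> = cutoff K \<eta> * (cnj (U k \<eta>) * inverse (\<Phi> \<eta>))" for k \<eta>
  have hs: "h k \<in> schwartz" for k
  proof -
    have "supported (K * 2) (h k)" unfolding h_def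
      by (intro supported_mult cutoff_supported K smooth_mult smooth_cnj U_smooth smooth_inverse \<Phi>s \<Phi>nz)
    then show ?thesis by (rule supported_schwartz)
  qed
  define G where "G k l \<eta> = h k \<eta> * U l \<eta>" for k l \<eta>
  have Gs: "G k l \<in> schwartz" for k l unfolding G_def by (intro schwartz_mult hs U_schwartz)
  have G0: "G k l \<eta> = 0" if "l \<notin> ?L" for k l \<eta>
  proof -
    have "cutoff K \<eta> * U l \<eta> = 0" using that by blast
    then show ?thesis by (auto simp: G_def h_def)
  qed
  have part: "cutoff K \<eta> * U l \<eta> = (\<Sum>k\<in>F. G k l \<eta> * U k \<eta>)" for l \<eta>
  proof (cases "cutoff K \<eta> = 0")
    case True then show ?thesis by (simp add: G_def h_def)
  next
    case False
    then have "norm \<eta> \<le> 2 * K" using cutoff_0[OF K, of \<eta>] by (cases "norm \<eta> \<le> 2 * K") auto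
    then have "\<theta>2 \<eta> = 1" using K by (simp add: \<theta>2_def cell_def bump_1 pos_divide_le_eq)
    then have "(\<Sum>k\<in>F. U k \<eta> * cnj (U k \<eta>)) = \<Phi> \<eta>" by (simp add: \<Phi>_def)
    moreover have "(\<Sum>k\<in>F. G k l \<eta> * U k \<eta>) = (cutoff K \<eta> * U l \<eta>) * inverse (\<Phi> \<eta>) * (\<Sum>k\<in>F. U k \<eta> * cnj (U k \<eta>))"
      unfolding sum_distrib_left G_def h_def by (intro sum.cong refl) (simp only: mult_ac)
    ultimately show ?thesis using \<Phi>nz[of \<eta>] by simp
  qed
  define Kc where "Kc k = complex_of_real ((2 * (r k * \<Lambda>)) ^ CARD('n))" for k
  define \<kappa> where "\<kappa> k l i j = fourier (G k l) (node k j - node l i) / Kc k" for k l i j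
  have samp: "((\<lambda>j. \<kappa> k l i j * val f k j) has_sum band_value f (\<lambda>\<eta>. G k l \<eta> * U k \<eta>) (node l i)) UNIV"
      for k l i
    unfolding \<kappa>_def Kc_def node_def
    by (rule sampling[OF f rL_pos Gs U_schwartz _ U_cube]) (auto simp: G_def h_def U_cube)
  have "\<exists>A. A \<ge> 0 \<and> (\<forall>i J. finite J \<longrightarrow> (\<Sum>j\<in>J. norm (\<kappa> k l i j)) \<le> A) \<and> (\<forall>j I. finite I
      \<longrightarrow> (\<Sum>i\<in>I. norm (\<kappa> k l i j)) \<le> A)" for k l
  proof -
    obtain P1 where P1: "P1 \<ge> 0" "\<And>x J. finite J \<Longrightarrow> (\<Sum>j\<in>J. norm (fourier (G k l) (dual_node (r k * \<Lambda>) j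
        + x))) \<le> P1"
      by (rule dual_node_sum[OF fourier_rapid[OF Gs] rL_pos]) blast
    obtain P2 where P2: "P2 \<ge> 0" "\<And>x J. finite J \<Longrightarrow> (\<Sum>j\<in>J. norm (fourier (G k l) (dual_node (r l * \<Lambda>) j
        + x))) \<le> P2"
      by (rule dual_node_sum[OF fourier_rapid[OF Gs] rL_pos]) blast
    let ?A = "max P1 P2 / norm (Kc k)"
    show ?thesis
    proof (intro exI[of _ ?A] conjI allI impI)
      show "?A \<ge> 0" using P1 by (intro divide_nonneg_nonneg) auto
      show "(\<Sum>j\<in>J. norm (\<kappa> k l i j)) \<le> ?A" if "finite J" for i J
        unfolding \<kappa>_def norm_divide sum_divide_distrib[symmetric]
        using P1(2)[OF that, of "- node l i"] by (intro divide_right_mono) (auto simp: node_def)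
      show "(\<Sum>i\<in>I. norm (\<kappa> k l i j)) \<le> ?A" if "finite I" for j I
        unfolding \<kappa>_def norm_divide sum_divide_distrib[symmetric]
        using dual_node_sum_reflect[of "fourier (G k l)" "r l * \<Lambda>" "node k j" P2 I] P2(2) that
        by (intro divide_right_mono) (auto simp: node_def)
    qed
  qed
  then have "\<forall>kl. \<exists>A. A \<ge> 0 \<and> (\<forall>i J. finite J \<longrightarrow> (\<Sum>j\<in>J. norm (\<kappa> (fst kl) (snd kl) i j)) \<le> A)
      \<and> (\<forall>j I. finite I \<longrightarrow> (\<Sum>i\<in>I. norm (\<kappa> (fst kl) (snd kl) i j)) \<le> A)"
    by blast
  from choice[OF this] obtain A0 where A0: "\<And>k l. A0 (k, l) \<ge> 0"
    "\<And>k l i J. finite J \<Longrightarrow> (\<Sum>j\<in>J. norm (\<kappa> k l i j)) \<le> A0 (k, l)"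
    "\<And>k l j I. finite I \<Longrightarrow> (\<Sum>i\<in>I. norm (\<kappa> k l i j)) \<le> A0 (k, l)"
    by (metis fst_conv snd_conv)
  define A where "A = (\<Sum>kl\<in>F \<times> ?L. A0 kl)"
  have Lfin: "finite ?L" by (rule finite_touching[OF K])
  have A: "A0 (k, l) \<le> A" if "k \<in> F" "l \<in> ?L" for k l
    unfolding A_def using that F(1) Lfin A0(1) by (intro member_le_sum) auto
  have Ann: "A \<ge> 0" unfolding A_def using A0(1) by (intro sum_nonneg) auto
  define n where "n = real (card F)"
  \<comment> \<open>the \<open>n\<close> cells contribute at most \<open>A \<tau>\<close> each; the summand \<open>1\<close> covers \<open>n A = 0\<close>\<close>
  define \<tau> where "\<tau> = \<epsilon> / (n * A + 1)"
  have nA: "n * A \<ge> 0" using Ann by (simp add: n_def)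
  have \<tau>: "\<tau> > 0" unfolding \<tau>_def using \<epsilon> nA by (intro divide_pos_pos) auto
  have \<tau>\<epsilon>: "n * (A * \<tau>) \<le> \<epsilon>"
  proof -
    have "n * (A * \<tau>) \<le> (n * A + 1) * \<tau>" using \<tau> by (simp add: distrib_right mult.assoc)
    then show ?thesis unfolding \<tau>_def using nA by simp
  qed
  have "\<exists>J0. finite J0 \<and> (\<forall>J. finite J \<longrightarrow> J \<inter> J0 = {} \<longrightarrow> (\<Sum>j\<in>J. norm (val f k j) powr P) \<le> \<tau> powr P)" for k
    by (rule small_tail[of "\<lambda>j. norm (val f k j) powr P" "b k powr P" "\<tau> powr P"])
      (use b \<tau> in auto)
  then have "\<forall>k. \<exists>J0. finite J0 \<and> (\<forall>J. finite J \<longrightarrow> J \<inter> J0 = {} \<longrightarrow> (\<Sum>j\<in>J. norm (val f k j) powr P) \<le> \<tau> powr P)"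
    by blast
  from choice[OF this] obtain J0 where J0: "\<And>k. finite (J0 k)"
    "\<And>k J. finite J \<Longrightarrow> J \<inter> J0 k = {} \<Longrightarrow> (\<Sum>j\<in>J. norm (val f k j) powr P) \<le> \<tau> powr P"
    by blast
  define \<Gamma> where "\<Gamma> \<eta> = (\<Sum>k\<in>F. \<Sum>j\<in>J0 k. (val f k j / Kc k) * (h k \<eta> * cis (\<eta> \<bullet> (- node k j))))" for \<eta>
  have \<Gamma>s: "\<Gamma> \<in> schwartz" unfolding \<Gamma>_def
    by (intro schwartz_sum schwartz_cmult schwartz_modulate hs)
  obtain g where g: "g \<in> schwartz" "fourier g = \<Gamma>" by (rule fourier_surj[OF \<Gamma>s])
  have bg: "val (distr_of g) l i = (\<Sum>k\<in>F. \<Sum>j\<in>J0 k. \<kappa> k l i j * val f k j)" for l i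
  proof -
    have i: "integrable lborel (\<lambda>\<eta>. (val f k j / Kc k) * (G k l \<eta> * cis (\<eta> \<bullet> (- node k j)) * cis (- (\<eta> \<bullet>
        - node l i))))" for k j
      by (intro integrable_mult_right integrable_cis_neg schwartz_integrable schwartz_modulate Gs)
    have "val (distr_of g) l i = fourier (\<lambda>\<eta>. \<Gamma> \<eta> * U l \<eta>) (- node l i)"
      unfolding band_value_distr_of[OF g(1) U_schwartz] g(2) ..
    also have "\<dots> = (LINT \<eta>|lborel. (\<Sum>k\<in>F. \<Sum>j\<in>J0 k. (val f k j / Kc k) * (G k l \<eta>
        * cis (\<eta> \<bullet> (- node k j)) * cis (- (\<eta> \<bullet> - node l i)))))"
      unfolding fourier_def \<Gamma>_def sum_distrib_right G_def
      by (intro Bochner_Integration.integral_cong sum.cong refl) (simp only: mult_ac)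
    also have "\<dots> = (\<Sum>k\<in>F. \<Sum>j\<in>J0 k. (LINT \<eta>|lborel. (val f k j / Kc k) * (G k l \<eta>
        * cis (\<eta> \<bullet> (- node k j)) * cis (- (\<eta> \<bullet> - node l i)))))"
      using i by (subst Bochner_Integration.integral_sum; (subst Bochner_Integration.integral_sum)?; auto)
    also have "\<dots> = (\<Sum>k\<in>F. \<Sum>j\<in>J0 k. \<kappa> k l i j * val f k j)"
    proof (intro sum.cong refl)
      fix k j
      have "(LINT \<eta>|lborel. (val f k j / Kc k) * (G k l \<eta> * cis (\<eta> \<bullet> (- node k j)) * cis (- (\<eta> \<bullet>
          - node l i)))) =
          val f k j / Kc k * fourier (\<lambda>\<eta>. G k l \<eta> * cis (\<eta> \<bullet> (- node k j))) (- node l i)"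
        unfolding integral_mult_right_zero fourier_def ..
      also have "fourier (\<lambda>\<eta>. G k l \<eta> * cis (\<eta> \<bullet> (- node k j))) (- node l i) = fourier (G k l) (node k j
          - node l i)"
        unfolding fourier_shift by simp
      finally show "(LINT \<eta>|lborel. (val f k j / Kc k) * (G k l \<eta> * cis (\<eta> \<bullet> (- node k j)) * cis (- (\<eta> \<bullet>
          - node l i)))) =
          \<kappa> k l i j * val f k j"
        by (simp add: \<kappa>_def)
    qed
    finally show ?thesis .
  qed
  define D where "D k l i = band_value f (\<lambda>\<eta>. G k l \<eta> * U k \<eta>) (node l i) - (\<Sum>j\<in>J0 k. \<kappa> k l i j
      * val f k j)" for k l i
  have err: "low f K l i - val (distr_of g) l i = (\<Sum>k\<in>F. D k l i)" for l i
  proof -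
    have "low f K l i = (\<Sum>k\<in>F. band_value f (\<lambda>\<eta>. G k l \<eta> * U k \<eta>) (node l i))"
      unfolding part by (rule band_value_sum[OF f]) (intro schwartz_mult Gs U_schwartz)
    then show ?thesis unfolding bg D_def sum_subtractf by simp
  qed
  have Dsum: "((\<lambda>j. \<kappa> k l i j * (if j \<in> J0 k then 0 else val f k j)) has_sum D k l i) UNIV" for k l i
  proof -
    have "((\<lambda>j. if j \<in> J0 k then \<kappa> k l i j * val f k j else 0) has_sum (\<Sum>j\<in>J0 k. \<kappa> k l i j * val f k j)) UNIV"
      by (rule has_sum_finite_neutralI[where B="J0 k"]) (auto simp: J0(1))
    from has_sum_diff[OF samp this]
    show ?thesis unfolding D_def by (rule has_sum_cong[THEN iffD1, rotated]) auto
  qed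
  have Dbound: "(\<Sum>i\<in>I. norm (D k l i) powr P) \<le> (A * \<tau>) powr P" if k: "k \<in> F" and l: "l \<in> ?L"
      and I: "finite I" for k l I
  proof (rule schur_test[OF P Ann, where \<kappa>="\<kappa> k l" and v="\<lambda>j. if j \<in> J0 k then 0 else val f k j"])
    show "\<tau> \<ge> 0" using \<tau> by simp
    show "(\<Sum>j\<in>J. norm (\<kappa> k l i j)) \<le> A" if "finite J" for i J
      using A0(2)[OF that] A[OF k l] by (rule order_trans)
    show "(\<Sum>i\<in>J. norm (\<kappa> k l i j)) \<le> A" if "finite J" for j J
      using A0(3)[OF that] A[OF k l] by (rule order_trans)
    fix J :: "(int^'n) set" assume J: "finite J"
    have "(\<Sum>j\<in>J. norm (if j \<in> J0 k then 0 else val f k j) powr P) = (\<Sum>j\<in>J - J0 k. norm (val f k j) powr P)"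
      using J by (intro sum.mono_neutral_cong_right) auto
    also have "\<dots> \<le> \<tau> powr P" using J by (intro J0(2)) auto
    finally show "(\<Sum>j\<in>J. norm (if j \<in> J0 k then 0 else val f k j) powr P) \<le> \<tau> powr P" .
  qed (use Dsum I in auto)
  show ?thesis
  proof (rule that[OF g(1)])
    fix l and I :: "(int^'n) set" assume I: "finite I"
    show "(\<Sum>i\<in>I. norm (low f K l i - val (distr_of g) l i) powr P)
      \<le> (if \<exists>\<eta>. cutoff K \<eta> * U l \<eta> \<noteq> 0 then \<epsilon> else 0) powr P"
    proof (cases "l \<in> ?L")
      case False
      have z: "fourier (\<lambda>\<eta>::real^'n. 0) = (\<lambda>_. 0)" by (simp add: fourier_def fun_eq_iff)
      have "\<kappa> k l i j = 0" for k i j using G0[OF False] z by (simp add: \<kappa>_def fun_eq_iff[of "G k l" "\<lambda>_.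
          0"] ext[of "G k l" "\<lambda>_. 0"])
      then have "D k l i = 0" for k i
        using Dsum[of k l i] has_sum_unique[OF Dsum[of k l i], of 0] by simp
      then show ?thesis unfolding err using False P by simp
    next
      case True
      have "(\<Sum>i\<in>I. norm (\<Sum>k\<in>F. D k l i) powr P) \<le> (\<Sum>i\<in>I. n powr (P - 1) * (\<Sum>k\<in>F. norm (D k l i) powr P))"
      proof (rule sum_mono)
        fix i
        have "norm (\<Sum>k\<in>F. D k l i) powr P \<le> (\<Sum>k\<in>F. norm (D k l i)) powr P"
          using P by (intro powr_mono2 norm_sum) auto
        also have "\<dots> \<le> n powr (P - 1) * (\<Sum>k\<in>F. norm (D k l i) powr P)"
          unfolding n_def by (rule sum_power_le[OF F(1) _ P]) auto
        finally show "norm (\<Sum>k\<in>F. D k l i) powr P \<le> n powr (P - 1) * (\<Sum>k\<in>F. norm (D k l i) powr P)" .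
      qed
      also have "\<dots> = n powr (P - 1) * (\<Sum>k\<in>F. \<Sum>i\<in>I. norm (D k l i) powr P)"
        unfolding sum_distrib_left[symmetric] by (subst sum.swap) (rule refl)
      also have "\<dots> \<le> n powr (P - 1) * (\<Sum>k\<in>F. (A * \<tau>) powr P)"
        by (intro mult_left_mono sum_mono Dbound True I) auto
      also have "\<dots> = (n * (A * \<tau>)) powr P"
      proof (cases "n = 0")
        case False
        then have "n > 0" by (simp add: n_def)
        then have 1: "n powr (P - 1) * n = n powr P" by (simp add: powr_mult_base mult.commute)
        have 2: "(\<Sum>k\<in>F. (A * \<tau>) powr P) = n * (A * \<tau>) powr P" by (simp add: n_def)
        have "n powr (P - 1) * (n * (A * \<tau>) powr P) = n powr P * (A * \<tau>) powr P"
          unfolding mult.assoc[symmetric] 1 ..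
        also have "\<dots> = (n * (A * \<tau>)) powr P"
          by (subst powr_mult) (use \<open>n > 0\<close> Ann \<tau> in auto)
        finally show ?thesis unfolding 2 .
      qed (use P in simp)
      also have "\<dots> \<le> \<epsilon> powr P" using \<tau>\<epsilon> P \<tau> Ann by (intro powr_mono2) (auto simp: n_def)
      finally show ?thesis unfolding err using True by simp
    qed
  qed
qed

text \<open>Cells that dominate the norm are untouched by a sufficiently large cutoff; on the others the
truncation error is a fixed multiple of a small tail. Once the cutoff is fixed, finitely many
cells remain, and their total error is made small by the choice of \<open>\<epsilon>\<close>.\<close>

theorem schwartz_dense_values:
  assumes f: "f \<in> tempered" and P: "P \<ge> 1" and Q: "Q \<ge> 1" and e: "e > 0"
    and b: "\<And>l. b l \<ge> 0" and w: "\<And>l. w l > 0"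
    and inner: "\<And>l J. finite J \<Longrightarrow> (\<Sum>j\<in>J. norm (val f l j) powr P) \<le> b l powr P"
    and outer: "\<And>I. finite I \<Longrightarrow> (\<Sum>l\<in>I. (b l * w l) powr Q) \<le> T"
  obtains g E where "g \<in> schwartz" "\<And>l. E l \<ge> 0"
    "\<And>l J. finite J \<Longrightarrow> (\<Sum>j\<in>J. norm (val f l j - val (distr_of g) l j) powr P) \<le> E l powr P"
    "\<And>I. finite I \<Longrightarrow> (\<Sum>l\<in>I. (E l * w l) powr Q) \<le> e"
proof -
  obtain A where A: "A \<ge> 0" and trunc: "\<And>K f P l b I. K > 0 \<Longrightarrow> f \<in> tempered \<Longrightarrow> P \<ge> 1 \<Longrightarrow> b \<ge> 0 \<Longrightarrow>
    (\<And>J. finite J \<Longrightarrow> (\<Sum>j\<in>J. norm (val f l j) powr P) \<le> b powr P) \<Longrightarrow> finite I \<Longrightarrow>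
    (\<Sum>i\<in>I. norm (val f l i - low f K l i) powr P) \<le> (A * b) powr P"
    by (rule truncation_error) blast
  \<comment> \<open>half of \<open>e\<close>, divided by the constants of the quasi-triangle inequality and of the truncation bound\<close>
  define e1 where "e1 = e / (2 * 4 powr Q * (A + 1) powr Q)"
  have e1: "e1 > 0" unfolding e1_def using e A by (intro divide_pos_pos mult_pos_pos) auto
  obtain I0 where I0: "finite I0" "\<And>I. finite I \<Longrightarrow> I \<inter> I0 = {} \<Longrightarrow> (\<Sum>l\<in>I. (b l * w l) powr Q) \<le> e1"
    by (rule small_tail[of "\<lambda>l. (b l * w l) powr Q" T e1]) (use outer e1 in auto)
  define K where "K = 1 + (\<Sum>l\<in>I0. norm (\<xi> l) + r l * R)"
  have K0: "K > 0" unfolding K_def using r_pos R by (intro add_pos_nonneg sum_nonneg) (auto simp: less_imp_le)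
  have I0K: "cutoff K \<eta> * U l \<eta> = U l \<eta>" if "l \<in> I0" for l \<eta>
  proof (cases "norm (\<eta> - \<xi> l) > r l * R")
    case True then show ?thesis by (simp add: U_eq_0)
  next
    case False
    have "norm (\<xi> l) + r l * R \<le> (\<Sum>l\<in>I0. norm (\<xi> l) + r l * R)"
      using that I0(1) r_pos R by (intro member_le_sum) (auto simp: less_imp_le)
    moreover have "norm \<eta> \<le> norm (\<eta> - \<xi> l) + norm (\<xi> l)"
      using norm_triangle_ineq[of "\<eta> - \<xi> l" "\<xi> l"] by simp
    ultimately have "norm \<eta> \<le> K" using False by (simp add: K_def)
    then show ?thesis using cutoff_1[OF K0] by simp
  qed
  let ?L = "{l. \<exists>\<eta>. cutoff K \<eta> * U l \<eta> \<noteq> 0}"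
  have Lfin: "finite ?L" by (rule finite_touching[OF K0])
  define W where "W = (\<Sum>l\<in>?L. w l powr Q)"
  have W: "W \<ge> 0" unfolding W_def by (intro sum_nonneg) auto
  define e2 where "e2 = e / (2 * 4 powr Q)"
  have e2: "e2 > 0" unfolding e2_def using e by (intro divide_pos_pos mult_pos_pos) auto
  \<comment> \<open>chosen so that \<open>\<epsilon>\<^sup>Q W \<le> e2\<close>\<close>
  define \<epsilon> where "\<epsilon> = (e2 / (1 + W)) powr (1 / Q)"
  have \<epsilon>: "\<epsilon> > 0" unfolding \<epsilon>_def using e2 W by simp
  have \<epsilon>Q: "\<epsilon> powr Q = e2 / (1 + W)" unfolding \<epsilon>_def using Q e2 W by (simp add: powr_powr)
  obtain g where g: "g \<in> schwartz" "\<And>l I. finite I \<Longrightarrow> (\<Sum>i\<in>I. norm (low f K l i - val (distr_of g) l i) powr P)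
      \<le> (if \<exists>\<eta>. cutoff K \<eta> * U l \<eta> \<noteq> 0 then \<epsilon> else 0) powr P"
    by (rule finite_approximation[OF K0 f P \<epsilon> inner]) auto
  define X where "X l = (if l \<in> I0 then 0 else A * b l)" for l
  define Y where "Y l = (if l \<in> ?L then \<epsilon> else 0)" for l
  have XY: "X l \<ge> 0" "Y l \<ge> 0" for l using A b \<epsilon> by (auto simp: X_def Y_def)
  show ?thesis
  proof (rule that[OF g(1), of "\<lambda>l. 2 * (X l + Y l)"])
    show "0 \<le> 2 * (X l + Y l)" for l using XY[of l] by simp
    fix l and J :: "(int^'n) set" assume J: "finite J"
    let ?u = "\<lambda>j. val f l j" and ?v = "\<lambda>j. low f K l j"
      and ?g = "\<lambda>j. val (distr_of g) l j"
    have s1: "(\<Sum>j\<in>J. norm (?u j - ?v j) powr P) \<le> X l powr P"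
    proof (cases "l \<in> I0")
      case True then show ?thesis using P by (simp add: X_def I0K)
    next
      case False then show ?thesis using trunc[OF K0 f P b inner J, of l] by (simp add: X_def)
    qed
    have s2: "(\<Sum>j\<in>J. norm (?v j - ?g j) powr P) \<le> Y l powr P"
      using g(2)[OF J, of l] by (simp add: Y_def)
    have "(\<Sum>j\<in>J. norm (?u j - ?g j) powr P) \<le> (\<Sum>j\<in>J. 2 powr P * (norm (?u j - ?v j) powr P + norm (?v j
        - ?g j) powr P))"
    proof (rule sum_mono)
      fix j
      have "norm (?u j - ?g j) \<le> norm (?u j - ?v j) + norm (?v j - ?g j)"
        using norm_triangle_ineq[of "?u j - ?v j" "?v j - ?g j"] by simp
      then have "norm (?u j - ?g j) powr P \<le> (norm (?u j - ?v j) + norm (?v j - ?g j)) powr P"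
        using P by (intro powr_mono2) auto
      also have "\<dots> \<le> 2 powr P * (norm (?u j - ?v j) powr P + norm (?v j - ?g j) powr P)"
        by (rule powr_add_le) (use P in auto)
      finally show "norm (?u j - ?g j) powr P \<le> 2 powr P * (norm (?u j - ?v j) powr P + norm (?v j
          - ?g j) powr P)" .
    qed
    also have "\<dots> = 2 powr P * ((\<Sum>j\<in>J. norm (?u j - ?v j) powr P) + (\<Sum>j\<in>J. norm (?v j - ?g j) powr P))"
      by (simp add: sum_distrib_left sum.distrib distrib_left)
    also have "\<dots> \<le> 2 powr P * (X l powr P + Y l powr P)" by (intro mult_left_mono add_mono s1 s2) auto
    also have "\<dots> \<le> 2 powr P * (X l + Y l) powr P" using P XY[of l]
        by (intro mult_left_mono powr_superadditive) auto
    also have "\<dots> = (2 * (X l + Y l)) powr P" by (subst powr_mult) (use XY[of l] in auto)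
    finally show "(\<Sum>j\<in>J. norm (?u j - ?g j) powr P) \<le> (2 * (X l + Y l)) powr P" .
  next
    fix I :: "nat set" assume I: "finite I"
    have w0: "w l \<ge> 0" for l using w[of l] by simp
    have "(\<Sum>l\<in>I. (2 * (X l + Y l) * w l) powr Q) \<le> (\<Sum>l\<in>I. 4 powr Q * ((X l * w l) powr Q + (Y l * w l) powr Q))"
    proof (rule sum_mono)
      fix l
      have "(2 * (X l + Y l) * w l) powr Q = 2 powr Q * (X l * w l + Y l * w l) powr Q"
        using XY[of l] w0[of l] by (simp add: powr_mult[symmetric] distrib_right mult.assoc)
      also have "\<dots> \<le> 2 powr Q * (2 powr Q * ((X l * w l) powr Q + (Y l * w l) powr Q))"
        using XY[of l] w0[of l] Q by (intro mult_left_mono powr_add_le) auto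
      also have "\<dots> = 4 powr Q * ((X l * w l) powr Q + (Y l * w l) powr Q)"
        unfolding mult.assoc[symmetric] by (simp add: powr_mult[symmetric])
      finally show "(2 * (X l + Y l) * w l) powr Q \<le> 4 powr Q * ((X l * w l) powr Q + (Y l * w l) powr Q)" .
    qed
    also have "\<dots> = 4 powr Q * ((\<Sum>l\<in>I. (X l * w l) powr Q) + (\<Sum>l\<in>I. (Y l * w l) powr Q))"
      by (simp add: sum_distrib_left sum.distrib distrib_left)
    also have "\<dots> \<le> 4 powr Q * ((A + 1) powr Q * e1 + e2)"
    proof (intro mult_left_mono add_mono)
      have "(\<Sum>l\<in>I. (X l * w l) powr Q) = (\<Sum>l\<in>I - I0. A powr Q * (b l * w l) powr Q)"
        using I A b w0 by (intro sum.mono_neutral_cong_right) (auto simp: X_def powr_mult mult.assoc)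
      also have "\<dots> \<le> A powr Q * e1"
        unfolding sum_distrib_left[symmetric] using I by (intro mult_left_mono I0(2)) auto
      also have "\<dots> \<le> (A + 1) powr Q * e1" using A Q e1 by (intro mult_right_mono powr_mono2) auto
      finally show "(\<Sum>l\<in>I. (X l * w l) powr Q) \<le> (A + 1) powr Q * e1" .
      have "(\<Sum>l\<in>I. (Y l * w l) powr Q) = (\<Sum>l\<in>I \<inter> ?L. \<epsilon> powr Q * w l powr Q)"
        using I \<epsilon> w0 by (intro sum.mono_neutral_cong_right) (auto simp: Y_def powr_mult)
      also have "\<dots> \<le> (\<Sum>l\<in>?L. \<epsilon> powr Q * w l powr Q)" using Lfin by (intro sum_mono2) auto
      also have "\<dots> = e2 / (1 + W) * W" unfolding sum_distrib_left[symmetric] W_def[symmetric] \<epsilon>Q ..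
      also have "\<dots> \<le> e2" using e2 W by (simp add: divide_le_eq)
      finally show "(\<Sum>l\<in>I. (Y l * w l) powr Q) \<le> e2" .
    qed simp
    also have "\<dots> = e"
    proof -
      have "4 powr Q * ((A + 1) powr Q * e1) = e / 2" unfolding e1_def using A by simp
      moreover have "4 powr Q * e2 = e / 2" unfolding e2_def by simp
      ultimately show ?thesis by (simp add: distrib_left)
    qed
    finally show "(\<Sum>l\<in>I. (2 * (X l + Y l) * w l) powr Q) \<le> e" .
  qed
qed

end

section \<open>Coefficients of Schwartz functions\<close>

context cell_frame begin

text \<open>The samples are even summable over the nodes, with a sum that decreases faster than any power of
\<open>|\<xi>|\<close>, whereas the weights and the number of centers grow polynomially.\<close>

lemma schwartz_values_bounded:
  fixes \<beta> :: real
  assumes g: "g \<in> schwartz" and P: "P \<ge> 1" and Q: "Q \<ge> 1"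
    and count: "\<And>I. finite I \<Longrightarrow> (\<Sum>k\<in>I. 1 / (1 + norm (\<xi> k)) ^ M) \<le> B"
  obtains b T where "\<And>l. b l \<ge> 0"
    "\<And>l J. finite J \<Longrightarrow> (\<Sum>j\<in>J. norm (val (distr_of g) l j) powr P) \<le> b l powr P"
    "\<And>I. finite I \<Longrightarrow> (\<Sum>l\<in>I. (b l * (r l powr (- real CARD('n) / 2) / (2 * pi) ^ CARD('n) * (1
        + norm (\<xi> l)) powr \<beta>)) powr Q) \<le> T"
proof -
  \<comment> \<open>growth exponent of the volume factor \<open>r\<^sup>n\<close>, the packet normalization \<open>r\<^sup>-\<^sup>n\<^sup>/\<^sup>2\<close> and the weight taken together\<close>
  define s where "s = (1 - \<alpha>) * (real CARD('n) / 2) + \<bar>\<beta>\<bar>"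
  have mu: "min 1 \<alpha> > 0" using alpha by simp
  obtain N :: nat where "(s + real M) / min 1 \<alpha> \<le> real N" using real_arch_simple by blast
  then have N: "s + real M \<le> min 1 \<alpha> * real N" using mu by (simp add: pos_divide_le_eq mult.commute)
  obtain C where C: "\<forall>r \<xi> J z. r > 0 \<longrightarrow> finite J \<longrightarrow>
    norm \<xi> ^ N * (\<Sum>j\<in>J. norm (fourier (\<lambda>\<eta>. fourier g \<eta> * cell r \<xi> V \<eta>) (dual_node (r * \<Lambda>) j + z)))
    \<le> C * ((1 + r) ^ N * r ^ CARD('n))"
    using cell_decay[OF Lambda_pos V fourier_schwartz[OF g], of N] by blast
  define b where "b l = max C 0 * 2 ^ N * r l ^ CARD('n) * norm (\<xi> l) powr (- (min 1 \<alpha> * real N))" for l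
  define D where "D = max C 0 * 2 ^ N * (1 / (2 * pi) ^ CARD('n)) * 2 powr \<bar>\<beta>\<bar> * 2 ^ M"
  have D: "D \<ge> 0" by (simp add: D_def)
  have b0: "b l \<ge> 0" for l using r_pos[of l] by (simp add: b_def)
  have l1: "(\<Sum>j\<in>J. norm (val (distr_of g) l j)) \<le> b l" if J: "finite J" for l J
  proof -
    have "(\<Sum>j\<in>J. norm (val (distr_of g) l j)) = (\<Sum>j\<in>J. norm (fourier (\<lambda>\<eta>. fourier g \<eta> * U l \<eta>) (0 - node l j)))"
      unfolding band_value_distr_of[OF g U_schwartz] by simp
    also have "\<dots> \<le> b l"
      unfolding node_def
    proof (rule dual_node_sum_reflect[OF _ J])
      fix J :: "(int^'n) set" assume J: "finite J"
      let ?S = "\<Sum>j\<in>J. norm (fourier (\<lambda>\<eta>. fourier g \<eta> * U l \<eta>) (dual_node (r l * \<Lambda>) j + 0))"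
      have t: "norm (\<xi> l) \<ge> 1" "norm (\<xi> l) > 0" using xi_ge_1 xi_pos by auto
      have r1: "(1 + r l) ^ N \<le> 2 ^ N * (norm (\<xi> l) ^ N * norm (\<xi> l) powr (- (min 1 \<alpha> * real N)))"
      proof -
        have "r l \<le> norm (\<xi> l) powr (1 - min 1 \<alpha>)" "1 \<le> norm (\<xi> l) powr (1 - min 1 \<alpha>)"
          unfolding r_def using t by (auto intro!: powr_mono ge_one_powr_ge_zero)
        then have "(1 + r l) ^ N \<le> (2 * norm (\<xi> l) powr (1 - min 1 \<alpha>)) ^ N"
          using r_pos[of l] by (intro power_mono) auto
        also have "\<dots> = 2 ^ N * (norm (\<xi> l) powr real N * norm (\<xi> l) powr (- (min 1 \<alpha> * real N)))"
          using t unfolding powr_add[symmetric] by (simp add: power_mult_distrib powr_power algebra_simps)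
        finally show ?thesis using t by (simp add: powr_realpow)
      qed
      have "norm (\<xi> l) ^ N * ?S \<le> C * ((1 + r l) ^ N * r l ^ CARD('n))"
        using C r_pos[of l] J unfolding U_def by blast
      also have "\<dots> \<le> max C 0 * ((2 ^ N * (norm (\<xi> l) ^ N * norm (\<xi> l) powr (- (min 1 \<alpha> * real N))))
          * r l ^ CARD('n))"
        using r_pos[of l] by (intro mult_mono mult_right_mono r1) auto
      also have "\<dots> = norm (\<xi> l) ^ N * b l" by (simp only: b_def mult_ac)
      finally show "?S \<le> b l" using t by (simp only: mult_le_cancel_left_pos zero_less_power)
    qed
    finally show ?thesis .
  qed
  show ?thesis
  proof (rule that[where b=b and T="D powr Q * B"])
    show "b l \<ge> 0" for l by (rule b0)
    fix l and J :: "(int^'n) set" assume J: "finite J"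
    have "(\<Sum>j\<in>J. norm (val (distr_of g) l j) powr P) \<le> (\<Sum>j\<in>J. norm (val (distr_of g) l j)) powr P"
      by (rule sum_powr_le_powr_sum) (use P in auto)
    also have "\<dots> \<le> b l powr P" using P by (intro powr_mono2 l1 J sum_nonneg) auto
    finally show "(\<Sum>j\<in>J. norm (val (distr_of g) l j) powr P) \<le> b l powr P" .
  next
    fix I :: "nat set" assume I: "finite I"
    let ?w = "\<lambda>l. r l powr (- real CARD('n) / 2) / (2 * pi) ^ CARD('n) * (1 + norm (\<xi> l)) powr \<beta>"
    have bw: "b l * ?w l \<le> D * (1 / (1 + norm (\<xi> l)) ^ M)" for l
    proof -
      define t where "t = norm (\<xi> l)"
      have t: "t \<ge> 1" "t > 0" using xi_ge_1[of l] by (auto simp: t_def)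
      have 1: "r l ^ CARD('n) * r l powr (- real CARD('n) / 2) = t powr ((1 - \<alpha>) * (real CARD('n) / 2))"
      proof -
        have "r l ^ CARD('n) * r l powr (- real CARD('n) / 2) = r l powr (real CARD('n) + - real CARD('n) / 2)"
          unfolding powr_add powr_realpow[OF r_pos] ..
        also have "real CARD('n) + - real CARD('n) / 2 = real CARD('n) / 2" by simp
        finally show ?thesis by (simp add: r_def t_def powr_powr)
      qed
      have 2: "(1 + t) powr \<beta> \<le> 2 powr \<bar>\<beta>\<bar> * t powr \<bar>\<beta>\<bar>"
      proof -
        have "(1 + t) powr \<beta> \<le> (1 + t) powr \<bar>\<beta>\<bar>" using t by (intro powr_mono) auto
        also have "\<dots> \<le> (2 * t) powr \<bar>\<beta>\<bar>" using t by (intro powr_mono2) auto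
        finally show ?thesis using t by (simp add: powr_mult)
      qed
      have "b l * ?w l = max C 0 * 2 ^ N * (1 / (2 * pi) ^ CARD('n)) * (t powr ((1 - \<alpha>)
          * (real CARD('n) / 2)) * t powr (- (min 1 \<alpha> * real N)) * (1 + t) powr \<beta>)"
        unfolding b_def unfolding 1[symmetric] unfolding t_def by (simp add: mult_ac)
      also have "\<dots> \<le> max C 0 * 2 ^ N * (1 / (2 * pi) ^ CARD('n)) * (t powr ((1 - \<alpha>)
          * (real CARD('n) / 2)) * t powr (- (min 1 \<alpha> * real N)) * (2 powr \<bar>\<beta>\<bar> * t powr \<bar>\<beta>\<bar>))"
        by (intro mult_left_mono 2) auto
      also have "\<dots> = max C 0 * 2 ^ N * (1 / (2 * pi) ^ CARD('n)) * 2 powr \<bar>\<beta>\<bar> * t powr (s - min 1 \<alpha> * real N)"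
      proof -
        have "t powr (s - min 1 \<alpha> * real N) = t powr ((1 - \<alpha>) * (real CARD('n) / 2))
            * t powr (- (min 1 \<alpha> * real N)) * t powr \<bar>\<beta>\<bar>"
          unfolding s_def powr_add[symmetric] by (simp add: algebra_simps)
        then show ?thesis by (simp only: mult_ac)
      qed
      also have "\<dots> \<le> max C 0 * 2 ^ N * (1 / (2 * pi) ^ CARD('n)) * 2 powr \<bar>\<beta>\<bar> * (2 ^ M * (1 / (1 + t) ^ M))"
      proof (intro mult_left_mono)
        have "t powr (s - min 1 \<alpha> * real N) \<le> t powr (- real M)" using t N by (intro powr_mono) auto
        also have "\<dots> = 1 / t ^ M" using t by (simp add: powr_minus powr_realpow divide_inverse)
        also have "\<dots> \<le> 2 ^ M * (1 / (1 + t) ^ M)"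
        proof -
          have "(1 + t) ^ M \<le> (2 * t) ^ M" using t by (intro power_mono) auto
          then show ?thesis using t by (simp add: field_simps power_mult_distrib)
        qed
        finally show "t powr (s - min 1 \<alpha> * real N) \<le> 2 ^ M * (1 / (1 + t) ^ M)" .
      qed auto
      also have "\<dots> = D * (1 / (1 + norm (\<xi> l)) ^ M)" by (simp only: D_def t_def mult_ac)
      finally show ?thesis .
    qed
    have w0: "?w l \<ge> 0" for l by auto
    have "(\<Sum>l\<in>I. (b l * ?w l) powr Q) \<le> (\<Sum>l\<in>I. D powr Q * (1 / (1 + norm (\<xi> l)) ^ M))"
    proof (rule sum_mono)
      fix l
      let ?z = "1 / (1 + norm (\<xi> l)) ^ M"
      have z: "0 < ?z" "?z \<le> 1" by (auto intro!: divide_pos_pos zero_less_power add_pos_nonneg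
          simp: divide_le_eq_1)
      have "(b l * ?w l) powr Q \<le> (D * ?z) powr Q" using Q b0 w0
          by (intro powr_mono2 bw mult_nonneg_nonneg) auto
      also have "\<dots> = D powr Q * ?z powr Q" by (rule powr_mult)
      also have "\<dots> \<le> D powr Q * ?z powr 1" using z Q by (intro mult_left_mono powr_mono') auto
      also have "\<dots> = D powr Q * ?z" using z by simp
      finally show "(b l * ?w l) powr Q \<le> D powr Q * ?z" .
    qed
    also have "\<dots> \<le> D powr Q * B" unfolding sum_distrib_left[symmetric] by (intro mult_left_mono count I) auto
    finally show "(\<Sum>l\<in>I. (b l * ?w l) powr Q) \<le> D powr Q * B" .
  qed
qed

end

section \<open>Geometry of the centers\<close>

lemma subdyadic_centersE:
  fixes \<xi> :: "nat \<Rightarrow> real^'n::finite"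
  assumes "subdyadic_centers \<alpha> a \<rho> \<xi>"
  obtains P pt c where "candidate_order \<alpha> \<rho> P pt c" "bij_betw \<xi> UNIV (c ` {i. retained \<alpha> a \<rho> c i})"
  using assms unfolding subdyadic_centers_def by blast

lemma candidate_annulus:
  assumes "candidate_order \<alpha> \<rho> P pt c" obtains n where "c i \<in> annulus n"
proof -
  have "bij_betw c UNIV (\<Union>n. {pt n Q | Q. Q \<in> P n \<and> Q \<inter> annulus n \<noteq> {}})"
    using assms unfolding candidate_order_def by (elim conjE)
  then have "c i \<in> (\<Union>n. {pt n Q | Q. Q \<in> P n \<and> Q \<inter> annulus n \<noteq> {}})"
    by (rule bij_betwE[THEN bspec]) auto
  then obtain n Q where "c i = pt n Q" "Q \<in> P n" "Q \<inter> annulus n \<noteq> {}" by auto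
  moreover have "\<forall>n. \<forall>Q\<in>P n. Q \<inter> annulus n \<noteq> {} \<longrightarrow> pt n Q \<in> Q \<inter> annulus n"
    using assms unfolding candidate_order_def by (elim conjE)
  ultimately show ?thesis using that by auto
qed

lemma centers_norm_ge_1:
  fixes \<xi> :: "nat \<Rightarrow> real^'n::finite"
  assumes "subdyadic_centers \<alpha> a \<rho> \<xi>" shows "norm (\<xi> k) \<ge> 1"
proof -
  obtain P pt c where c: "candidate_order \<alpha> \<rho> P pt c" "bij_betw \<xi> UNIV (c ` {i. retained \<alpha> a \<rho> c i})"
    by (rule subdyadic_centersE[OF assms])
  obtain i where "\<xi> k = c i" using c(2) unfolding bij_betw_def by blast
  moreover obtain n where "c i \<in> annulus n" by (rule candidate_annulus[OF c(1)])
  moreover have "(1::real) \<le> 2 ^ n" by simp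
  ultimately show ?thesis unfolding annulus_def by (smt (verit) mem_Collect_eq)
qed

text \<open>Of two retained candidates the later one was tested against the earlier one.\<close>

lemma centers_separated:
  fixes \<xi> :: "nat \<Rightarrow> real^'n::finite"
  assumes "subdyadic_centers \<alpha> a \<rho> \<xi>" and kl: "k \<noteq> l"
  shows "ball (\<xi> k) (a * \<rho> * norm (\<xi> k) powr (1 - \<alpha>)) \<inter> ball (\<xi> l) (a * \<rho> * norm (\<xi> l) powr (1 - \<alpha>)) = {}"
proof -
  obtain P pt c where c: "candidate_order \<alpha> \<rho> P pt c" "bij_betw \<xi> UNIV (c ` {i. retained \<alpha> a \<rho> c i})"
    by (rule subdyadic_centersE[OF assms(1)])
  have sb: "separation_ball \<alpha> a \<rho> x = ball x (a * \<rho> * norm x powr (1 - \<alpha>))" for x :: "real^'n"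
    by (auto simp: separation_ball_def dist_norm norm_minus_commute)
  have dj: "separation_ball \<alpha> a \<rho> (c i) \<inter> separation_ball \<alpha> a \<rho> (c j) = {}"
    if "retained \<alpha> a \<rho> c i" "retained \<alpha> a \<rho> c j" "j < i" for i j
    using that retained.simps[of \<alpha> a \<rho> c i] by (auto simp: disjnt_def)
  obtain i where i: "\<xi> k = c i" "retained \<alpha> a \<rho> c i" using c(2) unfolding bij_betw_def by blast
  obtain j where j: "\<xi> l = c j" "retained \<alpha> a \<rho> c j" using c(2) unfolding bij_betw_def by blast
  have "\<xi> k \<noteq> \<xi> l" using c(2) kl unfolding bij_betw_def by (meson UNIV_I inj_onD)
  then have "i \<noteq> j" using i j by auto
  then show ?thesis using dj[OF i(2) j(2)] dj[OF j(2) i(2)] i(1) j(1) unfolding sb by (cases "j < i") auto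
qed

text \<open>The first candidate is always retained, and it lies in the first annulus because candidates are
ordered by annulus.\<close>

lemma centers_first_annulus:
  fixes \<xi> :: "nat \<Rightarrow> real^'n::finite"
  assumes "subdyadic_centers \<alpha> a \<rho> \<xi>" obtains k where "norm (\<xi> k) < 2"
proof -
  obtain P pt c where c: "candidate_order \<alpha> \<rho> P pt c" "bij_betw \<xi> UNIV (c ` {i. retained \<alpha> a \<rho> c i})"
    by (rule subdyadic_centersE[OF assms])
  have e: "axis undefined 1 \<in> (annulus 0 :: (real^'n) set)" by (simp add: annulus_def)
  have "partition_on UNIV (P 0)" using c(1) unfolding candidate_order_def cube_partition_def by blast
  then obtain Q where Q: "Q \<in> P 0" "axis undefined 1 \<in> Q" unfolding partition_on_def by blast
  have QA: "Q \<inter> annulus 0 \<noteq> {}" using e Q(2) by blast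
  then have "pt 0 Q \<in> annulus 0" "pt 0 Q \<in> range c"
    using c(1) Q(1) unfolding candidate_order_def bij_betw_def by blast+
  then obtain j where j: "c j \<in> annulus 0" by auto
  obtain m where m: "c 0 \<in> annulus m" by (rule candidate_annulus[OF c(1)])
  have "m = 0"
  proof (rule ccontr)
    assume "m \<noteq> 0"
    then have "j < 0" using c(1) j m unfolding candidate_order_def by (meson not_gr_zero)
    then show False by simp
  qed
  then have "norm (c 0) < 2" using m by (simp add: annulus_def)
  moreover have "retained \<alpha> a \<rho> c 0" by (simp add: retained.simps[of _ _ _ _ 0])
  then have "c 0 \<in> range \<xi>" using c(2) unfolding bij_betw_def by blast
  ultimately show ?thesis using that by auto
qed

text \<open>The separation balls have radii bounded below by a negative power of \<open>1 + |\<xi>|\<close>. Shrinking them to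
that size gives disjoint balls of radius at most \<open>1\<close>, to which the packing bound applies.\<close>

lemma centers_sum_bound:
  fixes \<xi> :: "nat \<Rightarrow> real^'n::finite"
  assumes c: "subdyadic_centers \<alpha> a \<rho> \<xi>" and a: "a > 0" and \<rho>: "\<rho> > 0"
  obtains M B where "\<And>I. finite I \<Longrightarrow> (\<Sum>k\<in>I. 1 / (1 + norm (\<xi> k)) ^ M) \<le> B"
proof -
  let ?d = "CARD('n)"
  obtain Pb where Pb: "\<And>I (y :: nat \<Rightarrow> real^'n) s. finite I \<Longrightarrow> (\<And>i. i \<in> I \<Longrightarrow> 0 < s i \<and> s i \<le> 1) \<Longrightarrow>
      (\<And>i j. i \<in> I \<Longrightarrow> j \<in> I \<Longrightarrow> i \<noteq> j \<Longrightarrow> ball (y i) (s i) \<inter> ball (y j) (s j) = {}) \<Longrightarrow>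
      (\<Sum>i\<in>I. s i ^ ?d / (1 + norm (y i)) ^ (2 * ?d)) \<le> Pb"
    by (rule packing_bound[OF order_refl, where 'i=nat and 'n='n]) blast
  \<comment> \<open>an integer exponent that dominates \<open>|1 - \<alpha>|\<close>, so that \<open>|\<xi>|\<^sup>1\<^sup>-\<^sup>\<alpha> \<ge> (1 + |\<xi>|)\<^sup>-\<^sup>m\<close>\<close>
  define m where "m = nat \<lceil>\<bar>1 - \<alpha>\<bar>\<rceil>"
  define c0 where "c0 = min 1 (a * \<rho>)"
  have c0: "c0 > 0" "c0 \<le> 1" "c0 \<le> a * \<rho>" using a \<rho> by (auto simp: c0_def)
  define s where "s k = c0 * (1 / (1 + norm (\<xi> k)) ^ m)" for k
  have x1: "norm (\<xi> k) \<ge> 1" for k by (rule centers_norm_ge_1[OF c])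
  have p: "0 < (1 + norm (\<xi> k)) ^ i" "1 \<le> (1 + norm (\<xi> k)) ^ i" for k i
    by (auto intro!: zero_less_power one_le_power add_pos_nonneg)
  have s: "0 < s k" "s k \<le> 1" for k
  proof -
    define x where "x = 1 / (1 + norm (\<xi> k)) ^ m"
    have x: "0 < x" "x \<le> 1" unfolding x_def
      using divide_pos_pos[OF zero_less_one p(1)] divide_left_mono[OF p(2) zero_le_one] p(1) by simp_all
    have "s k = c0 * x" by (simp add: s_def x_def)
    then show "0 < s k" "s k \<le> 1" using c0 x by (auto intro: mult_le_one)
  qed
  have sr: "s k \<le> a * \<rho> * norm (\<xi> k) powr (1 - \<alpha>)" for k
  proof -
    have t: "norm (\<xi> k) \<ge> 1" "norm (\<xi> k) > 0" using x1[of k] by linarith+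
    have "1 / (1 + norm (\<xi> k)) ^ m \<le> 1 / norm (\<xi> k) ^ m"
      using t by (intro divide_left_mono power_mono mult_pos_pos zero_less_power) auto
    also have "\<dots> = norm (\<xi> k) powr (- real m)" using t by (simp add: powr_minus powr_realpow divide_inverse)
    also have "\<dots> \<le> norm (\<xi> k) powr (1 - \<alpha>)"
    proof (rule powr_mono)
      have "\<bar>1 - \<alpha>\<bar> \<le> real m" unfolding m_def by linarith
      then show "- real m \<le> 1 - \<alpha>" by linarith
    qed (use t in simp)
    finally show ?thesis unfolding s_def using c0 a \<rho> by (intro mult_mono) auto
  qed
  have disj: "ball (\<xi> i) (s i) \<inter> ball (\<xi> j) (s j) = {}" if "i \<noteq> j" for i j
    using centers_separated[OF c that] subset_ball[OF sr[of i], of "\<xi> i"] subset_ball[OF sr[of j], of "\<xi>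
        j"] by blast
  show ?thesis
  proof (rule that[of "m * ?d + 2 * ?d" "Pb / c0 ^ ?d"])
    fix I :: "nat set" assume I: "finite I"
    have "(\<Sum>k\<in>I. s k ^ ?d / (1 + norm (\<xi> k)) ^ (2 * ?d)) \<le> Pb" using Pb[OF I, of s \<xi>] s disj by blast
    moreover have "s k ^ ?d / (1 + norm (\<xi> k)) ^ (2 * ?d) = c0 ^ ?d * (1 / (1 + norm (\<xi> k)) ^ (m * ?d
        + 2 * ?d))" for k
      unfolding s_def by (simp add: power_mult_distrib power_divide power_add power_mult)
    ultimately have "c0 ^ ?d * (\<Sum>k\<in>I. 1 / (1 + norm (\<xi> k)) ^ (m * ?d + 2 * ?d)) \<le> Pb"
      by (simp only: sum_distrib_left)
    then show "(\<Sum>k\<in>I. 1 / (1 + norm (\<xi> k)) ^ (m * ?d + 2 * ?d)) \<le> Pb / c0 ^ ?d"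
      using c0 by (subst pos_le_divide_eq) (auto simp: mult.commute)
  qed
qed

lemma centers_finite:
  fixes \<xi> :: "nat \<Rightarrow> real^'n::finite"
  assumes "subdyadic_centers \<alpha> a \<rho> \<xi>" "a > 0" "\<rho> > 0"
  shows "finite {k. norm (\<xi> k) \<le> X}"
proof -
  obtain M B where B: "\<And>I. finite I \<Longrightarrow> (\<Sum>k\<in>I. 1 / (1 + norm (\<xi> k)) ^ M) \<le> B"
    by (rule centers_sum_bound[OF assms]) blast
  show ?thesis
  proof (rule conjunct1, rule finite_if_finite_subsets_card_bdd)
    fix G assume G: "G \<subseteq> {k. norm (\<xi> k) \<le> X}" "finite G"
    have X: "(1 + norm (\<xi> k)) ^ M \<le> (1 + \<bar>X\<bar>) ^ M" if "k \<in> G" for k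
      using G that by (intro power_mono) (auto intro: order_trans[OF _ abs_ge_self])
    have pos: "0 < (1 + \<bar>X\<bar>) ^ M" "0 < (1 + norm (\<xi> k)) ^ M" for k
        by (auto intro!: zero_less_power add_pos_nonneg)
    have "real (card G) * (1 / (1 + \<bar>X\<bar>) ^ M) = (\<Sum>k\<in>G. 1 / (1 + \<bar>X\<bar>) ^ M)" by simp
    also have "\<dots> \<le> (\<Sum>k\<in>G. 1 / (1 + norm (\<xi> k)) ^ M)"
      using X pos by (intro sum_mono divide_left_mono mult_pos_pos) auto
    also have "\<dots> \<le> B" by (rule B[OF G(2)])
    finally have "real (card G) \<le> B * (1 + \<bar>X\<bar>) ^ M" using pos(1) by (simp add: pos_divide_le_eq)
    then show "card G \<le> nat \<lceil>B * (1 + \<bar>X\<bar>) ^ M\<rceil>" by linarith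
  qed
qed

text \<open>The covering constant speaks about \<open>|\<eta>| \<ge> 1\<close>. The unit ball is within distance \<open>3\<close> of a center in
the first annulus, and \<open>3\<close> is below the inner radius there by the lower bound on \<open>R0\<close>.\<close>

lemma centers_cover:
  fixes \<xi> :: "nat \<Rightarrow> real^'n::finite"
  assumes c: "subdyadic_centers \<alpha> a \<rho> \<xi>" and A: "covering_constant TYPE('n) \<alpha> a \<rho>0 A"
    and \<rho>: "0 < \<rho>" "\<rho> \<le> \<rho>0" and R0: "A * \<rho> < R0" "3 * 2 powr (max (\<alpha> - 1) 0) < R0"
  obtains k where "norm (\<eta> - \<xi> k) \<le> R0 * norm (\<xi> k) powr (1 - \<alpha>)"
proof (cases "norm \<eta> \<ge> 1")
  case True
  then obtain k where k: "norm (\<eta> - \<xi> k) \<le> A * \<rho> * norm (\<xi> k) powr (1 - \<alpha>)"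
    using A c \<rho> unfolding covering_constant_def by blast
  also have "\<dots> \<le> R0 * norm (\<xi> k) powr (1 - \<alpha>)" using R0 by (intro mult_right_mono) auto
  finally show ?thesis by (rule that)
next
  case False
  obtain k where k: "norm (\<xi> k) < 2" by (rule centers_first_annulus[OF c])
  have k1: "norm (\<xi> k) \<ge> 1" by (rule centers_norm_ge_1[OF c])
  have "norm (\<eta> - \<xi> k) \<le> 3" using norm_triangle_ineq4[of \<eta> "\<xi> k"] False k by linarith
  also have "3 \<le> R0 * norm (\<xi> k) powr (1 - \<alpha>)"
  proof -
    have "2 powr (- max (\<alpha> - 1) 0) \<le> norm (\<xi> k) powr (1 - \<alpha>)"
    proof (cases "\<alpha> \<le> 1")
      case True then show ?thesis using k1 by (simp add: ge_one_powr_ge_zero)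
    next
      case False
      have "norm (\<xi> k) powr (\<alpha> - 1) \<le> 2 powr (\<alpha> - 1)" using False k k1 by (intro powr_mono2) auto
      then have "inverse (2 powr (\<alpha> - 1)) \<le> inverse (norm (\<xi> k) powr (\<alpha> - 1))"
        using k1 by (intro le_imp_inverse_le) auto
      then show ?thesis using False by (simp add: powr_minus[symmetric])
    qed
    then have "(3 * 2 powr (max (\<alpha> - 1) 0)) * 2 powr (- max (\<alpha> - 1) 0) \<le> R0 * norm (\<xi> k) powr (1 - \<alpha>)"
      using R0(2) by (intro mult_mono) (auto intro: order_trans[OF _ less_imp_le[OF R0(2)]])
    moreover have "2 powr (max (\<alpha> - 1) 0) * 2 powr (- max (\<alpha> - 1) 0) = (1::real)"
      unfolding powr_add[symmetric] by simp
    ultimately show ?thesis by simp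
  qed
  finally show ?thesis by (rule that)
qed

section \<open>Mixed norms\<close>

lemma mod_norm_le:
  assumes P: "P \<ge> 1" and Q: "Q \<ge> 1" and E: "\<And>k. E k \<ge> 0" and T: "T \<ge> 0"
    and inner: "\<And>k J. finite J \<Longrightarrow> (\<Sum>j\<in>J. norm (frame_coeff \<alpha> b \<phi> \<rho> \<xi> f k j) powr P) \<le> E k powr P"
    and outer: "\<And>I. finite I \<Longrightarrow> (\<Sum>k\<in>I. (E k * (1 + norm (\<xi> k)) powr \<beta>) powr Q) \<le> T powr Q"
  shows "mod_norm \<alpha> \<beta> b \<phi> \<rho> \<xi> (ennreal P) (ennreal Q) f \<le> ennreal T"
  unfolding mod_norm_def
proof (rule ell_norm_le[OF Q T, of "\<lambda>k. E k * (1 + norm (\<xi> k)) powr \<beta>"])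
  fix k
  have "ell_norm (ennreal P) (\<lambda>j. ennreal (norm (frame_coeff \<alpha> b \<phi> \<rho> \<xi> f k j))) \<le> ennreal (E k)"
    by (rule ell_norm_le[OF P E, of "\<lambda>j. norm (frame_coeff \<alpha> b \<phi> \<rho> \<xi> f k j)"]) (use inner in auto)
  then show "ell_norm (ennreal P) (\<lambda>j. ennreal (norm (frame_coeff \<alpha> b \<phi> \<rho> \<xi> f k j))) * ennreal ((1
      + norm (\<xi> k)) powr \<beta>)
      \<le> ennreal (E k * (1 + norm (\<xi> k)) powr \<beta>)"
    using E[of k] by (simp add: ennreal_mult mult_right_mono)
qed (use E outer in auto)

lemma mod_norm_finiteD:
  assumes P: "P \<ge> 1" and Q: "Q \<ge> 1" and \<xi>: "\<And>k. norm (\<xi> k) \<ge> 1"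
    and fin: "mod_norm \<alpha> \<beta> b \<phi> \<rho> \<xi> (ennreal P) (ennreal Q) f < \<infinity>"
  obtains E T where "\<And>k. E k \<ge> 0"
    "\<And>k J. finite J \<Longrightarrow> (\<Sum>j\<in>J. norm (frame_coeff \<alpha> b \<phi> \<rho> \<xi> f k j) powr P) \<le> E k powr P"
    "\<And>I. finite I \<Longrightarrow> (\<Sum>k\<in>I. (E k * (1 + norm (\<xi> k)) powr \<beta>) powr Q) \<le> T"
proof -
  let ?v = "\<lambda>k. ell_norm (ennreal P) (\<lambda>j. ennreal (norm (frame_coeff \<alpha> b \<phi> \<rho> \<xi> f k j)))"
  let ?w = "\<lambda>k. (1 + norm (\<xi> k)) powr \<beta>"
  have w: "?w k > 0" for k using \<xi>[of k] by (simp add: add_pos_nonneg less_imp_neq[symmetric])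
  obtain c B where c: "\<And>k. c k \<ge> 0" "\<And>k. ?v k * ennreal (?w k) = ennreal (c k)"
    "\<And>I. finite I \<Longrightarrow> (\<Sum>k\<in>I. c k powr Q) \<le> B powr Q"
    by (rule ell_norm_finiteD[OF Q fin[unfolded mod_norm_def]]) blast
  have vfin: "?v k < \<infinity>" for k
    using c(2)[of k] w[of k] by (cases "?v k") (auto simp: ennreal_top_mult ennreal_mult_eq_top_iff less_top)
  have "\<exists>E. E \<ge> 0 \<and> ?v k = ennreal E \<and> (\<forall>J. finite J \<longrightarrow> (\<Sum>j\<in>J. norm (frame_coeff \<alpha> b \<phi> \<rho> \<xi> f k j) powr P)
      \<le> E powr P)" for k
  proof (rule ell_norm_finiteD[OF P vfin[of k]])
    fix c' E
    assume a: "\<And>i. 0 \<le> c' i" "0 \<le> E" "\<And>i. ennreal (norm (frame_coeff \<alpha> b \<phi> \<rho> \<xi> f k i))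
        = ennreal (c' i)" "?v k = ennreal E"
      "\<And>J. finite J \<Longrightarrow> (\<Sum>j\<in>J. c' j powr P) \<le> E powr P"
    have "norm (frame_coeff \<alpha> b \<phi> \<rho> \<xi> f k i) = c' i" for i using a(1,3)[of i] by simp
    then show ?thesis using a(2,4,5) by (intro exI[of _ E]) auto
  qed
  then have "\<forall>k. \<exists>E. E \<ge> 0 \<and> ?v k = ennreal E \<and> (\<forall>J. finite J
      \<longrightarrow> (\<Sum>j\<in>J. norm (frame_coeff \<alpha> b \<phi> \<rho> \<xi> f k j) powr P) \<le> E powr P)"
    by blast
  from choice[OF this] obtain E where E: "\<And>k. E k \<ge> 0" "\<And>k. ?v k = ennreal (E k)"
    "\<And>k J. finite J \<Longrightarrow> (\<Sum>j\<in>J. norm (frame_coeff \<alpha> b \<phi> \<rho> \<xi> f k j) powr P) \<le> E k powr P" by blast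
  have "c k = E k * ?w k" for k
  proof -
    have "ennreal (E k * ?w k) = ennreal (c k)" using c(2)[of k] E(1)[of k] unfolding E(2)
        by (simp add: ennreal_mult)
    then show ?thesis using c(1)[of k] E(1)[of k] by (subst (asm) ennreal_inj) auto
  qed
  then show ?thesis using c(3) by (intro that[OF E(1) E(3), of "B powr Q"]) auto
qed

section \<open>Density of the Schwartz functions\<close>

theorem proposition4p10:
  fixes \<alpha> \<beta> a b \<rho>0 A R0 R1 m0 \<rho> :: real
    and \<phi> :: "real^'n::finite \<Rightarrow> real"
    and \<xi> :: "nat \<Rightarrow> real^'n"
    and p q :: ennreal
  assumes "\<alpha> > 0"
    and "a > 0" and "b > 0" and "\<rho>0 > 0"
    and "covering_constant TYPE('n) \<alpha> a \<rho>0 A"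
    and "subdyadic_frame_pair \<alpha> a b \<rho>0 A R0 R1 m0 \<phi> \<rho> \<xi>"
    and "1 \<le> p" and "p < \<infinity>" and "1 \<le> q" and "q < \<infinity>"
  shows "distr_of ` schwartz \<subseteq> mod_space \<alpha> \<beta> b \<phi> \<rho> \<xi> p q \<and>
    (\<forall>f \<in> mod_space \<alpha> \<beta> b \<phi> \<rho> \<xi> p q. \<forall>\<epsilon>>0.
       \<exists>g \<in> schwartz. mod_norm \<alpha> \<beta> b \<phi> \<rho> \<xi> p q (\<lambda>h. f h - distr_of g h) < \<epsilon>)"
proof -
  let ?\<phi> = "\<lambda>t. complex_of_real (\<phi> t)"
  define V where "V = fourier ?\<phi>"
  define \<Lambda> where "\<Lambda> = pi / (b * \<rho>)"
  have win: "?\<phi> \<in> schwartz" "\<And>t. \<phi> (- t) = \<phi> t" "smooth V" "closure {\<zeta>. V \<zeta> \<noteq> 0} \<subseteq> ball 0 R1" "m0 > 0"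
    "\<And>\<zeta>. norm \<zeta> \<le> R0 \<Longrightarrow> m0 \<le> norm (V \<zeta>)" "3 * 2 powr (max (\<alpha> - 1) 0) < R0" "R0 < R1"
    using assms(6) unfolding subdyadic_frame_pair_def subdyadic_window_def Let_def V_def by blast+
  have pair: "0 < \<rho>" "\<rho> \<le> \<rho>0" "subdyadic_centers \<alpha> a \<rho> \<xi>" "A * \<rho> < R0" "b * \<rho> * R1 < pi"
    using assms(6) unfolding subdyadic_frame_pair_def by blast+
  have b\<rho>: "b * \<rho> > 0" using assms(3) pair(1) by simp
  interpret cell_frame \<alpha> \<Lambda> R1 V \<xi>
  proof
    show "\<alpha> > 0" by fact
    have "(0::real) < 3 * 2 powr (max (\<alpha> - 1) 0)" by simp
    then show "0 < R1" using win(7,8) by linarith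
    show "R1 < \<Lambda>" unfolding \<Lambda>_def using b\<rho> pair(5) by (simp add: pos_less_divide_eq mult.commute)
    have "V \<zeta> = 0" if "norm \<zeta> > R1" for \<zeta>
    proof (rule ccontr)
      assume "V \<zeta> \<noteq> 0"
      then have "\<zeta> \<in> ball 0 R1" using win(4) closure_subset[of "{\<zeta>. V \<zeta> \<noteq> 0}"] by blast
      then show False using that by simp
    qed
    then show "supported R1 V" using win(3) by (simp add: supported_def)
    show x1: "norm (\<xi> k) \<ge> 1" for k by (rule centers_norm_ge_1[OF pair(3)])
    show "finite {k. norm (\<xi> k) \<le> X}" for X by (rule centers_finite[OF pair(3) assms(2) pair(1)])
    show "\<exists>k. cell (norm (\<xi> k) powr (1 - \<alpha>)) (\<xi> k) V \<eta> \<noteq> 0" for \<eta>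
    proof -
      obtain k where k: "norm (\<eta> - \<xi> k) \<le> R0 * norm (\<xi> k) powr (1 - \<alpha>)"
        by (rule centers_cover[OF pair(3) assms(5) pair(1,2,4) win(7)])
      have "norm (\<xi> k) powr (1 - \<alpha>) > 0" using x1[of k] by (auto simp: less_le)
      then have "norm ((1 / norm (\<xi> k) powr (1 - \<alpha>)) *\<^sub>R (\<eta> - \<xi> k)) \<le> R0" using k by (simp add: pos_divide_le_eq)
      from win(6)[OF this] have "cell (norm (\<xi> k) powr (1 - \<alpha>)) (\<xi> k) V \<eta> \<noteq> 0"
        using win(5) unfolding cell_def by auto
      then show ?thesis by blast
    qed
  qed
  define P where "P = enn2real p"
  define Q where "Q = enn2real q"
  have PQ: "p = ennreal P" "q = ennreal Q" "P \<ge> 1" "Q \<ge> 1"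
  proof -
    show "p = ennreal P" "q = ennreal Q" using assms(8,10) by (auto simp: P_def Q_def)
    then have "1 \<le> ennreal P" "1 \<le> ennreal Q" using assms(7,9) by auto
    then show "P \<ge> 1" "Q \<ge> 1" by (simp_all add: ennreal_ge_1)
  qed
  define C where "C k = r k powr (- real CARD('n) / 2) / (2 * pi) ^ CARD('n)" for k
  have C: "C k > 0" for k unfolding C_def using r_pos[of k] by (intro divide_pos_pos) auto
  define w where "w k = (1 + norm (\<xi> k)) powr \<beta>" for k
  have w: "w k > 0" for k unfolding w_def using xi_ge_1[of k] by (auto simp: less_le)
  obtain z where z: "\<And>k j. norm (z k j) = C k"
    "\<And>f k j. f \<in> tempered \<Longrightarrow> frame_coeff \<alpha> b \<phi> \<rho> \<xi> f k j = z k j * val f k j"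
  proof
    fix k and j :: "int^'n"
    let ?z = "complex_of_real (C k) * cis (- (\<xi> k \<bullet> lattice_node \<alpha> b \<rho> \<xi> k j))"
    show "norm ?z = C k" using C[of k] by (simp add: norm_mult)
    fix f :: "(real^'n \<Rightarrow> complex) \<Rightarrow> complex" assume f: "f \<in> tempered"
    have "\<xi> k \<noteq> 0" using xi_pos[of k] by auto
    then have "frame_coeff \<alpha> b \<phi> \<rho> \<xi> f k j =
        (complex_of_real (r k powr (- real CARD('n) / 2) / (2 * pi) ^ CARD('n))
            * cis (- (\<xi> k \<bullet> lattice_node \<alpha> b \<rho> \<xi> k j))) *
        band_value f (cell (r k) (\<xi> k) (fourier ?\<phi>)) (dual_node (r k * (pi / (b * \<rho>))) j)"
      by (rule frame_coeff_band_value[where \<phi>=\<phi> and \<xi>=\<xi> and k=k, OF f win(1,2) _ r_def _ b\<rho>])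
        (use U_schwartz[of k, unfolded U_def, unfolded V_def] in auto)
    then show "frame_coeff \<alpha> b \<phi> \<rho> \<xi> f k j = ?z * val f k j"
      unfolding U_def node_def C_def unfolding V_def \<Lambda>_def .
  qed
  have scale: "(\<Sum>j\<in>J. (C k * norm (y j)) powr P) \<le> (C k * E) powr P"
    if "(\<Sum>j\<in>J. norm (y j) powr P) \<le> E powr P" "E \<ge> 0" for k J E and y :: "int^'n \<Rightarrow> complex"
  proof -
    have "(\<Sum>j\<in>J. (C k * norm (y j)) powr P) = C k powr P * (\<Sum>j\<in>J. norm (y j) powr P)"
      using C[of k] by (simp add: powr_mult sum_distrib_left)
    also have "\<dots> \<le> C k powr P * E powr P" by (intro mult_left_mono that) auto
    also have "\<dots> = (C k * E) powr P" using C[of k] that(2) by (simp add: powr_mult)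
    finally show ?thesis .
  qed
  have "distr_of g \<in> mod_space \<alpha> \<beta> b \<phi> \<rho> \<xi> p q" if g: "g \<in> schwartz" for g
  proof -
    obtain M B where MB: "\<And>I. finite I \<Longrightarrow> (\<Sum>k\<in>I. 1 / (1 + norm (\<xi> k)) ^ M) \<le> B"
      by (rule centers_sum_bound[OF pair(3) assms(2) pair(1)]) blast
    obtain v T where v: "\<And>l. v l \<ge> 0"
      "\<And>l J. finite J \<Longrightarrow> (\<Sum>j\<in>J. norm (val (distr_of g) l j) powr P) \<le> v l powr P"
      "\<And>I. finite I \<Longrightarrow> (\<Sum>l\<in>I. (v l * (C l * w l)) powr Q) \<le> T"
      unfolding C_def w_def by (rule schwartz_values_bounded[OF g PQ(3,4) MB]) blast+
    have T: "T \<ge> 0" using v(3)[of "{}"] by simp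
    have "mod_norm \<alpha> \<beta> b \<phi> \<rho> \<xi> p q (distr_of g) \<le> ennreal (T powr (1 / Q))"
      unfolding PQ(1,2)
    proof (rule mod_norm_le[OF PQ(3,4), of "\<lambda>k. C k * v k"])
      show "C k * v k \<ge> 0" for k using C[of k] v(1)[of k] by simp
      show "(\<Sum>j\<in>J. norm (frame_coeff \<alpha> b \<phi> \<rho> \<xi> (distr_of g) k j) powr P) \<le> (C k * v k) powr P"
          if "finite J" for k J
        using scale[OF v(2)[OF that] v(1)] by (simp add: z distr_of_tempered[OF g] norm_mult)
      show "(\<Sum>k\<in>I. (C k * v k * (1 + norm (\<xi> k)) powr \<beta>) powr Q) \<le> (T powr (1 / Q)) powr Q" if "finite I" for I
        using v(3)[OF that] T PQ(4) by (simp add: powr_powr w_def mult_ac)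
    qed simp
    then have "mod_norm \<alpha> \<beta> b \<phi> \<rho> \<xi> p q (distr_of g) < \<infinity>" by (rule le_less_trans) simp
    then show ?thesis using distr_of_tempered[OF g] by (simp add: mod_space_def)
  qed
  moreover have "\<exists>g\<in>schwartz. mod_norm \<alpha> \<beta> b \<phi> \<rho> \<xi> p q (\<lambda>h. f h - distr_of g h) < \<epsilon>"
    if fm: "f \<in> mod_space \<alpha> \<beta> b \<phi> \<rho> \<xi> p q" and \<epsilon>: "\<epsilon> > 0" for f \<epsilon>
  proof -
    have f: "f \<in> tempered" using fm by (simp add: mod_space_def)
    have fin: "mod_norm \<alpha> \<beta> b \<phi> \<rho> \<xi> (ennreal P) (ennreal Q) f < \<infinity>"
      using fm by (simp add: mod_space_def PQ(1,2))
    obtain E T where E: "\<And>k. E k \<ge> 0"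
      "\<And>k J. finite J \<Longrightarrow> (\<Sum>j\<in>J. norm (frame_coeff \<alpha> b \<phi> \<rho> \<xi> f k j) powr P) \<le> E k powr P"
      "\<And>I. finite I \<Longrightarrow> (\<Sum>k\<in>I. (E k * w k) powr Q) \<le> T"
      unfolding w_def by (rule mod_norm_finiteD[OF PQ(3,4) xi_ge_1 fin]) blast
    obtain y where y: "0 < y" "y < \<epsilon>" using dense[OF \<epsilon>] by blast
    then obtain e where e: "y = ennreal e" "e > 0" by (cases y) (auto simp: ennreal_less_zero_iff)
    define bb where "bb k = E k / C k" for k
    have inner: "(\<Sum>j\<in>J. norm (val f l j) powr P) \<le> bb l powr P" if J: "finite J" for l J
    proof -
      have "C l powr P * (\<Sum>j\<in>J. norm (val f l j) powr P) = (\<Sum>j\<in>J. norm (frame_coeff \<alpha> b \<phi> \<rho> \<xi> f l j) powr P)"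
        using C[of l] by (simp add: z f norm_mult powr_mult sum_distrib_left)
      also have "\<dots> \<le> E l powr P" by (rule E(2)[OF J])
      also have "\<dots> = C l powr P * bb l powr P"
        using C[of l] E(1)[of l] by (simp add: bb_def powr_mult[symmetric])
      finally show ?thesis using C[of l] by simp
    qed
    have outer: "(\<Sum>l\<in>I. (bb l * (C l * w l)) powr Q) \<le> T" if "finite I" for I
    proof -
      have "bb l * (C l * w l) = E l * w l" for l using C[of l] by (simp add: bb_def)
      then show ?thesis using E(3)[OF that] by (simp only:)
    qed
    obtain g E' where g: "g \<in> schwartz" "\<And>l. E' l \<ge> 0"
      "\<And>l J. finite J \<Longrightarrow> (\<Sum>j\<in>J. norm (val f l j - val (distr_of g) l j) powr P) \<le> E' l powr P"
      "\<And>I. finite I \<Longrightarrow> (\<Sum>l\<in>I. (E' l * (C l * w l)) powr Q) \<le> e powr Q"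
    proof (rule schwartz_dense_values[OF f PQ(3,4), of "e powr Q" bb "\<lambda>l. C l * w l" T])
      show "e powr Q > 0" using e(2) by simp
      show "bb l \<ge> 0" for l using E(1)[of l] C[of l] by (simp add: bb_def)
      show "C l * w l > 0" for l using C[of l] w[of l] by simp
    qed (use inner outer in auto)
    have "mod_norm \<alpha> \<beta> b \<phi> \<rho> \<xi> p q (\<lambda>h. f h - distr_of g h) \<le> ennreal e"
      unfolding PQ(1,2)
    proof (rule mod_norm_le[OF PQ(3,4), of "\<lambda>k. C k * E' k"])
      show "C k * E' k \<ge> 0" for k using C[of k] g(2)[of k] by simp
      show "e \<ge> 0" using e by simp
      have fc: "frame_coeff \<alpha> b \<phi> \<rho> \<xi> (\<lambda>h. f h - distr_of g h) k j = z k j * (val f k j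
          - val (distr_of g) k j)" for k j
        using z(2)[OF f, of k j] z(2)[OF distr_of_tempered[OF g(1)], of k j]
        by (simp add: frame_coeff_def pairing_def right_diff_distrib)
      show "(\<Sum>j\<in>J. norm (frame_coeff \<alpha> b \<phi> \<rho> \<xi> (\<lambda>h. f h - distr_of g h) k j) powr P) \<le> (C k
          * E' k) powr P" if "finite J" for k J
        using scale[OF g(3)[OF that] g(2)] by (simp add: fc z norm_mult)
      show "(\<Sum>k\<in>I. (C k * E' k * (1 + norm (\<xi> k)) powr \<beta>) powr Q) \<le> e powr Q" if "finite I" for I
        using g(4)[OF that] by (simp add: w_def mult_ac)
    qed
    then have "mod_norm \<alpha> \<beta> b \<phi> \<rho> \<xi> p q (\<lambda>h. f h - distr_of g h) < \<epsilon>"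
      using y e(1) by (meson le_less_trans)
    then show ?thesis using g(1) by blast
  qed
  ultimately show ?thesis by blast
qed

end
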